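(* Let $n\ge1$ be an integer and $\alpha>0$. Let $X_1,\dots,X_n,Y_1,\dots,Y_n$ be mutually independent random variables, where $X_i$ has distribution $F_i$ on $\mathbb{R}$ and $Y_i$ has distribution $G_i$ on $(0,\infty)$. Assume that $F_i$ and $G_i$, $1\le i\le n$, belong to $\mathcal{R}_{11}(\alpha)$; more specifically, as $x\to\infty$, $$\overline{F_i}(x)\sim x^{-\alpha}l_i(x)=x^{-\alpha}f_i(\ln x),\qquad \overline{G_i}(x)\sim x^{-\alpha}l_i^\star(x)=x^{-\alpha}f_i^\star(\ln x),$$ where $l_i,l_i^\star$ are slowly varying and $\int_0^\infty f_i(y)\,dy=\int_0^\infty f_i^\star(y)\,dy=\infty$. Assume also that $$f_{k-1}(x)=o\big(f_k\otimes f^\star_k(x)\big)\quad\text{for all } 2\le k\le n.$$ Put $S_0=0$, $S_k=\sum_{i=1}^k X_i\prod_{j=1}^iY_j$, $M_n=\max_{0\le k\le n}S_k$ and $\psi(x,n)=P(M_n>x)$. Then, as $x\to\infty$: i) If $f_i\in\mathcal{R}_{\gamma_i}$ with $\gamma_i>-1$ and $f_i^\star\in\mathcal{R}_{\gamma_i^\star}$ with $\gamma_i^\star>-1$ for $1\le i\le n$, then $$\psi(x,n)\sim P(S_n>x)\sim\alpha^nx^{-\alpha}(\ln x)^nf_n(\ln x)\prod_{i=1}^nf^\star_i(\ln x)\prod_{j=1}^nB\Big(\gamma_n+\sum_{k=1}^{j-1}\gamma^\star_k+j,\ \gamma^\star_j+1\Big).$$ ii) If $f_i\in\mathcal{R}_{-1}$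 and $f_i^\star\in\mathcal{R}_{-1}$ for $1\le i\le n$, then $$\psi(x,n)\sim P(S_n>x)\sim \alpha^nx^{-\alpha}\Big(f_n(\ln x)\prod_{i=1}^nf_i^{\star I}(\ln x)+f_n^I(\ln x)\sum_{i=1}^{n}f_i^\star(\ln x)\prod_{1\le j\le n,\ j\neq i}f_j^{\star I}(\ln x)\Big).$$ iii) If $f_i\in\mathcal{R}_{-1}$ and $f_i^\star\in\mathcal{R}_{\gamma_i^\star}$ with $\gamma_i^\star>-1$ for $1\le i\le n$, then $$\psi(x,n)\sim P(S_n>x)\sim\alpha^nx^{-\alpha}(\ln x)^{n-1}f_n^I(\ln x)\prod_{i=1}^nf^\star_i(\ln x)\prod_{j=1}^{n-1}B\Big(\sum_{k=1}^{j}\gamma^\star_k+j,\ \gamma^\star_{j+1}+1\Big).$$ iv) If $f_i\in\mathcal{R}_{\gamma_i}$ with $\gamma_i>-1$ and $f_i^\star\in\mathcal{R}_{-1}$ for $1\le i\le n$, then $$\psi(x,n)\sim P(S_n>x)\sim \alpha^nx^{-\alpha}f_n(\ln x)\prod_{i=1}^nf_i^{\star I}(\ln x).$$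
   Context: All limits are as $x\to\infty$; $u(x)\sim v(x)$ means $u(x)/v(x)\to1$, and $u(x)=o(v(x))$ means $u(x)/v(x)\to0$. $\overline F=1-F$ denotes the tail of a distribution $F$. For nonnegative functions, $u\otimes v(x)=\int_0^x u(x-y)v(y)\,dy$; $f^I(x)=\int_0^x f(y)\,dy$ and $f^{\star I}(x)=\int_0^x f^\star(y)\,dy$ for $x\ge 0$. $B(\gamma_1+1,\gamma_2+1)=\int_0^1(1-y)^{\gamma_1}y^{\gamma_2}\,dy$ is the Beta function. Empty sums are $0$ and empty products are $1$. A measurable eventually positive function $u$ is in $\mathcal{R}_\gamma$ ($\gamma\in\mathbb{R}$) if $u(xt)\sim t^\gamma u(x)$ for every $t>0$; slowly varying means $\gamma=0$. For $\alpha>0$, a distribution $F$ belongs to $\mathcal{R}_{11}(\alpha)$ if $\overline F\in\mathcal{R}_{-\alpha}$ and, writing $\overline F(x)\sim x^{-\alpha}l(x)=x^{-\alpha}f(\ln x)$ with $l$ slowly varying and $f(y)=l(e^y)$, one has $\int_0^\infty f(y)\,dy=\infty$ and $f\in\mathcal{R}_\gamma$ for some $\gamma\ge-1$. The functions $f$ are taken nonnegative, measurable, and bounded on bounded subsets of $[0,\infty)$. All distributions (of the logarithms $\ln X_i^+$, $\ln Y_i$) are assumed non-lattice. *)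

theory Defs
  imports "HOL-Probability.Probability" "HOL-Library.Landau_Symbols"
begin

text \<open>
  Asymptotic relations are the library's \<open>\<sim>[at_top]\<close> and \<open>o(_)\<close>. The library reads
  \<open>0 / 0\<close> as \<open>1\<close> in \<open>u \<sim>[F] v\<close>; in all uses below one side is eventually positive, so
  both relations agree with the limits \<open>u / v \<longlongrightarrow> 1\<close> and \<open>u / v \<longlongrightarrow> 0\<close>.
\<close>

text \<open>Measurability is only required near infinity, so that the function may live on any
  half-line: distribution tails on the whole line, \<open>f\<close> on \<open>[0,\<infinity>)\<close>, \<open>l\<close> on \<open>[1,\<infinity>)\<close>.\<close>

definition regularly_varying :: "real \<Rightarrow> (real \<Rightarrow> real) \<Rightarrow> bool" where
  "regularly_varying \<gamma> u \<longleftrightarrow>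
     (\<exists>A. u \<in> borel_measurable (restrict_space borel {A..})) \<and>
     (\<forall>\<^sub>F x in at_top. u x > 0) \<and>
     (\<forall>t>0. (\<lambda>x. u (x * t)) \<sim>[at_top] (\<lambda>x. t powr \<gamma> * u x))"

abbreviation slowly_varying :: "(real \<Rightarrow> real) \<Rightarrow> bool" where
  "slowly_varying \<equiv> regularly_varying 0"

definition dist_tail :: "real measure \<Rightarrow> real \<Rightarrow> real" where
  "dist_tail F x = 1 - cdf F x"

text \<open>The standing conventions on the functions \<open>f\<close>, which matter only on \<open>[0,\<infinity>)\<close>.\<close>

definition admissible :: "(real \<Rightarrow> real) \<Rightarrow> bool" where
  "admissible f \<longleftrightarrow>
     (\<forall>y\<ge>0. f y \<ge> 0) \<and>
     f \<in> borel_measurable (restrict_space borel {0..}) \<and>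
     (\<forall>A\<subseteq>{0..}. bounded A \<longrightarrow> bounded (f ` A))"

definition R11_representation ::
    "real \<Rightarrow> real measure \<Rightarrow> (real \<Rightarrow> real) \<Rightarrow> (real \<Rightarrow> real) \<Rightarrow> bool" where
  "R11_representation \<alpha> F l f \<longleftrightarrow>
     dist_tail F \<sim>[at_top] (\<lambda>x. x powr (-\<alpha>) * l x) \<and>
     slowly_varying l \<and>
     (\<forall>y\<ge>0. f y = l (exp y)) \<and>
     admissible f \<and>
     (\<integral>\<^sup>+ y\<in>{0..}. ennreal (f y) \<partial>lborel) = \<infinity>"

definition R11 :: "real \<Rightarrow> real measure set" where
  "R11 \<alpha> = {F. real_distribution F \<and> regularly_varying (-\<alpha>) (dist_tail F) \<and>
     (\<exists>l f. R11_representation \<alpha> F l f \<and> (\<exists>\<gamma>\<ge>-1. regularly_varying \<gamma> f))}"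

text \<open>For \<open>X\<close> with distribution \<open>F\<close>, the variable \<open>ln X\<^sup>+\<close> takes the value \<open>-\<infinity>\<close> where
  \<open>X \<le> 0\<close>; only its finite values are tested against the lattices \<open>a + h\<int>\<close>.\<close>

definition nonlattice_log :: "real measure \<Rightarrow> bool" where
  "nonlattice_log F \<longleftrightarrow>
     \<not> (\<exists>a h. h > 0 \<and> (AE x in F. x > 0 \<longrightarrow> (\<exists>k::int. ln x = a + of_int k * h)))"

definition conv :: "(real \<Rightarrow> real) \<Rightarrow> (real \<Rightarrow> real) \<Rightarrow> real \<Rightarrow> real" where
  "conv u v x = (LINT y:{0..x}|lborel. u (x - y) * v y)"

definition integ :: "(real \<Rightarrow> real) \<Rightarrow> real \<Rightarrow> real" where
  "integ f x = (LINT y:{0..x}|lborel. f y)"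

definition S :: "(nat \<Rightarrow> 'a \<Rightarrow> real) \<Rightarrow> (nat \<Rightarrow> 'a \<Rightarrow> real) \<Rightarrow> nat \<Rightarrow> 'a \<Rightarrow> real" where
  "S X Y k \<omega> = (\<Sum>i=1..k. X i \<omega> * (\<Prod>j=1..i. Y j \<omega>))"

definition S_max :: "(nat \<Rightarrow> 'a \<Rightarrow> real) \<Rightarrow> (nat \<Rightarrow> 'a \<Rightarrow> real) \<Rightarrow> nat \<Rightarrow> 'a \<Rightarrow> real" where
  "S_max X Y n \<omega> = Max ((\<lambda>k. S X Y k \<omega>) ` {0..n})"

definition ruin_prob ::
    "'a measure \<Rightarrow> (nat \<Rightarrow> 'a \<Rightarrow> real) \<Rightarrow> (nat \<Rightarrow> 'a \<Rightarrow> real) \<Rightarrow> real \<Rightarrow> nat \<Rightarrow> real" where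
  "ruin_prob M X Y x n = measure M {\<omega> \<in> space M. S_max X Y n \<omega> > x}"

definition S_tail ::
    "'a measure \<Rightarrow> (nat \<Rightarrow> 'a \<Rightarrow> real) \<Rightarrow> (nat \<Rightarrow> 'a \<Rightarrow> real) \<Rightarrow> real \<Rightarrow> nat \<Rightarrow> real" where
  "S_tail M X Y x n = measure M {\<omega> \<in> space M. S X Y n \<omega> > x}"

end

theory Submission
  imports Defs "HOL-Real_Asymp.Real_Asymp"
begin

text \<open>
  Put \<open>s = ln x\<close>. Multiplying a tail \<open>x powr (-\<alpha>) * l x\<close> by \<open>exp (\<alpha> * s)\<close> leaves
  \<open>f s = l (exp s)\<close>, and slow variation of \<open>l\<close> becomes \<open>f (s + h) \<sim> f s\<close> for every fixed \<open>h\<close>.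
  The probabilistic part of the proof lives on this logarithmic scale, among the nonnegative
  locally bounded functions on \<open>[0,\<infinity>)\<close> that are insensitive to shifts in this sense and have
  infinite integral; they are called \<open>shift_stable\<close> below.

  A product adds logarithms. If \<open>V\<close> and \<open>Y\<close> are independent with
  \<open>P(V > exp s) \<sim> c exp(-\<alpha>s) g(s)\<close> and \<open>P(Y > exp s) \<sim> exp(-\<alpha>s) f(s)\<close>, then \<open>P(Y V > exp s)\<close> is the
  integral of \<open>P(V > exp(s - y))\<close> against the law of \<open>ln Y\<close>. That law gives an interval
  \<open>(y, y + dy]\<close> roughly the mass \<open>\<alpha> exp(-\<alpha>y) f(y) dy\<close>, so the result is \<open>\<alpha> c exp(-\<alpha>s) (g \<otimes> f)(s)\<close>.
  The law need not have a density: by monotonicity the tail of \<open>V\<close> at a point lies between its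
  averages over the two adjacent intervals of length \<open>h\<close>, and averaging smooths the law of \<open>ln Y\<close>
  (\<open>tilted_convolution\<close>). The ranges where \<open>y\<close> or \<open>s - y\<close> is bounded do not count, because
  infinite integrals force \<open>g\<close> and \<open>f\<close> to be \<open>o(g \<otimes> f)\<close> (\<open>shift_stable_smallo_conv\<close>).

  The sum is unfolded from the inside,
  \<open>S\<^sub>n = Y\<^sub>1 (X\<^sub>1 + Y\<^sub>2 (X\<^sub>2 + \<dots> + Y\<^sub>n X\<^sub>n))\<close>. Each multiplication by \<open>Y\<^sub>k\<close> convolves with \<open>f\<^sub>k\<^sup>\<star>\<close>
  and contributes a factor \<open>\<alpha>\<close>. Each addition of \<open>X\<^sub>k\<^sub>-\<^sub>1\<close> is invisible: the hypothesis
  \<open>f\<^sub>k\<^sub>-\<^sub>1 = o(f\<^sub>k \<otimes> f\<^sub>k\<^sup>\<star>)\<close> says that its tail is negligible against the tail of \<open>Y\<^sub>k X\<^sub>k\<close>, and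
  convolution preserves the comparison with the longer products. Hence
  \<open>P(S\<^sub>n > x) \<sim> \<alpha>\<^sup>n x powr (-\<alpha>) (f\<^sub>n \<otimes> f\<^sub>n\<^sup>\<star> \<otimes> \<dots> \<otimes> f\<^sub>1\<^sup>\<star>)(ln x)\<close> (\<open>tail_S\<close>). The maximum \<open>M\<^sub>n\<close> lies
  between \<open>S\<^sub>n\<close> and the same sum formed with the positive parts of the \<open>X\<^sub>i\<close>; both have this
  tail, so \<open>M\<^sub>n\<close> has it too (\<open>ruin_asymp\<close>).

  It remains to evaluate the iterated convolution for regularly varying functions, one
  convolution at a time. If both indices exceed \<open>-1\<close>, the substitution \<open>z = x t\<close> and dominated
  convergence, with Potter's bounds as majorant, give \<open>x g(x) f(x) B\<close> (\<open>conv_asymp_Beta\<close>). If the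
  index of \<open>u\<close> is \<open>-1\<close>, its integral \<open>u\<^sup>I\<close> is slowly varying and outgrows \<open>x u(x)\<close>. The middle of the
  range of integration then becomes negligible, and the end where the argument of \<open>u\<close> is small
  compared with \<open>x\<close> contributes \<open>v u\<^sup>I\<close>. Against this the other end vanishes if the index of \<open>v\<close>
  exceeds \<open>-1\<close> (\<open>conv_asymp_integ\<close>); if that index is \<open>-1\<close> too, it contributes \<open>u v\<^sup>I\<close>
  (\<open>conv_asymp_product_rule\<close>). The four parts of the theorem are the four ways in which these
  steps combine. The order of the factors does not show in the limit, since the Beta functions
  telescope to a symmetric quotient of Gamma functions (\<open>Beta_telescope\<close>).
\<close>

section \<open>Asymptotic equivalence by constant factors\<close>

text \<open>
  The multiplicative form of \<open>\<sim>\<close>. Estimates up to a factor \<open>K\<close> near \<open>1\<close> compose under products,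
  integrals of nonnegative functions and inequalities, so most asymptotic relations below are
  proved and used through it.
\<close>

lemma asymp_equiv_iff_factor_bounds:
  fixes u v :: "'a \<Rightarrow> real"
  assumes pos: "\<forall>\<^sub>F s in F. v s > 0"
  shows "u \<sim>[F] v \<longleftrightarrow> (\<forall>K>1. \<forall>\<^sub>F s in F. u s \<le> K * v s \<and> v s \<le> K * u s)"
proof
  assume uv: "u \<sim>[F] v"
  have "((\<lambda>s. u s / v s) \<longlongrightarrow> 1) F"
    using uv pos by (intro asymp_equivD_strong) (auto elim: eventually_mono)
  show "\<forall>K>1. \<forall>\<^sub>F s in F. u s \<le> K * v s \<and> v s \<le> K * u s"
  proof (intro allI impI)
    fix K :: real assume K: "K > 1"
    have "\<forall>\<^sub>F s in F. u s / v s < K" "\<forall>\<^sub>F s in F. u s / v s > 1/K"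
      using order_tendstoD[OF \<open>((\<lambda>s. u s / v s) \<longlongrightarrow> 1) F\<close>] K by auto
    thus "\<forall>\<^sub>F s in F. u s \<le> K * v s \<and> v s \<le> K * u s"
      using pos
    proof eventually_elim
      case (elim s)
      thus ?case using K by (auto simp: field_simps)
    qed
  qed
next
  assume R: "\<forall>K>1. \<forall>\<^sub>F s in F. u s \<le> K * v s \<and> v s \<le> K * u s"
  have "((\<lambda>s. u s / v s) \<longlongrightarrow> 1) F"
  proof (rule order_tendstoI)
    fix a :: real assume a: "a < 1"
    define K where "K = (if a \<le> 0 then 2 else 2 / (1 + a))"
    have K: "K > 1" using a by (auto simp: K_def field_simps)
    have Ka: "a * K < 1" using a by (auto simp: K_def field_simps)
    from R K have "\<forall>\<^sub>F s in F. u s \<le> K * v s \<and> v s \<le> K * u s" by auto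
    thus "\<forall>\<^sub>F s in F. a < u s / v s" using pos
    proof eventually_elim
      case (elim s)
      have "K * (u s / v s) \<ge> 1" using elim by (simp add: field_simps)
      hence "K * (u s / v s) > K * a" using Ka by (simp add: mult.commute)
      hence "K * a < K * (u s / v s)" by (simp only: mult.commute)
      thus ?case using K by (subst (asm) mult_less_cancel_left_pos) auto
    qed
  next
    fix a :: real assume a: "1 < a"
    from R[rule_format, of "(1+a)/2"] a
    have "\<forall>\<^sub>F s in F. u s \<le> ((1+a)/2) * v s \<and> v s \<le> ((1+a)/2) * u s" by simp
    thus "\<forall>\<^sub>F s in F. u s / v s < a" using pos
    proof eventually_elim
      case (elim s)
      have "(1+a)/2 * v s < a * v s" using a elim by (intro mult_strict_right_mono) auto
      with elim have "u s < a * v s" by linarith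
      thus ?case using elim by (simp add: field_simps)
    qed
  qed
  thus "u \<sim>[F] v" by (rule asymp_equivI')
qed

lemmas asymp_equiv_factorI = asymp_equiv_iff_factor_bounds[THEN iffD2, rule_format]

lemma asymp_equiv_factorD:
  fixes u v :: "'a \<Rightarrow> real"
  assumes "u \<sim>[F] v" "\<forall>\<^sub>F s in F. v s > 0" "K > 1"
  shows "\<forall>\<^sub>F s in F. u s \<le> K * v s" "\<forall>\<^sub>F s in F. v s \<le> K * u s"
  using asymp_equiv_iff_factor_bounds[OF assms(2), of u] assms by (auto elim: eventually_mono)

lemma asymp_equiv_eventually_pos:
  fixes u v :: "'a \<Rightarrow> real"
  assumes "u \<sim>[F] v" "\<forall>\<^sub>F s in F. v s > 0"
  shows "\<forall>\<^sub>F s in F. u s > 0"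
proof -
  have "\<forall>\<^sub>F s in F. v s \<le> 2 * u s" by (rule asymp_equiv_factorD(2)[OF assms]) simp
  with assms(2) show ?thesis by eventually_elim linarith
qed

text \<open>
  A budget \<open>K > 1\<close> is shared equally among \<open>m\<close> successive estimates.
\<close>

lemma factor_root:
  fixes K :: real assumes "K > 1" "m > 0"
  obtains L where "L > 1" "L ^ m = K"
  using assms that[of "root m K"] by (auto simp: real_root_pow_pos2)

lemma smallo_leD:
  fixes u v :: "real \<Rightarrow> real"
  assumes "u \<in> o[F](v)" "c > 0" "\<forall>\<^sub>F s in F. u s \<ge> 0" "\<forall>\<^sub>F s in F. v s \<ge> 0"
  shows "\<forall>\<^sub>F s in F. u s \<le> c * v s"
  using landau_o.smallD[OF assms(1,2)] assms(3,4) by eventually_elim auto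

lemma smallo_leI:
  fixes u v :: "real \<Rightarrow> real"
  assumes "\<And>c. c > 0 \<Longrightarrow> \<forall>\<^sub>F s in F. u s \<le> c * v s" "\<forall>\<^sub>F s in F. u s \<ge> 0"
  shows "u \<in> o[F](v)"
proof (rule landau_o.smallI)
  fix c :: real assume "c > 0"
  from assms(1)[OF this] assms(2) show "\<forall>\<^sub>F s in F. norm (u s) \<le> c * norm (v s)"
  proof eventually_elim
    case (elim s)
    have "c * v s \<le> c * \<bar>v s\<bar>" using \<open>c > 0\<close> by simp
    thus ?case using elim by simp
  qed
qed

section \<open>The uniform convergence theorem\<close>

text \<open>
  Convergence for each fixed shift is automatically uniform over bounded shifts. For given \<open>s\<close> the
  set \<open>bad s\<close> of shifts at which \<open>k\<close> is off by more than the factor \<open>L\<close> has small measure when \<open>s\<close> is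
  large, by dominated convergence. So the good points ahead of \<open>s\<close> and those ahead of \<open>s - h\<close>
  both fill most of a window of length \<open>c\<close>, hence have a common member, through which \<open>k s\<close> and
  \<open>k (s - h)\<close> are compared.
\<close>

lemma uniform_shift_aux:
  fixes k :: "real \<Rightarrow> real"
  assumes meas: "k \<in> borel_measurable borel"
    and pos: "\<And>s. k s > 0"
    and shift: "\<And>h. ((\<lambda>s. k (s + h) / k s) \<longlongrightarrow> 1) at_top"
    and c: "c > 0" and K: "K > 1"
  shows "\<forall>\<^sub>F s in at_top. \<forall>h\<in>{0..c}. k (s - h) \<le> K * k s \<and> k s \<le> K * k (s - h)"
proof -
  obtain L where L: "L > 1" "L ^ 2 = K" using factor_root[OF K, of 2] by auto
  define bad where "bad s = {h\<in>{0..2*c}. \<not> (k (s + h) \<le> L * k s \<and> k s \<le> L * k (s + h))}" for s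
  have bad_meas[measurable, simp]: "bad s \<in> sets borel" for s
    unfolding bad_def using meas by measurable
  have lim: "((\<lambda>s. LINT h|lborel. indicator (bad s) h :: real) \<longlongrightarrow> (LINT (h::real)|lborel. (0::real))) at_top"
  proof (rule integral_dominated_convergence_at_top[where w = "indicator {0..2*c}"
        and s = "\<lambda>s h. indicator (bad s) h" and f = "\<lambda>_. 0"])
    show "AE h in lborel. ((\<lambda>s. indicator (bad s) h :: real) \<longlongrightarrow> 0) at_top"
    proof (rule AE_I2)
      fix h :: real
      have "\<forall>\<^sub>F s in at_top. k (s + h) / k s < L" "\<forall>\<^sub>F s in at_top. k (s + h) / k s > 1 / L"
        using order_tendstoD[OF shift[of h]] L by auto
      hence "\<forall>\<^sub>F s in at_top. indicator (bad s) h = (0::real)"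
      proof eventually_elim
        case (elim s)
        thus ?case using pos[of s] L by (auto simp: bad_def field_simps indicator_def)
      qed
      thus "((\<lambda>s. indicator (bad s) h :: real) \<longlongrightarrow> 0) at_top"
        by (rule tendsto_eventually)
    qed
    show "\<forall>\<^sub>F i in at_top. AE x in lborel. norm (indicator (bad i) x :: real) \<le> indicator {0..2*c} x"
      by (intro always_eventually allI AE_I2) (auto simp: bad_def indicator_def)
  qed (use c in auto)
  have "\<forall>\<^sub>F s in at_top. measure lborel (bad s) < c/2"
    using order_tendstoD(2)[OF lim, of "c/2"] c by simp
  then obtain A where A: "\<And>s. s \<ge> A \<Longrightarrow> measure lborel (bad s) < c/2"
    by (auto simp: eventually_at_top_linorder)
  have fin: "emeasure lborel (bad s) \<noteq> \<infinity>" for s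
  proof -
    have "emeasure lborel (bad s) \<le> emeasure lborel {0..2*c}"
      by (intro emeasure_mono) (auto simp: bad_def)
    thus ?thesis using c by (auto simp: top_unique)
  qed
  show ?thesis
    unfolding eventually_at_top_linorder
  proof (intro exI[of _ "A + c"] allI impI ballI)
    fix s h assume s: "A + c \<le> s" and h: "h \<in> {0..c}"
    \<comment> \<open>Good shifts are sought in \<open>[0, c]\<close> as seen from \<open>s\<close>; seen from \<open>s - h\<close> they lie in \<open>[0, 2 * c]\<close>.\<close>
    define B where "B = bad s \<union> (\<lambda>t. h + t) -` bad (s - h)"
    have vim: "(\<lambda>t. h + t) -` bad (s - h) \<in> sets lborel"
      using measurable_sets[of "(\<lambda>t. h + t)" lborel lborel "bad (s-h)"] bad_meas[of "s-h"] by simp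
    have em: "emeasure lborel ((\<lambda>t. h + t) -` bad (s - h)) = emeasure lborel (bad (s - h))"
    proof -
      have "emeasure lborel (bad (s - h)) = emeasure (distr lborel borel ((+) h)) (bad (s - h))"
        by (simp add: lborel_distr_plus)
      also have "\<dots> = emeasure lborel ((\<lambda>t. h + t) -` bad (s - h))"
        using bad_meas[of "s-h"] by (subst emeasure_distr) auto
      finally show ?thesis by simp
    qed
    hence m2: "measure lborel ((\<lambda>t. h + t) -` bad (s - h)) < c/2"
      using A[of "s-h"] s h by (simp add: measure_def)
    have "measure lborel B \<le> measure lborel (bad s) + measure lborel ((\<lambda>t. h + t) -` bad (s - h))"
      unfolding B_def by (intro measure_Un_le vim) simp
    also have "\<dots> < c/2 + c/2" using A[of s] s c m2 by (intro add_strict_mono) auto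
    finally have mB: "measure lborel B < c" by simp
    have "\<not> {0..c} \<subseteq> B"
    proof
      assume "{0..c} \<subseteq> B"
      moreover have "emeasure lborel B \<noteq> \<infinity>"
      proof -
        have "emeasure lborel B \<le> emeasure lborel (bad s) + emeasure lborel ((\<lambda>t. h + t) -` bad (s - h))"
          unfolding B_def by (intro emeasure_subadditive vim) simp
        also have "\<dots> < \<infinity>" using fin em by (simp add: less_top)
        finally show ?thesis by simp
      qed
      ultimately have "measure lborel {0..c} \<le> measure lborel B"
        using vim by (intro measure_mono_fmeasurable) (auto simp: fmeasurable_def B_def less_top)
      thus False using mB c by simp
    qed
    then obtain t where t: "t \<in> {0..c}" "t \<notin> bad s" "h + t \<notin> bad (s - h)"
      unfolding B_def by blast
    have 1: "k (s + t) \<le> L * k s" "k s \<le> L * k (s + t)" using t c by (auto simp: bad_def)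
    have 2: "k (s + t) \<le> L * k (s - h)" "k (s - h) \<le> L * k (s + t)"
      using t h c by (auto simp: bad_def)
    have "k (s - h) \<le> L * (L * k s)"
      using 1 2 L by (meson order_trans mult_left_mono less_imp_le zero_less_one)
    moreover have "k s \<le> L * (L * k (s - h))"
      using 1 2 L by (meson order_trans mult_left_mono less_imp_le zero_less_one)
    ultimately show "k (s - h) \<le> K * k s \<and> k s \<le> K * k (s - h)"
      by (simp add: power2_eq_square mult.assoc flip: L(2))
  qed
qed

lemma uniform_shift:
  fixes k :: "real \<Rightarrow> real"
  assumes meas: "k \<in> borel_measurable borel"
    and pos: "\<forall>\<^sub>F s in at_top. k s > 0"
    and shift: "\<And>h. (\<lambda>s. k (s + h)) \<sim>[at_top] k"
    and K: "K > 1"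
  shows "\<forall>\<^sub>F s in at_top. \<forall>h\<in>{0..c}. k (s - h) \<le> K * k s \<and> k s \<le> K * k (s - h)"
proof -
  obtain A where A: "\<And>s. s \<ge> A \<Longrightarrow> k s > 0" using pos by (auto simp: eventually_at_top_linorder)
  define k' where "k' s = (if s \<ge> A then k s else 1)" for s
  define c' where "c' = max c 1"
  have "\<forall>\<^sub>F s in at_top. \<forall>h\<in>{0..c'}. k' (s - h) \<le> K * k' s \<and> k' s \<le> K * k' (s - h)"
  proof (rule uniform_shift_aux)
    show "k' \<in> borel_measurable borel" unfolding k'_def using meas by measurable
    show "k' s > 0" for s using A by (auto simp: k'_def)
    fix h
    have "((\<lambda>s. k (s + h) / k s) \<longlongrightarrow> 1) at_top"
      using shift[of h] pos by (intro asymp_equivD_strong) (auto elim: eventually_mono)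
    moreover have "\<forall>\<^sub>F s in at_top. k (s + h) / k s = k' (s + h) / k' s"
      using eventually_ge_at_top[of A] eventually_ge_at_top[of "A - h"]
      by eventually_elim (auto simp: k'_def)
    ultimately show "((\<lambda>s. k' (s + h) / k' s) \<longlongrightarrow> 1) at_top"
      by (rule Lim_transform_eventually)
  qed (use K in \<open>auto simp: c'_def\<close>)
  thus ?thesis using eventually_ge_at_top[of "A + c"] eventually_ge_at_top[of A]
  proof eventually_elim
    case (elim s)
    show ?case
    proof
      fix h assume h: "h \<in> {0..c}"
      hence "k' (s - h) \<le> K * k' s \<and> k' s \<le> K * k' (s - h)" using elim(1) by (auto simp: c'_def)
      moreover have "k' (s - h) = k (s - h)" "k' s = k s" using elim h by (auto simp: k'_def)
      ultimately show "k (s - h) \<le> K * k s \<and> k s \<le> K * k (s - h)" by simp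
    qed
  qed
qed

section \<open>Convolution of locally bounded functions\<close>

text \<open>
  Vanishing on the negative half-line turns the convolution over \<open>[0, s]\<close> into one over the whole
  line, so that translation, reflection and Fubini apply without attention to the boundary.
\<close>

definition tame :: "(real \<Rightarrow> real) \<Rightarrow> bool" where
  "tame g \<longleftrightarrow> g \<in> borel_measurable borel \<and> (\<forall>y. 0 \<le> g y) \<and> (\<forall>y<0. g y = 0) \<and>
     (\<forall>b. \<exists>C. \<forall>y\<le>b. g y \<le> C)"

lemma tame_measurable: "tame g \<Longrightarrow> g \<in> borel_measurable borel"
  and tame_nonneg: "tame g \<Longrightarrow> 0 \<le> g y"
  and tame_zero: "tame g \<Longrightarrow> y < 0 \<Longrightarrow> g y = 0"
  by (auto simp: tame_def)

lemma tame_nonzero: "tame g \<Longrightarrow> g y \<noteq> 0 \<Longrightarrow> 0 \<le> y"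
  using tame_zero[of g y] by force

lemma tame_bound:
  assumes "tame g"
  obtains C where "C > 0" "\<And>y. y \<le> b \<Longrightarrow> g y \<le> C"
proof -
  from assms obtain C where C: "\<And>y. y \<le> b \<Longrightarrow> g y \<le> C" unfolding tame_def by blast
  show ?thesis by (rule that[of "max C 1"]) (auto intro: max.coboundedI1 C)
qed

lemma const_set_integrable: "set_integrable lborel {a..b::real} (\<lambda>_. c::real)"
  by (rule borel_integrable_atLeastAtMost') simp

lemma const_set_integral: "a \<le> b \<Longrightarrow> (LINT z:{a..b::real}|lborel. c) = c * (b - a :: real)"
  by (simp add: set_lebesgue_integral_def)

lemma tame_conv_set_integrable:
  assumes "tame g" "tame f"
  shows "set_integrable lborel {a..b} (\<lambda>z. g (s - z) * f z)"
proof -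
  obtain C where C: "C > 0" "\<And>y. y \<le> s - a \<Longrightarrow> g y \<le> C" using tame_bound[OF assms(1)] by blast
  obtain D where D: "D > 0" "\<And>y. y \<le> b \<Longrightarrow> f y \<le> D" using tame_bound[OF assms(2)] by blast
  have [measurable]: "g \<in> borel_measurable borel" "f \<in> borel_measurable borel"
    using assms by (auto simp: tame_def)
  show ?thesis
  proof (rule set_integrable_bound[where f = "\<lambda>_. C * D"])
    show "set_integrable lborel {a..b} (\<lambda>_. C * D)"
      by (rule const_set_integrable)
    show "set_borel_measurable lborel {a..b} (\<lambda>z. g (s - z) * f z)"
      unfolding set_borel_measurable_def by measurable
    show "AE x in lborel. x \<in> {a..b} \<longrightarrow> norm (g (s - x) * f x) \<le> norm (C * D)"
      using C D tame_nonneg[OF assms(1)] tame_nonneg[OF assms(2)]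
      by (intro AE_I2) (auto simp: abs_mult intro!: mult_mono)
  qed
qed

lemma tame_set_integrable:
  assumes "tame g"
  shows "set_integrable lborel {a..b} g"
proof -
  obtain C where C: "C > 0" "\<And>y. y \<le> b \<Longrightarrow> g y \<le> C" using tame_bound[OF assms(1)] by blast
  have [measurable]: "g \<in> borel_measurable borel"
    using assms by (auto simp: tame_def)
  show ?thesis
  proof (rule set_integrable_bound[where f = "\<lambda>_. C"])
    show "set_integrable lborel {a..b} (\<lambda>_. C)"
      by (rule const_set_integrable)
    show "set_borel_measurable lborel {a..b} g"
      unfolding set_borel_measurable_def by measurable
    show "AE x in lborel. x \<in> {a..b} \<longrightarrow> norm (g x) \<le> norm C"
      using C tame_nonneg[OF assms(1)] by (intro AE_I2) auto
  qed
qed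

lemma set_integral_nonneg_mono:
  fixes h h' :: "real \<Rightarrow> real"
  assumes "set_integrable lborel B h'" "A \<subseteq> B" "A \<in> sets lborel" "\<And>z. z \<in> A \<Longrightarrow> h z \<le> h' z"
    "\<And>z. z \<in> A \<Longrightarrow> 0 \<le> h z" "\<And>z. z \<in> B \<Longrightarrow> 0 \<le> h' z"
  shows "(LINT z:A|lborel. h z) \<le> (LINT z:B|lborel. h' z)"
  unfolding set_lebesgue_integral_def
  using assms by (intro Bochner_Integration.integral_mono')
    (auto simp: set_integrable_def indicator_def)

abbreviation conv_on :: "real set \<Rightarrow> (real \<Rightarrow> real) \<Rightarrow> (real \<Rightarrow> real) \<Rightarrow> real \<Rightarrow> real" where
  "conv_on A g f s \<equiv> (LINT z:A|lborel. g (s - z) * f z)"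

lemma conv_part_mono:
  assumes "tame g" "tame f" "a' \<le> a" "b \<le> b'"
  shows "conv_on {a..b} g f s \<le> conv_on {a'..b'} g f s"
  by (rule set_integral_nonneg_mono[OF tame_conv_set_integrable])
     (use assms in \<open>auto simp: tame_nonneg\<close>)

lemma conv_part_nonneg:
  assumes "tame g" "tame f"
  shows "0 \<le> conv_on A g f s"
  unfolding set_lebesgue_integral_def
  using assms by (intro Bochner_Integration.integral_nonneg) (auto simp: tame_nonneg)

lemma conv_nonneg: "tame g \<Longrightarrow> tame f \<Longrightarrow> 0 \<le> conv g f s"
  unfolding conv_def by (rule conv_part_nonneg)

lemma integ_nonneg: "tame g \<Longrightarrow> 0 \<le> integ g s"
  unfolding integ_def set_lebesgue_integral_def
  by (intro Bochner_Integration.integral_nonneg) (auto simp: tame_nonneg)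

lemma integ_mono: "tame g \<Longrightarrow> s \<le> t \<Longrightarrow> integ g s \<le> integ g t"
  unfolding integ_def by (rule set_integral_nonneg_mono[OF tame_set_integrable]) (auto simp: tame_nonneg)

lemma set_integral_split:
  fixes h :: "real \<Rightarrow> real"
  assumes "set_integrable lborel {a..c} h" "a \<le> b" "b \<le> c"
  shows "(LINT z:{a..c}|lborel. h z) = (LINT z:{a..b}|lborel. h z) + (LINT z:{b..c}|lborel. h z)"
proof -
  have "{a..c} = {a..b} \<union> {b..c}" using assms by auto
  moreover have "(LINT z:{a..b} \<union> {b..c}|lborel. h z) =
     (LINT z:{a..b}|lborel. h z) + (LINT z:{b..c}|lborel. h z)"
  proof (rule set_integral_Un_AE)
    show "AE x in lborel. \<not> (x \<in> {a..b} \<and> x \<in> {b..c})"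
      using AE_lborel_singleton[of b] by eventually_elim auto
    show "set_integrable lborel {a..b} h" "set_integrable lborel {b..c} h"
      using assms by (auto intro: set_integrable_subset[OF assms(1)])
  qed auto
  ultimately show ?thesis by simp
qed

lemma conv_whole_line:
  assumes "tame g" "tame f"
  shows "conv g f s = (LINT z|lborel. g (s - z) * f z)"
  unfolding conv_def set_lebesgue_integral_def
  by (intro Bochner_Integration.integral_cong)
     (auto simp: indicator_def dest: tame_nonzero[OF assms(1)] tame_nonzero[OF assms(2)])

lemma nn_integral_conv:
  assumes "tame g" "tame f"
  shows "(\<integral>\<^sup>+z. ennreal (g (s - z) * f z) \<partial>lborel) = ennreal (conv g f s)"
proof -
  have "integrable lborel (\<lambda>z. g (s - z) * f z)"
  proof -
    have "(\<lambda>z. indicator {0..s} z *\<^sub>R (g (s - z) * f z)) = (\<lambda>z. g (s - z) * f z)"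
      by (rule ext) (auto simp: indicator_def dest: tame_nonzero[OF assms(1)] tame_nonzero[OF assms(2)])
    with tame_conv_set_integrable[OF assms, of 0 s s] show ?thesis
      by (simp add: set_integrable_def)
  qed
  thus ?thesis unfolding conv_whole_line[OF assms]
    by (intro nn_integral_eq_integral) (auto simp: tame_nonneg[OF assms(1)] tame_nonneg[OF assms(2)])
qed

text \<open>
  The reflection \<open>z \<mapsto> s - z\<close> exchanges the two factors; statements about the left end of the
  range of integration transfer to the right end.
\<close>

lemma conv_part_reflect:
  fixes f g :: "real \<Rightarrow> real"
  shows "conv_on {a..b} g f s = conv_on {s-b..s-a} f g s"
proof -
  have "conv_on {a..b} g f s
    = \<bar>-1\<bar> *\<^sub>R (LINT z|lborel. indicator {a..b} (s + -1 * z) *\<^sub>R (g (s - (s + -1 * z)) * f (s + -1 * z)))"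
    unfolding set_lebesgue_integral_def by (rule lborel_integral_real_affine) simp
  also have "\<dots> = conv_on {s-b..s-a} f g s"
    unfolding set_lebesgue_integral_def
    by (simp, intro Bochner_Integration.integral_cong) (auto simp: indicator_def)
  finally show ?thesis .
qed

lemma conv_commute: "conv g f = conv f g"
  unfolding conv_def by (rule ext, subst conv_part_reflect) simp

lemma conv_le_bound:
  assumes "tame g" "tame f" "s \<le> b" "\<And>y. y \<le> b \<Longrightarrow> g y \<le> C" "\<And>y. y \<le> b \<Longrightarrow> f y \<le> D"
  shows "conv g f s \<le> C * D * max 0 b"
proof -
  have C: "C \<ge> 0" "D \<ge> 0" using assms(4)[of b] tame_nonneg[OF assms(1), of b]
     assms(5)[of b] tame_nonneg[OF assms(2), of b] by linarith+
  have "conv g f s \<le> (LINT z:{0..max 0 b}|lborel. C * D)"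
    unfolding conv_def
    using assms C by (intro set_integral_nonneg_mono)
      (auto simp: const_set_integrable tame_nonneg intro!: mult_mono)
  thus ?thesis by (subst (asm) const_set_integral) auto
qed

lemma tame_conv:
  assumes "tame g" "tame f" shows "tame (conv g f)"
  unfolding tame_def
proof (intro conjI allI impI)
  have [measurable]: "g \<in> borel_measurable borel" "f \<in> borel_measurable borel"
    using assms by (auto simp: tame_def)
  have "conv g f = (\<lambda>s. LINT z|lborel. g (s - z) * f z)"
    using conv_whole_line[OF assms] by auto
  thus "conv g f \<in> borel_measurable borel" by simp
next
  fix y show "0 \<le> conv g f y" using assms by (rule conv_nonneg)
next
  fix y :: real assume "y < 0" thus "conv g f y = 0" by (simp add: conv_def set_lebesgue_integral_def)
next
  fix b
  obtain C where C: "C > 0" "\<And>y. y \<le> b \<Longrightarrow> g y \<le> C" using tame_bound[OF assms(1)] by blast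
  obtain D where D: "D > 0" "\<And>y. y \<le> b \<Longrightarrow> f y \<le> D" using tame_bound[OF assms(2)] by blast
  show "\<exists>C. \<forall>y\<le>b. conv g f y \<le> C"
    using conv_le_bound[OF assms _ C(2) D(2)] by blast
qed

text \<open>
  Both sides are the integral of \<open>u (s - y) * v (y - z) * w z\<close> over the plane.
\<close>

lemma conv_assoc:
  assumes "tame u" "tame v" "tame w"
  shows "conv (conv u v) w = conv u (conv v w)"
proof
  fix s
  have [measurable]: "u \<in> borel_measurable borel" "v \<in> borel_measurable borel" "w \<in> borel_measurable borel"
    using assms by (auto simp: tame_def)
  note t = tame_conv[OF assms(1,2)] tame_conv[OF assms(2,3)]
  have [measurable]: "conv u v \<in> borel_measurable borel" "conv v w \<in> borel_measurable borel"
    using t by (auto simp: tame_def)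
  note nn = tame_nonneg[OF assms(1)] tame_nonneg[OF assms(2)] tame_nonneg[OF assms(3)]
   tame_nonneg[OF t(1)] tame_nonneg[OF t(2)]
  have "ennreal (conv (conv u v) w s) = (\<integral>\<^sup>+z. ennreal (conv u v (s - z) * w z) \<partial>lborel)"
    by (rule nn_integral_conv[OF t(1) assms(3), symmetric])
  also have "\<dots> = (\<integral>\<^sup>+z. (\<integral>\<^sup>+y. ennreal (u (s - z - y) * v y * w z) \<partial>lborel) \<partial>lborel)"
  proof (rule nn_integral_cong)
    fix z
    have "ennreal (conv u v (s - z) * w z) = (\<integral>\<^sup>+y. ennreal (u (s - z - y) * v y) \<partial>lborel) * ennreal (w z)"
      unfolding nn_integral_conv[OF assms(1,2)] by (rule ennreal_mult) (rule nn)+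
    also have "\<dots> = (\<integral>\<^sup>+y. ennreal (u (s - z - y) * v y) * ennreal (w z) \<partial>lborel)"
      by (rule nn_integral_multc[symmetric]) measurable
    finally show "ennreal (conv u v (s - z) * w z) = (\<integral>\<^sup>+y. ennreal (u (s - z - y) * v y * w z) \<partial>lborel)"
      by (simp add: ennreal_mult nn)
  qed
  also have "\<dots> = (\<integral>\<^sup>+z. (\<integral>\<^sup>+y. ennreal (u (s - y) * v (y - z) * w z) \<partial>lborel) \<partial>lborel)"
  proof (rule nn_integral_cong)
    fix z
    show "(\<integral>\<^sup>+y. ennreal (u (s - z - y) * v y * w z) \<partial>lborel) =
       (\<integral>\<^sup>+y. ennreal (u (s - y) * v (y - z) * w z) \<partial>lborel)"
      by (subst (2) nn_integral_real_affine[where c = 1 and t = z]) (auto simp: algebra_simps)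
  qed
  also have "\<dots> = (\<integral>\<^sup>+y. (\<integral>\<^sup>+z. ennreal (u (s - y) * v (y - z) * w z) \<partial>lborel) \<partial>lborel)"
    by (rule lborel_pair.Fubini') measurable
  also have "\<dots> = (\<integral>\<^sup>+y. ennreal (u (s - y) * conv v w y) \<partial>lborel)"
  proof (rule nn_integral_cong)
    fix y
    have "ennreal (u (s - y) * conv v w y) = ennreal (u (s - y)) * (\<integral>\<^sup>+z. ennreal (v (y - z) * w z) \<partial>lborel)"
      unfolding nn_integral_conv[OF assms(2,3)] by (rule ennreal_mult) (rule nn)+
    also have "\<dots> = (\<integral>\<^sup>+z. ennreal (u (s - y)) * ennreal (v (y - z) * w z) \<partial>lborel)"
      by (rule nn_integral_cmult[symmetric]) measurable
    finally show "(\<integral>\<^sup>+z. ennreal (u (s - y) * v (y - z) * w z) \<partial>lborel) = ennreal (u (s - y) * conv v w y)"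
      by (simp add: ennreal_mult nn mult.assoc)
  qed
  also have "\<dots> = ennreal (conv u (conv v w) s)"
    by (rule nn_integral_conv[OF assms(1) t(2)])
  finally show "conv (conv u v) w s = conv u (conv v w) s"
    by (simp add: nn tame_nonneg tame_conv assms)
qed

text \<open>
  The convolution with this function is the antiderivative, which makes statements about \<open>integ\<close>
  special cases of statements about \<open>conv\<close>.
\<close>

definition unit_step :: "real \<Rightarrow> real" where "unit_step = indicator {0..}"

lemma tame_unit_step: "tame unit_step"
  unfolding tame_def unit_step_def
proof (intro conjI allI)
  fix b :: real show "\<exists>C. \<forall>y\<le>b. indicator {0..} y \<le> (C::real)"
    by (intro exI[of _ 1]) (simp add: indicator_def)
qed (auto simp: indicator_def)

lemma conv_unit_step: "conv unit_step g = integ g"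
proof
  fix s show "conv unit_step g s = integ g s"
    unfolding conv_def integ_def by (rule set_lebesgue_integral_cong) (auto simp: unit_step_def indicator_def)
qed

section \<open>Shift-stable functions and their convolutions\<close>

text \<open>
  The functions \<open>f s = l (exp s)\<close> with \<open>l\<close> slowly varying and infinite integral.
\<close>

definition shift_stable :: "(real \<Rightarrow> real) \<Rightarrow> bool" where
  "shift_stable g \<longleftrightarrow> tame g \<and> (\<forall>\<^sub>F s in at_top. g s > 0) \<and> (\<forall>h. (\<lambda>s. g (s + h)) \<sim>[at_top] g) \<and>
     filterlim (integ g) at_top at_top"

lemma shift_stable_tame: "shift_stable g \<Longrightarrow> tame g"
  and shift_stable_pos: "shift_stable g \<Longrightarrow> \<forall>\<^sub>F s in at_top. g s > 0"
  and shift_stable_shift: "shift_stable g \<Longrightarrow> (\<lambda>s. g (s + h)) \<sim>[at_top] g"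
  and shift_stable_integ_at_top: "shift_stable g \<Longrightarrow> filterlim (integ g) at_top at_top"
  unfolding shift_stable_def by blast+

lemma shift_stable_uniform:
  assumes "shift_stable g" "K > 1"
  shows "\<forall>\<^sub>F s in at_top. \<forall>h\<in>{0..c}. g (s - h) \<le> K * g s \<and> g s \<le> K * g (s - h)"
  by (rule uniform_shift) (use assms in \<open>simp_all add: tame_measurable shift_stable_tame shift_stable_pos shift_stable_shift\<close>)

lemma integ_pos: "shift_stable g \<Longrightarrow> \<forall>\<^sub>F s in at_top. integ g s > 0"
  using filterlim_at_top_dense[THEN iffD1, OF shift_stable_integ_at_top] by blast

lemma conv_edge_upper:
  assumes "shift_stable g" "tame f" "D \<ge> 0"
  shows "\<forall>\<^sub>F s in at_top. conv_on {0..D} g f s \<le> 2 * g s * integ f D"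
  using shift_stable_uniform[OF assms(1), of 2 D, simplified]
proof eventually_elim
  case (elim s)
  note t = shift_stable_tame[OF assms(1)] assms(2)
  have "conv_on {0..D} g f s \<le> (LINT z:{0..D}|lborel. (2 * g s) * f z)"
    using elim by (intro set_integral_mono set_integrable_mult_right tame_conv_set_integrable
       tame_set_integrable t mult_right_mono tame_nonneg) auto
  thus ?case by (simp add: integ_def)
qed

lemma conv_edge_lower:
  assumes "shift_stable g" "tame f" "D \<ge> 0"
  shows "\<forall>\<^sub>F s in at_top. g s * integ f D \<le> 2 * conv_on {0..D} g f s"
  using shift_stable_uniform[OF assms(1), of 2 D, simplified]
proof eventually_elim
  case (elim s)
  note t = shift_stable_tame[OF assms(1)] assms(2)
  have "(LINT z:{0..D}|lborel. g s * f z) \<le> (LINT z:{0..D}|lborel. 2 * (g (s - z) * f z))"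
    using elim by (intro set_integral_mono set_integrable_mult_right tame_conv_set_integrable
       tame_set_integrable t) (auto simp: tame_nonneg[OF t(2)] simp flip: mult.assoc intro!: mult_right_mono)
  thus ?case by (simp add: integ_def)
qed

text \<open>
  On a bounded range of \<open>z\<close> the factor \<open>g (s - z)\<close> is comparable to \<open>g s\<close>, so the convolution is at
  least about \<open>g s\<close> times the integral of \<open>f\<close> over that range, which is as large as desired.
\<close>

lemma shift_stable_smallo_conv:
  assumes "shift_stable g" "shift_stable f"
  shows "g \<in> o(conv g f)"
proof (rule smallo_leI)
  note t = shift_stable_tame[OF assms(1)] shift_stable_tame[OF assms(2)]
  show "\<forall>\<^sub>F s in at_top. g s \<ge> 0" using tame_nonneg[OF t(1)] by simp
  fix c :: real assume c: "c > 0"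
  have "\<forall>\<^sub>F D in at_top. integ f D \<ge> 2 / c"
    using shift_stable_integ_at_top[OF assms(2)] by (auto simp: filterlim_at_top)
  hence "\<forall>\<^sub>F D in at_top. integ f D \<ge> 2 / c \<and> D \<ge> 0"
    using eventually_ge_at_top[of 0] by eventually_elim auto
  then obtain D where D: "integ f D \<ge> 2 / c" "D \<ge> 0"
    using eventually_happens[of _ "at_top :: real filter"] by auto
  show "\<forall>\<^sub>F s in at_top. g s \<le> c * conv g f s"
    using conv_edge_lower[OF assms(1) t(2) D(2)] eventually_ge_at_top[of D]
  proof eventually_elim
    case (elim s)
    have "2 * g s \<le> c * (g s * integ f D)"
      using D c tame_nonneg[OF t(1), of s] mult_left_mono[of "2/c" "integ f D" "c * g s"]
      by (simp add: mult_ac)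
    also have "\<dots> \<le> c * (2 * conv_on {0..D} g f s)"
      using elim c by (intro mult_left_mono) auto
    also have "\<dots> \<le> c * (2 * conv g f s)"
      unfolding conv_def using c elim by (intro mult_left_mono conv_part_mono t) auto
    finally show ?case by simp
  qed
qed

lemma conv_pos:
  assumes "shift_stable g" "shift_stable f"
  shows "\<forall>\<^sub>F s in at_top. conv g f s > 0"
  using smallo_leD[OF shift_stable_smallo_conv[OF assms], of 1] shift_stable_pos[OF assms(1)]
    tame_nonneg[OF shift_stable_tame[OF assms(1)]] conv_nonneg[OF shift_stable_tame[OF assms(1)] shift_stable_tame[OF assms(2)]]
  by (auto elim: eventually_elim2)

text \<open>
  The part of the convolution near an end is \<open>O(g)\<close>, and \<open>g\<close> is negligible.
\<close>

lemma conv_edge_smallo: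
  assumes "shift_stable g" "shift_stable f" "D \<ge> 0"
  shows "(\<lambda>s. conv_on {0..D} g f s) \<in> o(conv g f)"
proof -
  note t = shift_stable_tame[OF assms(1)] shift_stable_tame[OF assms(2)]
  have "(\<lambda>s. conv_on {0..D} g f s) \<in> O(g)"
  proof (rule bigoI)
    show "\<forall>\<^sub>F s in at_top. norm (conv_on {0..D} g f s) \<le> (2 * integ f D) * norm (g s)"
      using conv_edge_upper[OF assms(1) t(2) assms(3)]
      by eventually_elim (use conv_part_nonneg[OF t] in \<open>auto simp: tame_nonneg[OF t(1)] mult_ac\<close>)
  qed
  thus ?thesis using shift_stable_smallo_conv[OF assms(1,2)] by (rule landau_o.big_small_trans)
qed

lemma conv_right_edge_smallo:
  assumes "shift_stable g" "shift_stable f" "D \<ge> 0"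
  shows "(\<lambda>s. conv_on {s-D..s} g f s) \<in> o(conv g f)"
  using conv_edge_smallo[OF assms(2,1,3)]
  by (subst conv_part_reflect, subst conv_commute) simp

lemma conv_left_asymp:
  assumes "shift_stable g" "shift_stable f" "D \<ge> 0"
  shows "(\<lambda>s. conv_on {0..s-D} g f s) \<sim>[at_top] conv g f"
proof -
  note t = shift_stable_tame[OF assms(1)] shift_stable_tame[OF assms(2)]
  have "(\<lambda>s. conv g f s - conv_on {s-D..s} g f s) \<sim>[at_top] conv g f"
    unfolding diff_conv_add_uminus
    by (subst asymp_equiv_add_right) (use conv_right_edge_smallo[OF assms] in auto)
  moreover have "\<forall>\<^sub>F s in at_top. conv g f s - conv_on {s-D..s} g f s =
     conv_on {0..s-D} g f s"
    using eventually_ge_at_top[of D]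
  proof eventually_elim
    case (elim s)
    thus ?case unfolding conv_def using assms(3)
      by (subst set_integral_split[of 0 s _ "s - D"]) (auto intro!: tame_conv_set_integrable t)
  qed
  ultimately show ?thesis by (rule asymp_equiv_transfer) simp
qed

lemma conv_middle_asymp:
  assumes "shift_stable g" "shift_stable f" "D \<ge> 0"
  shows "(\<lambda>s. conv_on {D..s-D} g f s) \<sim>[at_top] conv g f"
proof -
  note t = shift_stable_tame[OF assms(1)] shift_stable_tame[OF assms(2)]
  have "(\<lambda>s. conv_on {0..s-D} g f s - conv_on {0..D} g f s) \<sim>[at_top] conv g f"
    unfolding diff_conv_add_uminus
    by (subst asymp_equiv_add_right) (use conv_edge_smallo[OF assms] conv_left_asymp[OF assms] in auto)
  moreover have "\<forall>\<^sub>F s in at_top. conv_on {0..s-D} g f s - conv_on {0..D} g f s =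
     conv_on {D..s-D} g f s"
    using eventually_ge_at_top[of "2 * D"]
  proof eventually_elim
    case (elim s)
    thus ?case using assms(3)
      by (subst set_integral_split[of 0 "s-D" _ D]) (auto intro!: tame_conv_set_integrable t)
  qed
  ultimately show ?thesis by (rule asymp_equiv_transfer) simp
qed

text \<open>
  Away from the range where \<open>s - z\<close> is bounded, \<open>g (s + h - z)\<close> and \<open>g (s - z)\<close> agree up to a factor
  close to \<open>1\<close>; the excluded range is negligible by \<open>conv_left_asymp\<close>.
\<close>

lemma conv_shift:
  assumes "shift_stable g" "shift_stable f"
  shows "(\<lambda>s. conv g f (s + h)) \<sim>[at_top] conv g f"
proof (rule asymp_equiv_factorI)
  note t = shift_stable_tame[OF assms(1)] shift_stable_tame[OF assms(2)]
  show pos: "\<forall>\<^sub>F s in at_top. conv g f s > 0" by (rule conv_pos[OF assms])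
  fix K :: real assume "K > 1"
  then obtain L where L: "L > 1" "L ^ 3 = K" using factor_root[of K 3] by auto
  have "\<forall>\<^sub>F u in at_top. (g (u + h) \<le> L * g u \<and> g u \<le> L * g (u + h)) \<and> u \<ge> \<bar>h\<bar>"
    using asymp_equiv_factorD[OF shift_stable_shift[OF assms(1), of h] shift_stable_pos[OF assms(1)] L(1)]
      eventually_ge_at_top[of "\<bar>h\<bar>"] by eventually_elim auto
  then obtain D' where D': "\<And>u. u \<ge> D' \<Longrightarrow> (g (u + h) \<le> L * g u \<and> g u \<le> L * g (u + h)) \<and> u \<ge> \<bar>h\<bar>"
    unfolding eventually_at_top_linorder by blast
  define D where "D = max D' \<bar>h\<bar>"
  have D: "g (u + h) \<le> L * g u" "g u \<le> L * g (u + h)" if "u \<ge> D" for u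
    using D'[of u] that by (auto simp: D_def)
  have D0: "D \<ge> 0" "D + h \<ge> 0" by (auto simp: D_def)
  have pos': "\<forall>\<^sub>F s in at_top. conv g f (s + h) > 0"
    using eventually_compose_filterlim[OF pos, of "\<lambda>s. s + h" at_top]
      filterlim_tendsto_add_at_top[OF tendsto_const[of h] filterlim_ident] by (simp add: add.commute)
  have sh: "(\<lambda>s. conv_on {0..s+h-(D+h)} g f (s + h)) \<sim>[at_top] (\<lambda>s. conv g f (s + h))"
    using asymp_equiv_compose'[OF conv_left_asymp[OF assms D0(2)], of "\<lambda>s. s + h" at_top]
      filterlim_tendsto_add_at_top[OF tendsto_const[of h] filterlim_ident] by (simp add: add.commute)
  show "\<forall>\<^sub>F s in at_top. conv g f (s + h) \<le> K * conv g f s \<and> conv g f s \<le> K * conv g f (s + h)"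
    using asymp_equiv_factorD[OF conv_left_asymp[OF assms D0(1)] pos L(1)]
      asymp_equiv_factorD[OF sh pos' L(1)]
  proof eventually_elim
    case (elim s)
    let ?J = "conv_on {0..s-D} g f s"
    let ?J' = "conv_on {0..s-D} g f (s + h)"
    have D1: "g (s + h - z) \<le> L * g (s - z)" "g (s - z) \<le> L * g (s + h - z)" if "z \<le> s - D" for z
      using D[of "s - z"] that by (simp_all add: add_diff_eq diff_add_eq)
    have a: "?J' \<le> (LINT z:{0..s-D}|lborel. L * (g (s - z) * f z))"
      using D1(1) by (intro set_integral_mono set_integrable_mult_right tame_conv_set_integrable t)
        (auto simp: tame_nonneg[OF t(2)] simp flip: mult.assoc intro!: mult_right_mono)
    have b: "?J \<le> (LINT z:{0..s-D}|lborel. L * (g (s + h - z) * f z))"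
      using D1(2) by (intro set_integral_mono set_integrable_mult_right tame_conv_set_integrable t)
        (auto simp: tame_nonneg[OF t(2)] simp flip: mult.assoc intro!: mult_right_mono)
    have "conv g f (s + h) \<le> L * ?J'" using elim(4) by simp
    also have "\<dots> \<le> L * (L * ?J)" using a L by (intro mult_left_mono) auto
    also have "\<dots> \<le> L * (L * (L * conv g f s))" using elim L by (intro mult_left_mono) auto
    finally have 1: "conv g f (s + h) \<le> K * conv g f s" by (simp add: power3_eq_cube mult.assoc flip: L(2))
    have "conv g f s \<le> L * ?J" using elim by simp
    also have "\<dots> \<le> L * (L * ?J')" using b L by (intro mult_left_mono) auto
    also have "\<dots> \<le> L * (L * (L * conv g f (s + h)))" using elim L by (intro mult_left_mono) auto
    finally have 2: "conv g f s \<le> K * conv g f (s + h)" by (simp add: power3_eq_cube mult.assoc flip: L(2))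
    show ?case using 1 2 by simp
  qed
qed

lemma shift_stable_conv:
  assumes "shift_stable g" "shift_stable f"
  shows "shift_stable (conv g f)"
  unfolding shift_stable_def
proof (intro conjI allI)
  note t = shift_stable_tame[OF assms(1)] shift_stable_tame[OF assms(2)]
  show tc: "tame (conv g f)" by (intro tame_conv t)
  show "\<forall>\<^sub>F s in at_top. conv g f s > 0" by (rule conv_pos[OF assms])
  show "(\<lambda>s. conv g f (s + h)) \<sim>[at_top] conv g f" for h by (rule conv_shift[OF assms])
  have "\<forall>\<^sub>F s in at_top. g s \<le> 1 * conv g f s"
    by (rule smallo_leD[OF shift_stable_smallo_conv[OF assms]]) (auto simp: tame_nonneg t tc)
  then obtain s0 where s0: "\<And>s. s \<ge> s0 \<Longrightarrow> g s \<le> conv g f s"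
    unfolding eventually_at_top_linorder by auto
  define a where "a = max s0 0"
  show "filterlim (integ (conv g f)) at_top at_top"
  proof (rule filterlim_at_top_mono)
    show "filterlim (\<lambda>s. - integ g a + integ g s) at_top at_top"
      by (rule filterlim_tendsto_add_at_top[OF tendsto_const shift_stable_integ_at_top[OF assms(1)]])
    show "\<forall>\<^sub>F s in at_top. - integ g a + integ g s \<le> integ (conv g f) s"
      using eventually_ge_at_top[of a]
    proof eventually_elim
      case (elim s)
      have "integ g s - integ g a = (LINT z:{a..s}|lborel. g z)"
        unfolding integ_def using elim
        by (subst set_integral_split[of 0 s _ a]) (auto intro!: tame_set_integrable t simp: a_def)
      also have "\<dots> \<le> integ (conv g f) s"
        unfolding integ_def using s0
        by (intro set_integral_nonneg_mono tame_set_integrable tc) (auto simp: a_def tame_nonneg t tc)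
      finally show ?case by simp
    qed
  qed
qed

text \<open>
  The estimate of \<open>f\<close> by \<open>g\<close> is available for large arguments only; the range where the argument of
  \<open>f\<close> is bounded carries at most half of \<open>conv f h\<close>. This lets the smallness hypothesis on
  consecutive tails propagate along the iterated convolution.
\<close>

lemma conv_bigo_mono:
  assumes "shift_stable f" "shift_stable g" "shift_stable h" "f \<in> O(g)"
  shows "conv f h \<in> O(conv g h)"
proof -
  note t = shift_stable_tame[OF assms(1)] shift_stable_tame[OF assms(2)] shift_stable_tame[OF assms(3)]
  obtain c where c: "c > 0" "\<forall>\<^sub>F s in at_top. norm (f s) \<le> c * norm (g s)"
    using assms(4) by (auto elim: landau_o.bigE)
  then obtain D' where "\<And>s. s \<ge> D' \<Longrightarrow> norm (f s) \<le> c * norm (g s)"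
    unfolding eventually_at_top_linorder by auto
  hence D: "\<And>s. s \<ge> max D' 0 \<Longrightarrow> f s \<le> c * g s" using tame_nonneg[OF t(1)] tame_nonneg[OF t(2)] by auto
  define D where "D = max D' 0"
  have D: "\<And>s. s \<ge> D \<Longrightarrow> f s \<le> c * g s" "D \<ge> 0" using D by (auto simp: D_def)
  have pos: "\<forall>\<^sub>F s in at_top. conv f h s > 0" by (rule conv_pos[OF assms(1,3)])
  show ?thesis
  proof (rule bigoI)
    show "\<forall>\<^sub>F s in at_top. norm (conv f h s) \<le> (2 * c) * norm (conv g h s)"
      using asymp_equiv_factorD(2)[OF conv_left_asymp[OF assms(1,3) D(2)] pos, of 2, simplified]
    proof eventually_elim
      case (elim s)
      have "conv_on {0..s-D} f h s \<le> (LINT z:{0..s}|lborel. c * (g (s - z) * h z))"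
        using D c by (intro set_integral_nonneg_mono set_integrable_mult_right tame_conv_set_integrable t)
          (auto simp flip: mult.assoc intro!: mult_right_mono simp: tame_nonneg t)
      also have "\<dots> = c * conv g h s" by (simp add: conv_def)
      finally have "conv f h s \<le> 2 * c * conv g h s" using elim by simp
      thus ?case using conv_nonneg[OF t(1,3)] conv_nonneg[OF t(2,3)] by simp
    qed
  qed
qed

section \<open>Convolution of exponentially tilted tails\<close>

lemma borel_measurable_antimono:
  fixes a :: "real \<Rightarrow> real"
  assumes "antimono a"
  shows "a \<in> borel_measurable borel"
proof -
  have "mono (\<lambda>x. - a x)" using antimonoD[OF assms] by (intro monoI) simp
  from borel_measurable_uminus[OF borel_measurable_mono[OF this]] show ?thesis by simp
qed

context real_distribution begin

text \<open>
  Since \<open>a\<close> is nonincreasing, \<open>h * a (s - y)\<close> is at most the integral of \<open>a (s - z)\<close> over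
  \<open>y \<le> z < y + h\<close>. Fubini then trades the law at the point \<open>y\<close> for its mass of \<open>(z - h, z]\<close>.
\<close>

lemma smoothing_upper:
  fixes a :: "real \<Rightarrow> real"
  assumes "antimono a" "\<And>u. 0 \<le> a u" "h > 0"
  shows "ennreal h * (\<integral>\<^sup>+y. ennreal (indicator {p<..q} y * a (s - y)) \<partial>M)
     \<le> (\<integral>\<^sup>+z. ennreal (indicator {p..q+h} z * a (s - z) * prob {z-h<..z}) \<partial>lborel)"
proof -
  have [measurable]: "a \<in> borel_measurable borel"
    using assms(1) by (rule borel_measurable_antimono)
  interpret P: pair_sigma_finite M lborel ..
  have "ennreal h * (\<integral>\<^sup>+y. ennreal (indicator {p<..q} y * a (s - y)) \<partial>M)
     = (\<integral>\<^sup>+y. ennreal h * ennreal (indicator {p<..q} y * a (s - y)) \<partial>M)"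
    by (rule nn_integral_cmult[symmetric]) measurable
  also have "\<dots> \<le> (\<integral>\<^sup>+y. (\<integral>\<^sup>+z. ennreal (if z - h < y \<and> y \<le> z \<and> p \<le> z \<and> z \<le> q + h then a (s - z) else 0) \<partial>lborel) \<partial>M)"
  proof (rule nn_integral_mono)
    fix y
    show "ennreal h * ennreal (indicator {p<..q} y * a (s - y)) \<le>
      (\<integral>\<^sup>+z. ennreal (if z - h < y \<and> y \<le> z \<and> p \<le> z \<and> z \<le> q + h then a (s - z) else 0) \<partial>lborel)"
    proof (cases "y \<in> {p<..q}")
      case True
      have "ennreal h * ennreal (indicator {p<..q} y * a (s - y)) = (\<integral>\<^sup>+z. ennreal (a (s - y)) * indicator {y..<y+h} z \<partial>lborel)"
        using assms True by (subst nn_integral_cmult_indicator) (auto simp: mult.commute)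
      also have "\<dots> \<le> (\<integral>\<^sup>+z. ennreal (if z - h < y \<and> y \<le> z \<and> p \<le> z \<and> z \<le> q + h then a (s - z) else 0) \<partial>lborel)"
        using True antimonoD[OF assms(1)] by (intro nn_integral_mono) (auto simp: indicator_def intro!: ennreal_leI)
      finally show ?thesis .
    qed auto
  qed
  also have "\<dots> = (\<integral>\<^sup>+z. (\<integral>\<^sup>+y. ennreal (if z - h < y \<and> y \<le> z \<and> p \<le> z \<and> z \<le> q + h then a (s - z) else 0) \<partial>M) \<partial>lborel)"
    by (rule P.Fubini'[symmetric]) measurable
  also have "\<dots> = (\<integral>\<^sup>+z. ennreal (indicator {p..q+h} z * a (s - z) * prob {z-h<..z}) \<partial>lborel)"
  proof (rule nn_integral_cong)
    fix z
    have "(\<integral>\<^sup>+y. ennreal (if z - h < y \<and> y \<le> z \<and> p \<le> z \<and> z \<le> q + h then a (s - z) else 0) \<partial>M)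
      = (\<integral>\<^sup>+y. ennreal (indicator {p..q+h} z * a (s - z)) * indicator {z-h<..z} y \<partial>M)"
      by (intro nn_integral_cong) (auto simp: indicator_def)
    also have "\<dots> = ennreal (indicator {p..q+h} z * a (s - z)) * emeasure M {z-h<..z}"
      by (subst nn_integral_cmult_indicator) auto
    also have "\<dots> = ennreal (indicator {p..q+h} z * a (s - z) * prob {z-h<..z})"
      by (simp add: emeasure_eq_measure ennreal_mult'' )
    finally show "(\<integral>\<^sup>+y. ennreal (if z - h < y \<and> y \<le> z \<and> p \<le> z \<and> z \<le> q + h then a (s - z) else 0) \<partial>M)
      = ennreal (indicator {p..q+h} z * a (s - z) * prob {z-h<..z})" .
  qed
  finally show ?thesis .
qed

text \<open>
  The counterpart that averages over \<open>y - h \<le> z < y\<close>.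
\<close>

lemma smoothing_lower:
  fixes a :: "real \<Rightarrow> real"
  assumes "antimono a" "\<And>u. 0 \<le> a u" "h > 0"
  shows "(\<integral>\<^sup>+z. ennreal (indicator {p..q} z * a (s - z) * prob {z<..z+h}) \<partial>lborel)
     \<le> ennreal h * (\<integral>\<^sup>+y. ennreal (a (s - y)) \<partial>M)"
proof -
  have [measurable]: "a \<in> borel_measurable borel"
    using assms(1) by (rule borel_measurable_antimono)
  interpret P: pair_sigma_finite M lborel ..
  have "(\<integral>\<^sup>+z. ennreal (indicator {p..q} z * a (s - z) * prob {z<..z+h}) \<partial>lborel)
    = (\<integral>\<^sup>+z. (\<integral>\<^sup>+y. ennreal (if z < y \<and> y \<le> z + h \<and> p \<le> z \<and> z \<le> q then a (s - z) else 0) \<partial>M) \<partial>lborel)"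
  proof (rule nn_integral_cong)
    fix z
    have "(\<integral>\<^sup>+y. ennreal (if z < y \<and> y \<le> z + h \<and> p \<le> z \<and> z \<le> q then a (s - z) else 0) \<partial>M)
      = (\<integral>\<^sup>+y. ennreal (indicator {p..q} z * a (s - z)) * indicator {z<..z+h} y \<partial>M)"
      by (intro nn_integral_cong) (auto simp: indicator_def)
    also have "\<dots> = ennreal (indicator {p..q} z * a (s - z)) * emeasure M {z<..z+h}"
      by (subst nn_integral_cmult_indicator) auto
    also have "\<dots> = ennreal (indicator {p..q} z * a (s - z) * prob {z<..z+h})"
      by (simp add: emeasure_eq_measure ennreal_mult'' )
    finally show "ennreal (indicator {p..q} z * a (s - z) * prob {z<..z+h}) =
       (\<integral>\<^sup>+y. ennreal (if z < y \<and> y \<le> z + h \<and> p \<le> z \<and> z \<le> q then a (s - z) else 0) \<partial>M)" by simp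
  qed
  also have "\<dots> = (\<integral>\<^sup>+y. (\<integral>\<^sup>+z. ennreal (if z < y \<and> y \<le> z + h \<and> p \<le> z \<and> z \<le> q then a (s - z) else 0) \<partial>lborel) \<partial>M)"
    by (rule P.Fubini') measurable
  also have "\<dots> \<le> (\<integral>\<^sup>+y. ennreal h * ennreal (a (s - y)) \<partial>M)"
  proof (rule nn_integral_mono)
    fix y
    have "(\<integral>\<^sup>+z. ennreal (if z < y \<and> y \<le> z + h \<and> p \<le> z \<and> z \<le> q then a (s - z) else 0) \<partial>lborel)
      \<le> (\<integral>\<^sup>+z. ennreal (a (s - y)) * indicator {y-h..<y} z \<partial>lborel)"
      using antimonoD[OF assms(1)] by (intro nn_integral_mono) (auto simp: indicator_def intro!: ennreal_leI)
    also have "\<dots> = ennreal h * ennreal (a (s - y))"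
      using assms by (subst nn_integral_cmult_indicator) (auto simp: mult.commute)
    finally show "(\<integral>\<^sup>+z. ennreal (if z < y \<and> y \<le> z + h \<and> p \<le> z \<and> z \<le> q then a (s - z) else 0) \<partial>lborel)
       \<le> ennreal h * ennreal (a (s - y))" .
  qed
  also have "\<dots> = ennreal h * (\<integral>\<^sup>+y. ennreal (a (s - y)) \<partial>M)"
    by (rule nn_integral_cmult) measurable
  finally show ?thesis .
qed

end

lemma tilted_shift:
  assumes "shift_stable g" "c \<noteq> 0" "b \<sim>[at_top] (\<lambda>s. c * exp (-\<alpha> * s) * g s)"
  shows "(\<lambda>s. b (s + h)) \<sim>[at_top] (\<lambda>s. exp (-\<alpha> * h) * (c * exp (-\<alpha> * s) * g s))"
proof -
  have "filterlim (\<lambda>s. s + h) at_top at_top"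
    using filterlim_tendsto_add_at_top[OF tendsto_const[of h] filterlim_ident] by (simp add: add.commute)
  from asymp_equiv_compose'[OF assms(3) this]
  have "(\<lambda>s. b (s + h)) \<sim>[at_top] (\<lambda>s. c * exp (-\<alpha> * (s + h)) * g (s + h))" .
  also have "\<dots> \<sim>[at_top] (\<lambda>s. c * exp (-\<alpha> * (s + h)) * g s)"
    by (intro asymp_equiv_mult asymp_equiv_refl shift_stable_shift assms)
  also have "(\<lambda>s. c * exp (-\<alpha> * (s + h)) * g s) = (\<lambda>s. exp (-\<alpha> * h) * (c * exp (-\<alpha> * s) * g s))"
    by (rule ext) (simp add: exp_add[symmetric] algebra_simps flip: exp_add)
  finally show ?thesis .
qed

lemma tilted_shift_smallo:
  assumes "shift_stable g" "shift_stable f" "c > 0" "b \<sim>[at_top] (\<lambda>s. c * exp (-\<alpha> * s) * g s)"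
  shows "(\<lambda>s. b (s + h)) \<in> o(\<lambda>s. exp (-\<alpha> * s) * conv g f s)"
proof -
  have "(\<lambda>s. b (s + h)) \<in> O(\<lambda>s. exp (-\<alpha> * h) * (c * exp (-\<alpha> * s) * g s))"
    using tilted_shift[OF assms(1) _ assms(4)] assms(3) by (intro asymp_equiv_imp_bigo) auto
  also have "(\<lambda>s. exp (-\<alpha> * h) * (c * exp (-\<alpha> * s) * g s)) = (\<lambda>s. (exp (-\<alpha> * h) * c) * (exp (-\<alpha> * s) * g s))"
    by (simp add: mult_ac)
  also have "O(\<lambda>s. (exp (-\<alpha> * h) * c) * (exp (-\<alpha> * s) * g s)) = O(\<lambda>s. exp (-\<alpha> * s) * g s)"
    using assms(3) by simp
  also have "(\<lambda>s. exp (-\<alpha> * s) * g s) \<in> o(\<lambda>s. exp (-\<alpha> * s) * conv g f s)"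
    by (intro landau_o.big_small_mult landau_o.big_refl shift_stable_smallo_conv assms)
  finally show ?thesis .
qed

text \<open>
  These are the constants that upper and lower smoothing over a length \<open>h\<close> produce in place of \<open>\<alpha>\<close>; both
  tend to \<open>\<alpha>\<close> as \<open>h\<close> decreases to \<open>0\<close>.
\<close>

lemma difference_quotient_exp:
  fixes \<alpha> :: real
  assumes "\<alpha> > 0" "L > 1"
  obtains h where "h > 0" "(exp (\<alpha> * h) - 1) / h \<le> L * \<alpha>" "\<alpha> \<le> L * ((1 - exp (-\<alpha> * h)) / h)"
proof -
  have 1: "((\<lambda>h. (exp (\<alpha> * h) - 1) / h) \<longlongrightarrow> \<alpha>) (at_right 0)" by real_asymp
  have 2: "((\<lambda>h. (1 - exp (-\<alpha> * h)) / h) \<longlongrightarrow> \<alpha>) (at_right 0)" by real_asymp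
  have "\<forall>\<^sub>F h in at_right 0. (exp (\<alpha> * h) - 1) / h < L * \<alpha>"
    using order_tendstoD(2)[OF 1, of "L * \<alpha>"] assms by simp
  moreover have "\<forall>\<^sub>F h in at_right 0. (1 - exp (-\<alpha> * h)) / h > \<alpha> / L"
    using order_tendstoD(1)[OF 2, of "\<alpha> / L"] assms by (simp add: field_simps)
  moreover have "\<forall>\<^sub>F h in at_right (0::real). h > 0" by (rule eventually_at_right_less)
  ultimately have "\<forall>\<^sub>F h in at_right 0. h > 0 \<and> (exp (\<alpha> * h) - 1) / h \<le> L * \<alpha> \<and> \<alpha> \<le> L * ((1 - exp (-\<alpha> * h)) / h)"
  proof eventually_elim
    case (elim h)
    thus ?case using assms by (auto simp: field_simps)
  qed
  from eventually_happens[OF this] that show ?thesis by auto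
qed

context real_distribution begin

text \<open>
  Shift stability leaves only the exponential factor to distinguish the tail at \<open>z + u\<close> from the tail
  at \<open>z + v\<close>, so the difference of the tails is of the same order as each of them.
\<close>

lemma tilted_interval_prob:
  assumes f: "shift_stable f" and b: "(\<lambda>s. prob {s<..}) \<sim>[at_top] (\<lambda>s. exp (-\<alpha> * s) * f s)"
    and uv: "u < v" and \<alpha>: "\<alpha> > 0"
  shows "(\<lambda>z. prob {z+u<..z+v}) \<sim>[at_top] (\<lambda>z. (exp (-\<alpha> * u) - exp (-\<alpha> * v)) * (exp (-\<alpha> * z) * f z))"
proof (rule asymp_equivI'_const)
  have lim: "((\<lambda>z. prob {z+u<..} / (exp (-\<alpha> * z) * f z)) \<longlongrightarrow> exp (-\<alpha> * u)) at_top" for u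
  proof -
    have "(\<lambda>s. prob {s+u<..}) \<sim>[at_top] (\<lambda>s. exp (-\<alpha> * u) * (1 * exp (-\<alpha> * s) * f s))"
      by (rule tilted_shift[OF f]) (use b in auto)
    hence "((\<lambda>z. prob {z+u<..} / (exp (-\<alpha> * u) * (1 * exp (-\<alpha> * z) * f z))) \<longlongrightarrow> 1) at_top"
      by (rule asymp_equivD_strong) (use shift_stable_pos[OF f] in \<open>auto elim: eventually_mono\<close>)
    from tendsto_mult_left[OF this, of "exp (-\<alpha> * u)"] show ?thesis by simp
  qed
  have "prob {z+u<..z+v} = prob {z+u<..} - prob {z+v<..}" for z
  proof -
    have "{z+u<..z+v} = {z+u<..} - {z+v<..}" by auto
    moreover have "prob ({z+u<..} - {z+v<..}) = prob {z+u<..} - prob {z+v<..}"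
      by (rule finite_measure_Diff) (use uv in auto)
    ultimately show ?thesis by (simp only:)
  qed
  with tendsto_diff[OF lim[of u] lim[of v]]
  show "((\<lambda>z. prob {z+u<..z+v} / (exp (-\<alpha> * z) * f z)) \<longlongrightarrow> exp (-\<alpha> * u) - exp (-\<alpha> * v)) at_top"
    by (simp add: diff_divide_distrib)
  show "exp (-\<alpha> * u) - exp (-\<alpha> * v) \<noteq> 0" using uv \<alpha> by simp
qed

text \<open>
  The integral is cut at \<open>y = E\<close> and \<open>y = s - E\<close>. The left piece is at most \<open>a (s - E)\<close> and the right
  piece at most the tail of the law at \<open>s - E\<close>; both are negligible. The middle piece is smoothed, and
  there both tails may be replaced by their asymptotic forms, whose exponentials multiply to
  \<open>exp (-\<alpha> * s)\<close>.
\<close>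

lemma tilted_convolution_upper:
  fixes a :: "real \<Rightarrow> real"
  assumes a: "antimono a" "\<And>u. 0 \<le> a u" "\<And>u. a u \<le> 1" and pos: "\<alpha> > 0" "c > 0"
    and g: "shift_stable g" and f: "shift_stable f"
    and ag: "a \<sim>[at_top] (\<lambda>s. c * exp (-\<alpha> * s) * g s)"
    and bf: "(\<lambda>s. prob {s<..}) \<sim>[at_top] (\<lambda>s. exp (-\<alpha> * s) * f s)"
    and K: "K > 1"
  shows "\<forall>\<^sub>F s in at_top. (LINT y|M. a (s - y)) \<le> K * (\<alpha> * c * exp (-\<alpha> * s) * conv g f s)"
proof -
  note t = shift_stable_tame[OF g] shift_stable_tame[OF f]
  note [measurable] = tame_measurable[OF t(1)] tame_measurable[OF t(2)]
  have [measurable]: "a \<in> borel_measurable borel"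
    using a(1) by (rule borel_measurable_antimono)
  obtain L where L: "L > 1" "L ^ 4 = K" using factor_root[OF K, of 4] by auto
  obtain h where h: "h > 0" "(exp (\<alpha> * h) - 1) / h \<le> L * \<alpha>"
    using difference_quotient_exp[OF pos(1) L(1)] by metis
  define e where "e = exp (\<alpha> * h) - 1"
  have e: "e > 0" using pos h by (simp add: e_def)
  have "\<forall>\<^sub>F u in at_top. a u \<le> L * (c * exp (-\<alpha> * u) * g u)"
    by (rule asymp_equiv_factorD(1)[OF ag _ L(1)])
       (use shift_stable_pos[OF g] pos in \<open>auto elim: eventually_mono\<close>)
  moreover have "\<forall>\<^sub>F u in at_top. prob {u-h<..u} \<le> L * (e * (exp (-\<alpha> * u) * f u))"
  proof -
    have "\<forall>\<^sub>F u in at_top. e * (exp (-\<alpha> * u) * f u) > 0"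
      using shift_stable_pos[OF f] by eventually_elim (use e in simp)
    thus ?thesis
      using asymp_equiv_factorD(1)[OF tilted_interval_prob[OF f bf, of "-h" 0] _ L(1)] pos h by (simp add: e_def)
  qed
  ultimately have "\<forall>\<^sub>F u in at_top. a u \<le> L * (c * exp (-\<alpha> * u) * g u) \<and> prob {u-h<..u} \<le> L * (e * (exp (-\<alpha> * u) * f u))"
    by eventually_elim auto
  then obtain D where D: "\<And>u. u \<ge> D \<Longrightarrow> a u \<le> L * (c * exp (-\<alpha> * u) * g u)"
    "\<And>u. u \<ge> D \<Longrightarrow> prob {u-h<..u} \<le> L * (e * (exp (-\<alpha> * u) * f u))"
    unfolding eventually_at_top_linorder by blast
  \<comment> \<open>Smoothing moves \<open>z\<close> beyond \<open>y\<close> by up to \<open>h\<close>, so the cut leaves room for \<open>s - z \<ge> D\<close>.\<close>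
  define E where "E = D + h"
  define w where "w s = c * (exp (-\<alpha> * s) * conv g f s)" for s
  have w0: "w s \<ge> 0" for s unfolding w_def using pos conv_nonneg[OF t] by simp
  have main: "(LINT y|M. a (s - y)) \<le> a (s + - E) + prob {s + - E<..} + L^2 * (e / h) * w s" for s
  proof -
    have "ennreal h * (\<integral>\<^sup>+y. ennreal (indicator {E<..s-E} y * a (s - y)) \<partial>M)
       \<le> (\<integral>\<^sup>+z. ennreal (indicator {E..s-E+h} z * a (s - z) * prob {z-h<..z}) \<partial>lborel)"
      by (rule smoothing_upper[OF a(1,2) h(1)])
    also have "\<dots> \<le> (\<integral>\<^sup>+z. ennreal (L^2 * e * c * exp (-\<alpha> * s)) * ennreal (g (s - z) * f z) \<partial>lborel)"
    proof (rule nn_integral_mono)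
      fix z
      show "ennreal (indicator {E..s-E+h} z * a (s - z) * prob {z-h<..z}) \<le>
        ennreal (L^2 * e * c * exp (-\<alpha> * s)) * ennreal (g (s - z) * f z)"
      proof (cases "z \<in> {E..s-E+h}")
        case True
        hence "s - z \<ge> D" "z \<ge> D" using h by (auto simp: E_def)
        hence "a (s - z) * prob {z-h<..z} \<le> (L * (c * exp (-\<alpha> * (s - z)) * g (s - z))) * (L * (e * (exp (-\<alpha> * z) * f z)))"
          using pos L e by (intro mult_mono D) (auto simp: tame_nonneg t)
        also have "\<dots> = L^2 * e * c * (exp (-\<alpha> * (s - z)) * exp (-\<alpha> * z)) * (g (s - z) * f z)"
          by (simp add: power2_eq_square)
        also have "exp (-\<alpha> * (s - z)) * exp (-\<alpha> * z) = exp (-\<alpha> * s)"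
          by (simp add: algebra_simps flip: exp_add)
        finally show ?thesis using True e pos tame_nonneg[OF t(1)] tame_nonneg[OF t(2)] L
          by (subst ennreal_mult[symmetric]) (auto intro!: ennreal_leI)
      qed auto
    qed
    also have "\<dots> = ennreal (L^2 * e * c * exp (-\<alpha> * s)) * (\<integral>\<^sup>+z. ennreal (g (s - z) * f z) \<partial>lborel)"
      by (intro nn_integral_cmult) measurable
    also have "\<dots> = ennreal (L^2 * e * c * exp (-\<alpha> * s) * conv g f s)"
      unfolding nn_integral_conv[OF t] using e pos conv_nonneg[OF t] L by (subst ennreal_mult) auto
    also have "L^2 * e * c * exp (-\<alpha> * s) * conv g f s = h * (L^2 * (e / h) * w s)"
      using h by (simp add: w_def)
    also have "ennreal \<dots> = ennreal h * ennreal (L^2 * (e / h) * w s)"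
      using h e w0[of s] by (intro ennreal_mult) auto
    finally have mid: "(\<integral>\<^sup>+y. ennreal (indicator {E<..s-E} y * a (s - y)) \<partial>M) \<le> ennreal (L^2 * (e / h) * w s)"
      using h by (subst (asm) ennreal_mult_le_mult_iff) auto
    have nn: "L^2 * (e / h) * w s \<ge> 0" using e h w0[of s] by simp
    have "ennreal (LINT y|M. a (s - y)) = (\<integral>\<^sup>+y. ennreal (a (s - y)) \<partial>M)"
      using a(2,3) by (intro nn_integral_eq_integral[symmetric] integrable_const_bound[where B = 1]) auto
    also have "\<dots> \<le> (\<integral>\<^sup>+y. ennreal (a (s - E)) + indicator {s-E<..} y + ennreal (indicator {E<..s-E} y * a (s - y)) \<partial>M)"
    proof (rule nn_integral_mono)
      fix y
      consider "y \<le> E" | "y > s - E" | "y \<in> {E<..s-E}" by force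
      thus "ennreal (a (s - y)) \<le> ennreal (a (s - E)) + indicator {s-E<..} y + ennreal (indicator {E<..s-E} y * a (s - y))"
      proof cases
        case 1
        hence "ennreal (a (s - y)) \<le> ennreal (a (s - E))" using antimonoD[OF a(1), of "s-E" "s-y"] by (auto intro: ennreal_leI)
        thus ?thesis by (metis add_increasing2 zero_le)
      next
        case 2
        have "ennreal (a (s - y)) \<le> ennreal 1" by (rule ennreal_leI) (rule a)
        hence "ennreal (a (s - y)) \<le> indicator {s-E<..} y" using 2 by simp
        thus ?thesis by (metis add_increasing add_increasing2 zero_le)
      next
        case 3
        thus ?thesis by (simp add: add_increasing)
      qed
    qed
    also have "\<dots> = ennreal (a (s - E)) + emeasure M {s-E<..} + (\<integral>\<^sup>+y. ennreal (indicator {E<..s-E} y * a (s - y)) \<partial>M)"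
      by (subst nn_integral_add, measurable, subst nn_integral_add) (auto simp: emeasure_space_1[simplified])
    also have "\<dots> \<le> ennreal (a (s - E)) + emeasure M {s-E<..} + ennreal (L^2 * (e / h) * w s)"
      by (intro add_left_mono mid)
    also have "\<dots> = ennreal (a (s - E) + prob {s-E<..} + L^2 * (e / h) * w s)"
      unfolding emeasure_eq_measure using a(2)[of "s - E"] nn
      by (metis ennreal_plus add_nonneg_nonneg measure_nonneg)
    finally have "ennreal (LINT y|M. a (s - y)) \<le> ennreal (a (s - E) + prob {s-E<..} + L^2 * (e / h) * w s)" .
    moreover have "0 \<le> a (s - E) + prob {s-E<..} + L^2 * (e / h) * w s"
      by (intro add_nonneg_nonneg a(2) nn measure_nonneg)
    ultimately have "(LINT y|M. a (s - y)) \<le> a (s - E) + prob {s-E<..} + L^2 * (e / h) * w s"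
      by (simp only: ennreal_le_iff)
    thus ?thesis by (simp only: diff_conv_add_uminus)
  qed
  have bf': "(\<lambda>s. prob {s<..}) \<sim>[at_top] (\<lambda>s. 1 * exp (-\<alpha> * s) * f s)" using bf by simp
  have "(\<lambda>s. a (s + - E)) \<in> o(\<lambda>s. exp (-\<alpha> * s) * conv g f s)"
    by (rule tilted_shift_smallo[OF g f pos(2) ag])
  moreover have "(\<lambda>s. prob {s + - E<..}) \<in> o(\<lambda>s. exp (-\<alpha> * s) * conv g f s)"
    using tilted_shift_smallo[OF f g _ bf', of "-E"] conv_commute[of f g] by simp
  ultimately have "(\<lambda>s. a (s + - E) + prob {s + - E<..}) \<in> o(\<lambda>s. exp (-\<alpha> * s) * conv g f s)"
    by (rule sum_in_smallo)
  hence "(\<lambda>s. a (s + - E) + prob {s + - E<..}) \<in> o(w)"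
    unfolding w_def using pos by simp
  hence "\<forall>\<^sub>F s in at_top. a (s + - E) + prob {s + - E<..} \<le> ((L-1) * L^3 * \<alpha>) * w s"
  proof (rule smallo_leD)
    show "(L-1) * L^3 * \<alpha> > 0" using L pos by simp
    show "\<forall>\<^sub>F s in at_top. 0 \<le> a (s + - E) + prob {s + - E<..}"
      by (intro always_eventually allI add_nonneg_nonneg a(2)) simp
    show "\<forall>\<^sub>F s in at_top. 0 \<le> w s" by (intro always_eventually allI w0)
  qed
  thus ?thesis
  proof eventually_elim
    case (elim s)
    have "(LINT y|M. a (s - y)) \<le> (L-1) * L^3 * \<alpha> * w s + L^2 * (e / h) * w s"
      using main[of s] elim by simp
    also have "L^2 * (e / h) * w s \<le> L^2 * (L * \<alpha>) * w s"
      using h L w0 by (intro mult_right_mono mult_left_mono) (auto simp: e_def)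
    finally have "(LINT y|M. a (s - y)) \<le> L^4 * (\<alpha> * w s)"
      by (simp add: algebra_simps eval_nat_numeral)
    thus ?case by (simp add: L(2) w_def mult_ac)
  qed
qed

text \<open>
  Only the middle range is kept; it carries almost all of \<open>conv g f\<close> by \<open>conv_middle_asymp\<close>.
\<close>

lemma tilted_convolution_lower:
  fixes a :: "real \<Rightarrow> real"
  assumes a: "antimono a" "\<And>u. 0 \<le> a u" "\<And>u. a u \<le> 1" and pos: "\<alpha> > 0" "c > 0"
    and g: "shift_stable g" and f: "shift_stable f"
    and ag: "a \<sim>[at_top] (\<lambda>s. c * exp (-\<alpha> * s) * g s)"
    and bf: "(\<lambda>s. prob {s<..}) \<sim>[at_top] (\<lambda>s. exp (-\<alpha> * s) * f s)"
    and K: "K > 1"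
  shows "\<forall>\<^sub>F s in at_top. \<alpha> * c * exp (-\<alpha> * s) * conv g f s \<le> K * (LINT y|M. a (s - y))"
proof -
  note t = shift_stable_tame[OF g] shift_stable_tame[OF f]
  note [measurable] = tame_measurable[OF t(1)] tame_measurable[OF t(2)]
  have [measurable]: "a \<in> borel_measurable borel"
    using a(1) by (rule borel_measurable_antimono)
  obtain L where L: "L > 1" "L ^ 4 = K" using factor_root[OF K, of 4] by auto
  obtain h where h: "h > 0" "\<alpha> \<le> L * ((1 - exp (-\<alpha> * h)) / h)"
    using difference_quotient_exp[OF pos(1) L(1)] by metis
  define e where "e = 1 - exp (-\<alpha> * h)"
  have e: "e > 0" using pos h by (simp add: e_def)
  have "\<forall>\<^sub>F u in at_top. c * exp (-\<alpha> * u) * g u \<le> L * a u"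
    by (rule asymp_equiv_factorD(2)[OF ag _ L(1)])
       (use shift_stable_pos[OF g] pos in \<open>auto elim: eventually_mono\<close>)
  moreover have "\<forall>\<^sub>F u in at_top. e * (exp (-\<alpha> * u) * f u) \<le> L * prob {u<..u+h}"
  proof -
    have "\<forall>\<^sub>F u in at_top. e * (exp (-\<alpha> * u) * f u) > 0"
      using shift_stable_pos[OF f] by eventually_elim (use e in simp)
    thus ?thesis
      using asymp_equiv_factorD(2)[OF tilted_interval_prob[OF f bf, of 0 h] _ L(1)] pos h by (simp add: e_def)
  qed
  ultimately have "\<forall>\<^sub>F u in at_top. c * exp (-\<alpha> * u) * g u \<le> L * a u \<and> e * (exp (-\<alpha> * u) * f u) \<le> L * prob {u<..u+h}"
    by eventually_elim auto
  then obtain D' where D': "\<And>u. u \<ge> D' \<Longrightarrow> c * exp (-\<alpha> * u) * g u \<le> L * a u"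
    "\<And>u. u \<ge> D' \<Longrightarrow> e * (exp (-\<alpha> * u) * f u) \<le> L * prob {u<..u+h}"
    unfolding eventually_at_top_linorder by blast
  define D where "D = max D' 0"
  define J where "J s = conv_on {D..s-D} g f s" for s
  have J0: "J s \<ge> 0" for s unfolding J_def by (rule conv_part_nonneg[OF t])
  have main: "(e / h) * c * exp (-\<alpha> * s) * J s \<le> L^2 * (LINT y|M. a (s - y))" for s
  proof -
    have int0: "(LINT y|M. a (s - y)) \<ge> 0" using a by (intro Bochner_Integration.integral_nonneg) auto
    have "ennreal (e * c * exp (-\<alpha> * s) * J s) = ennreal (e * c * exp (-\<alpha> * s)) * (\<integral>\<^sup>+z. ennreal (indicator {D..s-D} z *\<^sub>R (g (s - z) * f z)) \<partial>lborel)"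
    proof -
      have "(\<integral>\<^sup>+z. ennreal (indicator {D..s-D} z *\<^sub>R (g (s - z) * f z)) \<partial>lborel) = ennreal (J s)"
        unfolding J_def set_lebesgue_integral_def
        using tame_conv_set_integrable[OF t, of D "s - D" s]
        by (intro nn_integral_eq_integral) (auto simp: set_integrable_def tame_nonneg t)
      thus ?thesis using e pos J0 by (simp add: ennreal_mult)
    qed
    also have "\<dots> = (\<integral>\<^sup>+z. ennreal (e * c * exp (-\<alpha> * s)) * ennreal (indicator {D..s-D} z *\<^sub>R (g (s - z) * f z)) \<partial>lborel)"
      by (intro nn_integral_cmult[symmetric]) measurable
    also have "\<dots> \<le> (\<integral>\<^sup>+z. ennreal (L^2) * ennreal (indicator {D..s-D} z * a (s - z) * prob {z<..z+h}) \<partial>lborel)"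
    proof (rule nn_integral_mono)
      fix z
      show "ennreal (e * c * exp (-\<alpha> * s)) * ennreal (indicator {D..s-D} z *\<^sub>R (g (s - z) * f z)) \<le>
        ennreal (L^2) * ennreal (indicator {D..s-D} z * a (s - z) * prob {z<..z+h})"
      proof (cases "z \<in> {D..s-D}")
        case True
        hence z: "s - z \<ge> D'" "z \<ge> D'" using h by (auto simp: D_def)
        have "e * c * exp (-\<alpha> * s) * (g (s - z) * f z) = e * c * (exp (-\<alpha> * (s - z)) * exp (-\<alpha> * z)) * (g (s - z) * f z)"
          by (simp add: algebra_simps flip: exp_add)
        also have "\<dots> = (c * exp (-\<alpha> * (s - z)) * g (s - z)) * (e * (exp (-\<alpha> * z) * f z))"
          by (simp only: mult_ac)
        also have "\<dots> \<le> (L * a (s - z)) * (L * prob {z<..z+h})"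
          using pos L e a(2)
          by (intro mult_mono[OF D'(1)[OF z(1)] D'(2)[OF z(2)]]) (auto simp: tame_nonneg t)
        also have "\<dots> = L^2 * (a (s - z) * prob {z<..z+h})" by (simp add: power2_eq_square)
        finally show ?thesis using True e pos tame_nonneg[OF t(1)] tame_nonneg[OF t(2)] L a(2)
          by (subst (1 2) ennreal_mult[symmetric]) (auto intro!: ennreal_leI)
      qed auto
    qed
    also have "\<dots> = ennreal (L^2) * (\<integral>\<^sup>+z. ennreal (indicator {D..s-D} z * a (s - z) * prob {z<..z+h}) \<partial>lborel)"
    proof (rule nn_integral_cmult)
      have "prob {z<..z+h} = cdf M (z + h) - cdf M z" for z
        using cdf_diff_eq[of z "z+h"] h by simp
      thus "(\<lambda>z. ennreal (indicator {D..s-D} z * a (s - z) * prob {z<..z+h})) \<in> borel_measurable lborel"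
        using borel_measurable_mono[of "cdf M"] cdf_nondecreasing by (simp add: mono_def)
    qed
    also have "\<dots> \<le> ennreal (L^2) * (ennreal h * (\<integral>\<^sup>+y. ennreal (a (s - y)) \<partial>M))"
      by (intro mult_left_mono smoothing_lower a h) auto
    also have "(\<integral>\<^sup>+y. ennreal (a (s - y)) \<partial>M) = ennreal (LINT y|M. a (s - y))"
      using a by (intro nn_integral_eq_integral integrable_const_bound[where B = 1]) auto
    also have "ennreal (L^2) * (ennreal h * ennreal (LINT y|M. a (s - y))) = ennreal (L^2 * (h * (LINT y|M. a (s - y))))"
      using h int0 by (simp add: ennreal_mult)
    finally have "e * c * exp (-\<alpha> * s) * J s \<le> L^2 * (h * (LINT y|M. a (s - y)))"
      using h int0 by (subst (asm) ennreal_le_iff) auto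
    thus ?thesis using h by (simp add: field_simps)
  qed
  have "\<forall>\<^sub>F s in at_top. conv g f s \<le> L * J s"
    unfolding J_def
    by (rule asymp_equiv_factorD(2)[OF conv_middle_asymp[OF g f] conv_pos[OF g f] L(1)]) (simp add: D_def)
  thus ?thesis
  proof eventually_elim
    case (elim s)
    have "\<alpha> * c * exp (-\<alpha> * s) * conv g f s \<le> (L * (e / h)) * c * exp (-\<alpha> * s) * (L * J s)"
      using elim h pos conv_nonneg[OF t, of s] e L by (intro mult_mono) (auto simp: e_def)
    also have "\<dots> = L^2 * ((e / h) * c * exp (-\<alpha> * s) * J s)" by (simp add: power2_eq_square)
    also have "\<dots> \<le> L^2 * (L^2 * (LINT y|M. a (s - y)))"
      using main[of s] by (intro mult_left_mono) auto
    finally show ?case using L by (simp add: mult.assoc flip: power_add)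
  qed
qed

theorem tilted_convolution:
  fixes a :: "real \<Rightarrow> real"
  assumes a: "antimono a" "\<And>u. 0 \<le> a u" "\<And>u. a u \<le> 1" and pos: "\<alpha> > 0" "c > 0"
    and g: "shift_stable g" and f: "shift_stable f"
    and ag: "a \<sim>[at_top] (\<lambda>s. c * exp (-\<alpha> * s) * g s)"
    and bf: "(\<lambda>s. prob {s<..}) \<sim>[at_top] (\<lambda>s. exp (-\<alpha> * s) * f s)"
  shows "(\<lambda>s. LINT y|M. a (s - y)) \<sim>[at_top] (\<lambda>s. \<alpha> * c * exp (-\<alpha> * s) * conv g f s)"
proof (rule asymp_equiv_factorI)
  show "\<forall>\<^sub>F s in at_top. \<alpha> * c * exp (-\<alpha> * s) * conv g f s > 0"
    using conv_pos[OF g f] by eventually_elim (use pos in simp)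
  fix K :: real assume "K > 1"
  show "\<forall>\<^sub>F s in at_top. (LINT y|M. a (s - y)) \<le> K * (\<alpha> * c * exp (-\<alpha> * s) * conv g f s) \<and>
      \<alpha> * c * exp (-\<alpha> * s) * conv g f s \<le> K * (LINT y|M. a (s - y))"
    by (intro eventually_conj tilted_convolution_upper[OF assms \<open>K > 1\<close>]
        tilted_convolution_lower[OF assms \<open>K > 1\<close>])
qed

end

section \<open>Regular variation and Potter bounds\<close>

text \<open>
  The scaling clause of regular variation. It passes to asymptotically equivalent functions and to
  products; measurability and positivity are supplied by \<open>shift_stable\<close>.
\<close>

definition scales :: "real \<Rightarrow> (real \<Rightarrow> real) \<Rightarrow> bool" where
  "scales \<gamma> u \<longleftrightarrow> (\<forall>t>0. (\<lambda>x. u (x * t)) \<sim>[at_top] (\<lambda>x. t powr \<gamma> * u x))"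

lemma scalesD: "scales \<gamma> u \<Longrightarrow> t > 0 \<Longrightarrow> (\<lambda>x. u (x * t)) \<sim>[at_top] (\<lambda>x. t powr \<gamma> * u x)"
  unfolding scales_def by blast

lemma filterlim_times_at_top: "t > 0 \<Longrightarrow> filterlim (\<lambda>x::real. x * t) at_top at_top"
  by (subst mult.commute) (rule filterlim_tendsto_pos_mult_at_top[OF tendsto_const _ filterlim_ident])

lemma scales_cong:
  assumes "u \<sim>[at_top] v" "scales \<gamma> v"
  shows "scales \<gamma> u"
  unfolding scales_def
proof (intro allI impI)
  fix t :: real assume t: "t > 0"
  have "(\<lambda>x. u (x * t)) \<sim>[at_top] (\<lambda>x. v (x * t))"
    by (rule asymp_equiv_compose'[OF assms(1) filterlim_times_at_top[OF t]])
  also have "\<dots> \<sim>[at_top] (\<lambda>x. t powr \<gamma> * v x)" by (rule scalesD[OF assms(2) t])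
  also have "\<dots> \<sim>[at_top] (\<lambda>x. t powr \<gamma> * u x)"
    by (intro asymp_equiv_mult asymp_equiv_refl) (rule asymp_equiv_symI[OF assms(1)])
  finally show "(\<lambda>x. u (x * t)) \<sim>[at_top] (\<lambda>x. t powr \<gamma> * u x)" .
qed

lemma scales_mult:
  assumes "scales \<gamma> u" "scales \<delta> v"
  shows "scales (\<gamma> + \<delta>) (\<lambda>x. u x * v x)"
  unfolding scales_def
proof (intro allI impI)
  fix t :: real assume t: "t > 0"
  have "(\<lambda>x. u (x * t) * v (x * t)) \<sim>[at_top] (\<lambda>x. (t powr \<gamma> * u x) * (t powr \<delta> * v x))"
    by (intro asymp_equiv_mult scalesD assms t)
  thus "(\<lambda>x. u (x * t) * v (x * t)) \<sim>[at_top] (\<lambda>x. t powr (\<gamma> + \<delta>) * (u x * v x))"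
    by (simp add: powr_add mult_ac)
qed

lemma scales_ident: "scales 1 (\<lambda>x. x)"
  unfolding scales_def by (auto simp: mult.commute)

text \<open>
  In the variable \<open>s = ln x\<close> the function \<open>u (exp s) * exp (-\<gamma> * s)\<close> is insensitive to shifts, so the
  uniform convergence theorem applies to it.
\<close>

lemma uniform_scaling:
  assumes meas: "u \<in> borel_measurable borel" and pos: "\<forall>\<^sub>F x in at_top. u x > 0"
    and sc: "scales \<gamma> u" and K: "K > 1" and c: "c \<ge> 1"
  shows "\<forall>\<^sub>F x in at_top. \<forall>y\<in>{x/c..x}. u y \<le> K * ((y / x) powr \<gamma> * u x) \<and> (y / x) powr \<gamma> * u x \<le> K * u y"
proof -
  define k where "k s = u (exp s) * exp (-\<gamma> * s)" for s
  have "\<forall>\<^sub>F s in at_top. \<forall>h\<in>{0..ln c}. k (s - h) \<le> K * k s \<and> k s \<le> K * k (s - h)"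
  proof (rule uniform_shift[OF _ _ _ K])
    show "k \<in> borel_measurable borel" unfolding k_def using meas by measurable
    show "\<forall>\<^sub>F s in at_top. k s > 0"
      using eventually_compose_filterlim[OF pos exp_at_top] by eventually_elim (simp add: k_def)
    fix h :: real
    have "(\<lambda>s. u (exp s * exp h)) \<sim>[at_top] (\<lambda>s. exp h powr \<gamma> * u (exp s))"
      by (rule asymp_equiv_compose'[OF scalesD[OF sc] exp_at_top]) simp
    hence "(\<lambda>s. u (exp s * exp h) * exp (-\<gamma> * (s + h))) \<sim>[at_top] (\<lambda>s. exp h powr \<gamma> * u (exp s) * exp (-\<gamma> * (s + h)))"
      by (intro asymp_equiv_mult asymp_equiv_refl)
    moreover have "(\<lambda>s. exp h powr \<gamma> * u (exp s) * exp (-\<gamma> * (s + h))) = k"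
      by (rule ext) (simp add: k_def powr_def algebra_simps flip: exp_add)
    moreover have "(\<lambda>s. u (exp s * exp h) * exp (-\<gamma> * (s + h))) = (\<lambda>s. k (s + h))"
      by (simp add: k_def exp_add)
    ultimately show "(\<lambda>s. k (s + h)) \<sim>[at_top] k" by simp
  qed
  from eventually_compose_filterlim[OF this ln_at_top] eventually_gt_at_top[of 0]
  show ?thesis
  proof eventually_elim
    case (elim x)
    show ?case
    proof
      fix y assume y: "y \<in> {x/c..x}"
      have "x / c > 0" using elim c by simp
      hence y0: "y > 0" using y by simp
      define h where "h = ln x - ln y"
      have h0: "h \<ge> 0" using y y0 elim by (simp add: h_def)
      have "x \<le> c * y" using y c by (simp add: field_simps)
      hence "ln x \<le> ln (c * y)" using elim y0 c by (subst ln_le_cancel_iff) auto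
      hence h1: "h \<le> ln c" using c y0 by (simp add: h_def ln_mult)
      have "k (ln x - h) = u y * y powr (-\<gamma>)" "k (ln x) = u x * x powr (-\<gamma>)"
        using y0 elim by (simp_all add: k_def h_def powr_def)
      moreover have "k (ln x - h) \<le> K * k (ln x)" "k (ln x) \<le> K * k (ln x - h)"
        using elim h0 h1 by auto
      ultimately have 1: "u y * y powr (-\<gamma>) \<le> K * (u x * x powr (-\<gamma>))" "u x * x powr (-\<gamma>) \<le> K * (u y * y powr (-\<gamma>))"
        by auto
      have e: "y powr (-\<gamma>) * y powr \<gamma> = 1" using y0 by (simp flip: powr_add)
      have q: "(y / x) powr \<gamma> = x powr (-\<gamma>) * y powr \<gamma>"
        using y0 elim by (simp add: powr_divide powr_minus field_simps)
      have "u y * y powr (-\<gamma>) * y powr \<gamma> \<le> K * (u x * x powr (-\<gamma>)) * y powr \<gamma>"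
        by (rule mult_right_mono[OF 1(1)]) simp
      hence 2: "u y \<le> K * ((y / x) powr \<gamma> * u x)" unfolding q using e by (simp add: mult_ac)
      have "u x * x powr (-\<gamma>) * y powr \<gamma> \<le> K * (u y * y powr (-\<gamma>)) * y powr \<gamma>"
        by (rule mult_right_mono[OF 1(2)]) simp
      also have "\<dots> = K * u y * (y powr (-\<gamma>) * y powr \<gamma>)" by (simp only: mult_ac)
      finally have 3: "(y / x) powr \<gamma> * u x \<le> K * u y" unfolding q e by (simp add: mult_ac)
      show "u y \<le> K * ((y / x) powr \<gamma> * u x) \<and> (y / x) powr \<gamma> * u x \<le> K * u y" using 2 3 by blast
    qed
  qed
qed

lemmas stable_uniform_scaling = uniform_scaling[OF tame_measurable[OF shift_stable_tame] shift_stable_pos]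

text \<open>
  Halving \<open>x\<close> repeatedly: one step costs at most the factor \<open>2 powr \<delta>\<close> over the pure power, and the
  number of steps is logarithmic in \<open>x / y\<close>, so the accumulated cost is a power \<open>\<delta>\<close> of \<open>x / y\<close>.
\<close>

lemma potter_bound:
  assumes u: "shift_stable u" "scales \<gamma> u" and \<delta>: "\<delta> > 0"
  obtains A where "A > 0" "\<And>x y. A \<le> y \<Longrightarrow> y \<le> x \<Longrightarrow> u y \<le> 2 powr \<delta> * (y / x) powr (\<gamma> - \<delta>) * u x"
proof -
  have K: "(2::real) powr \<delta> > 1" using \<delta> by simp
  obtain A0 where A0: "\<And>x y. x \<ge> A0 \<Longrightarrow> y \<in> {x/2..x} \<Longrightarrow> u y \<le> 2 powr \<delta> * ((y / x) powr \<gamma> * u x)"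
    using stable_uniform_scaling[OF u(1,1,2) K, of 2, simplified]
    unfolding eventually_at_top_linorder by meson
  define A where "A = max A0 1"
  have step: "u y \<le> 2 powr \<delta> * (y / x) powr (\<gamma> - \<delta>) * u x"
    if "A \<le> y" "y \<le> x" "x \<le> 2 ^ n * y" for n x y
    using that
  proof (induction n arbitrary: y)
    case 0
    hence "y = x" by simp
    moreover have "y > 0" using 0 by (simp add: A_def)
    ultimately show ?case using K tame_nonneg[OF shift_stable_tame[OF u(1)], of y]
      by (simp add: mult_le_cancel_right1)
  next
    case (Suc n)
    have y: "y > 0" "x > 0" using Suc.prems by (auto simp: A_def)
    show ?case
    proof (cases "x \<le> 2 * y")
      case True
      hence "u y \<le> 2 powr \<delta> * ((y / x) powr \<gamma> * u x)"
        using Suc.prems by (intro A0) (auto simp: A_def)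
      also have "(y / x) powr \<gamma> \<le> (y / x) powr (\<gamma> - \<delta>)"
        using y Suc.prems \<delta> by (intro powr_mono') auto
      finally show ?thesis using K tame_nonneg[OF shift_stable_tame[OF u(1)], of x]
        by (simp add: mult.assoc mult_left_mono mult_right_mono)
    next
      case False
      have "u y \<le> 2 powr \<delta> * ((y / (2 * y)) powr \<gamma> * u (2 * y))"
        using Suc.prems y by (intro A0) (auto simp: A_def)
      also have "\<dots> = (1/2) powr (\<gamma> - \<delta>) * u (2 * y)"
        using y by (simp add: powr_diff powr_divide field_simps)
      also have "u (2 * y) \<le> 2 powr \<delta> * ((2 * y) / x) powr (\<gamma> - \<delta>) * u x"
        using Suc.prems y False by (intro Suc.IH) auto
      also have "(1/2) powr (\<gamma> - \<delta>) * (2 powr \<delta> * ((2 * y) / x) powr (\<gamma> - \<delta>) * u x)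
        = 2 powr \<delta> * (((1/2) powr (\<gamma> - \<delta>) * ((2 * y) / x) powr (\<gamma> - \<delta>)) * u x)"
        by (simp only: mult_ac)
      also have "(1/2) powr (\<gamma> - \<delta>) * ((2 * y) / x) powr (\<gamma> - \<delta>) = (y / x) powr (\<gamma> - \<delta>)"
        using y by (subst powr_mult[symmetric]) auto
      finally show ?thesis by (simp add: mult.assoc)
    qed
  qed
  show ?thesis
  proof (rule that[of A])
    show "A > 0" by (simp add: A_def)
    fix x y assume xy: "A \<le> y" "y \<le> x"
    have y: "y > 0" using xy by (simp add: A_def)
    obtain n where "x / y < 2 ^ n" using real_arch_pow[of 2 "x / y"] by auto
    hence "x \<le> 2 ^ n * y" using y by (simp add: field_simps)
    thus "u y \<le> 2 powr \<delta> * (y / x) powr (\<gamma> - \<delta>) * u x" using step xy by blast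
  qed
qed

section \<open>Convolution of regularly varying functions\<close>

lemma Beta_set_integral:
  fixes a b :: real assumes "a > 0" "b > 0"
  shows "(LINT t:{0..1}|lborel. t powr (a - 1) * (1 - t) powr (b - 1)) = Beta a b"
  using set_borel_integral_eq_integral(2)[OF integrable_Beta[OF assms]]
    integral_unique[OF has_integral_Beta_real[OF assms]] by simp

text \<open>
  By \<open>conv_middle_asymp\<close> the ends, where Potter's bounds fail, may be cut off. After the
  substitution \<open>z = x t\<close> and division by \<open>g x * f x\<close> the integrand converges pointwise to
  \<open>(1 - t) powr \<gamma> * t powr \<phi>\<close> and is dominated by a constant times the same expression with both
  exponents lowered by \<open>\<delta>\<close>, still above \<open>-1\<close>.
\<close>

theorem conv_asymp_Beta:
  assumes g: "shift_stable g" "scales \<gamma> g" "\<gamma> > -1"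
    and f: "shift_stable f" "scales \<phi> f" "\<phi> > -1"
  shows "conv g f \<sim>[at_top] (\<lambda>x. x * g x * f x * Beta (\<gamma> + 1) (\<phi> + 1))"
proof -
  note [measurable] = tame_measurable[OF shift_stable_tame[OF g(1)]] tame_measurable[OF shift_stable_tame[OF f(1)]]
  define \<delta> where "\<delta> = min (\<gamma> + 1) (\<phi> + 1) / 2"
  have \<delta>: "\<delta> > 0" "\<gamma> - \<delta> > -1" "\<phi> - \<delta> > -1" using g(3) f(3) by (auto simp: \<delta>_def min_def field_simps)
  obtain A1 where A1: "A1 > 0" "\<And>x y. A1 \<le> y \<Longrightarrow> y \<le> x \<Longrightarrow> g y \<le> 2 powr \<delta> * (y / x) powr (\<gamma> - \<delta>) * g x"
    using potter_bound[OF g(1,2) \<delta>(1)] by metis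
  obtain A2 where A2: "A2 > 0" "\<And>x y. A2 \<le> y \<Longrightarrow> y \<le> x \<Longrightarrow> f y \<le> 2 powr \<delta> * (y / x) powr (\<phi> - \<delta>) * f x"
    using potter_bound[OF f(1,2) \<delta>(1)] by metis
  define A where "A = max A1 A2"
  have A: "A > 0" "A \<ge> A1" "A \<ge> A2" using A1 A2 by (auto simp: A_def)
  define I where "I x t = indicator {A..x-A} (x * t) * ((g (x - x * t) / g x) * (f (x * t) / f x))" for x t
  define J where "J t = (if 0 < t \<and> t < 1 then (1 - t) powr \<gamma> * t powr \<phi> else 0)" for t :: real
  define w where "w t = (2 powr \<delta> * 2 powr \<delta>) * (indicator {0..1} t *\<^sub>R (t powr (\<phi> - \<delta> + 1 - 1) * (1 - t) powr (\<gamma> - \<delta> + 1 - 1)))" for t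
  have "((\<lambda>x. LINT t|lborel. I x t) \<longlongrightarrow> (LINT t|lborel. J t)) at_top"
  proof (rule integral_dominated_convergence_at_top[where s = I and f = J and w = w])
    show "J \<in> borel_measurable lborel" unfolding J_def by measurable
    show "I x \<in> borel_measurable lborel" for x unfolding I_def by measurable
    show "integrable lborel w" unfolding w_def
      using integrable_Beta[of "\<phi> - \<delta> + 1" "\<gamma> - \<delta> + 1"] \<delta> unfolding set_integrable_def
      by (intro integrable_mult_right) auto
    show "AE t in lborel. ((\<lambda>x. I x t) \<longlongrightarrow> J t) at_top"
    proof (rule AE_I2)
      fix t :: real
      show "((\<lambda>x. I x t) \<longlongrightarrow> J t) at_top"
      proof (cases "0 < t \<and> t < 1")
        case True
        have lim: "((\<lambda>x. u (x * r) / u x) \<longlongrightarrow> r powr \<kappa>) at_top"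
          if "r > 0" "shift_stable u" "scales \<kappa> u" for r \<kappa> u
        proof -
          have "((\<lambda>x. u (x * r) / (r powr \<kappa> * u x)) \<longlongrightarrow> 1) at_top"
          proof (rule asymp_equivD_strong[OF scalesD[OF that(3,1)]])
            show "\<forall>\<^sub>F x in at_top. u (x * r) \<noteq> 0 \<or> r powr \<kappa> * u x \<noteq> 0"
              using shift_stable_pos[OF that(2)] by eventually_elim (use that in simp)
          qed
          from tendsto_mult_left[OF this, of "r powr \<kappa>"] show ?thesis using that by simp
        qed
        have "((\<lambda>x. (g (x * (1 - t)) / g x) * (f (x * t) / f x)) \<longlongrightarrow> (1 - t) powr \<gamma> * t powr \<phi>) at_top"
          using True by (intro tendsto_mult lim g f) auto
        moreover have "\<forall>\<^sub>F x in at_top. (g (x * (1 - t)) / g x) * (f (x * t) / f x) = I x t"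
          using eventually_ge_at_top[of "A / t"] eventually_ge_at_top[of "A / (1 - t)"]
          by eventually_elim (use True in \<open>auto simp: I_def field_simps\<close>)
        ultimately show ?thesis using True by (simp add: J_def Lim_transform_eventually)
      next
        case False
        have "\<forall>\<^sub>F x in at_top. I x t = 0" using eventually_gt_at_top[of 0]
        proof eventually_elim
          case (elim x)
          have "x * t \<notin> {A..x-A}"
          proof
            assume a: "x * t \<in> {A..x-A}"
            hence "A \<le> x * t \<and> x * t \<le> x - A" by simp
            hence "x * t > 0" "x * t < x" using A(1) by linarith+
            hence "t > 0" "t < 1" using elim by (auto simp: zero_less_mult_iff)
            thus False using False by simp
          qed
          thus ?case by (simp add: I_def)
        qed
        moreover have "J t = 0" unfolding J_def using False by (rule if_not_P)
        ultimately show ?thesis by (simp add: tendsto_eventually)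
      qed
    qed
    show "\<forall>\<^sub>F x in at_top. AE t in lborel. norm (I x t) \<le> w t"
      using shift_stable_pos[OF g(1)] shift_stable_pos[OF f(1)] eventually_gt_at_top[of 0]
    proof eventually_elim
      case (elim x)
      show ?case
      proof (rule AE_I2)
        fix t
        show "norm (I x t) \<le> w t"
        proof (cases "x * t \<in> {A..x-A}")
          case True
          hence "A \<le> x * t \<and> x * t \<le> x - A" by simp
            hence "x * t > 0" "x * t < x" using A(1) by linarith+
          hence t: "t > 0" "t < 1" using elim by (auto simp: zero_less_mult_iff)
          have "g (x - x * t) \<le> 2 powr \<delta> * ((x - x * t) / x) powr (\<gamma> - \<delta>) * g x"
            using True A t elim by (intro A1) auto
          hence 1: "g (x - x * t) / g x \<le> 2 powr \<delta> * (1 - t) powr (\<gamma> - \<delta>)"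
            using elim by (simp add: diff_divide_distrib pos_divide_le_eq)
          have "f (x * t) \<le> 2 powr \<delta> * (x * t / x) powr (\<phi> - \<delta>) * f x"
            using True A t elim by (intro A2) auto
          hence 2: "f (x * t) / f x \<le> 2 powr \<delta> * t powr (\<phi> - \<delta>)"
            using elim by (simp add: pos_divide_le_eq)
          have nn: "g (x - x * t) / g x \<ge> 0" "f (x * t) / f x \<ge> 0"
            using elim tame_nonneg[OF shift_stable_tame] g(1) f(1) by auto
          have "norm (I x t) = (g (x - x * t) / g x) * (f (x * t) / f x)"
            unfolding I_def using True nn by (simp only: indicator_simps real_norm_def abs_mult abs_of_nonneg abs_one mult_1)
          also have "\<dots> \<le> (2 powr \<delta> * (1 - t) powr (\<gamma> - \<delta>)) * (2 powr \<delta> * t powr (\<phi> - \<delta>))"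
            using nn by (intro mult_mono 1 2) auto
          also have "\<dots> = w t" using t by (simp add: w_def)
          finally show ?thesis .
        next
          case False
          thus ?thesis by (simp add: I_def w_def)
        qed
      qed
    qed
  qed
  also have "(LINT t|lborel. J t) = Beta (\<gamma> + 1) (\<phi> + 1)"
  proof -
    have "(LINT t|lborel. J t) = (LINT t:{0..1}|lborel. t powr ((\<phi> + 1) - 1) * (1 - t) powr ((\<gamma> + 1) - 1))"
      unfolding set_lebesgue_integral_def J_def
      using AE_lborel_singleton[of 0] AE_lborel_singleton[of 1]
      by (intro integral_cong_AE) (auto simp: indicator_def)
    also have "\<dots> = Beta (\<phi> + 1) (\<gamma> + 1)" using g f by (intro Beta_set_integral) auto
    finally show ?thesis by (simp add: Beta_commute)
  qed
  finally have lim: "((\<lambda>x. LINT t|lborel. I x t) \<longlongrightarrow> Beta (\<gamma> + 1) (\<phi> + 1)) at_top" .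
  have B: "Beta (\<gamma> + 1) (\<phi> + 1) \<noteq> 0" using g f by (auto simp: Beta_def Gamma_eq_zero_iff elim!: nonpos_Ints_cases)
  have "conv g f \<sim>[at_top] (\<lambda>x. conv_on {A..x-A} g f x)"
    by (rule asymp_equiv_symI[OF conv_middle_asymp]) (use g f A in auto)
  also have "(\<lambda>x. conv_on {A..x-A} g f x) \<sim>[at_top] (\<lambda>x. x * g x * f x * (LINT t|lborel. I x t))"
  proof (rule asymp_equiv_refl_ev)
    show "\<forall>\<^sub>F x in at_top. conv_on {A..x-A} g f x = x * g x * f x * (LINT t|lborel. I x t)"
      using shift_stable_pos[OF g(1)] shift_stable_pos[OF f(1)] eventually_gt_at_top[of 0]
    proof eventually_elim
      case (elim x)
      have "conv_on {A..x-A} g f x = x * (LINT t|lborel. indicator {A..x-A} (x * t) *\<^sub>R (g (x - x * t) * f (x * t)))"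
        unfolding set_lebesgue_integral_def using elim
        by (subst lborel_integral_real_affine[where c = x and t = 0]) auto
      also have "(LINT t|lborel. indicator {A..x-A} (x * t) *\<^sub>R (g (x - x * t) * f (x * t))) =
        (LINT t|lborel. (g x * f x) * I x t)"
        by (intro Bochner_Integration.integral_cong) (use elim in \<open>auto simp: I_def\<close>)
      also have "\<dots> = (g x * f x) * (LINT t|lborel. I x t)" by simp
      finally show ?case by (simp add: mult_ac)
    qed
  qed
  also have "\<dots> \<sim>[at_top] (\<lambda>x. x * g x * f x * Beta (\<gamma> + 1) (\<phi> + 1))"
    by (intro asymp_equiv_mult asymp_equiv_refl tendsto_imp_asymp_equiv_const[OF lim B])
  finally show ?thesis .
qed

lemma shift_stable_unit_step: "shift_stable unit_step"
proof -
  have ev: "\<forall>\<^sub>F s in at_top. unit_step (s + h) = 1" for h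
    using eventually_ge_at_top[of "-h"] by eventually_elim (simp add: unit_step_def)
  have "(\<lambda>s. unit_step (s + h)) \<sim>[at_top] unit_step" for h
  proof (rule asymp_equiv_refl_ev)
    show "\<forall>\<^sub>F s in at_top. unit_step (s + h) = unit_step s"
      using ev[of h] ev[of 0] by eventually_elim simp
  qed
  moreover have "\<forall>\<^sub>F s in at_top. unit_step s > 0" using ev[of 0] by eventually_elim simp
  moreover have "filterlim (integ unit_step) at_top at_top"
  proof (rule filterlim_at_top_mono[OF filterlim_ident])
    show "\<forall>\<^sub>F s in at_top. s \<le> integ unit_step s" using eventually_ge_at_top[of 0]
    proof eventually_elim
      case (elim s)
      have "integ unit_step s = (LINT z:{0..s}|lborel. 1)"
        unfolding integ_def by (rule set_lebesgue_integral_cong) (auto simp: unit_step_def)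
      thus ?case using const_set_integral[of 0 s 1] elim by simp
    qed
  qed
  ultimately show ?thesis unfolding shift_stable_def using tame_unit_step by blast
qed

lemma shift_stable_integ: "shift_stable g \<Longrightarrow> shift_stable (integ g)"
  using shift_stable_conv[OF shift_stable_unit_step, of g] by (simp add: conv_unit_step)

lemma scales_unit_step: "scales 0 unit_step"
  unfolding scales_def
proof (intro allI impI)
  fix t :: real assume t: "t > 0"
  show "(\<lambda>x. unit_step (x * t)) \<sim>[at_top] (\<lambda>x. t powr 0 * unit_step x)"
  proof (rule asymp_equiv_refl_ev)
    show "\<forall>\<^sub>F x in at_top. unit_step (x * t) = t powr 0 * unit_step x"
      using eventually_ge_at_top[of 0] by eventually_elim (use t in \<open>simp add: unit_step_def\<close>)
  qed
qed

text \<open>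
  The antiderivative is a convolution with a function of index \<open>0\<close>, so \<open>conv_asymp_Beta\<close> covers it.
\<close>

lemma integ_bigo:
  assumes "shift_stable v" "scales \<gamma> v" "\<gamma> > -1"
  shows "integ v \<in> O(\<lambda>x. x * v x)"
proof -
  have "integ v \<sim>[at_top] (\<lambda>x. x * unit_step x * v x * Beta (0 + 1) (\<gamma> + 1))"
    using conv_asymp_Beta[OF shift_stable_unit_step scales_unit_step _ assms] by (simp add: conv_unit_step)
  also have "(\<lambda>x. x * unit_step x * v x * Beta (0 + 1) (\<gamma> + 1)) \<sim>[at_top] (\<lambda>x. x * v x * Beta (0 + 1) (\<gamma> + 1))"
  proof (rule asymp_equiv_refl_ev)
    show "\<forall>\<^sub>F x in at_top. x * unit_step x * v x * Beta (0 + 1) (\<gamma> + 1) = x * v x * Beta (0 + 1) (\<gamma> + 1)"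
      using eventually_ge_at_top[of 0] by eventually_elim (simp add: unit_step_def)
  qed
  finally have "integ v \<in> O(\<lambda>x. x * v x * Beta (0 + 1) (\<gamma> + 1))" by (rule asymp_equiv_imp_bigo)
  also have "(\<lambda>x. x * v x * Beta (0 + 1) (\<gamma> + 1)) \<in> O(\<lambda>x. x * v x)" by simp
  finally show ?thesis .
qed

lemma uniform_scaling_down:
  assumes "shift_stable u" "scales \<gamma> u" "K > 1" "0 < \<epsilon>" "\<epsilon> \<le> 1"
  shows "\<forall>\<^sub>F x in at_top. \<forall>y\<in>{\<epsilon>*x..x}. u y \<le> K * ((y / x) powr \<gamma> * u x) \<and> (y / x) powr \<gamma> * u x \<le> K * u y"
  using stable_uniform_scaling[OF assms(1,1,2,3), of "1/\<epsilon>"] assms(4,5) by (simp add: mult.commute)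

text \<open>
  On \<open>[x / T, x]\<close> the function is at least half of \<open>x * u x / y\<close>, whose integral is
  \<open>x * u x * ln T / 2\<close>, and \<open>T\<close> is arbitrary.
\<close>

lemma times_smallo_integ:
  assumes u: "shift_stable u" "scales (-1) u"
  shows "(\<lambda>x. x * u x) \<in> o(integ u)"
proof (rule smallo_leI)
  note t = shift_stable_tame[OF u(1)]
  show "\<forall>\<^sub>F x in at_top. x * u x \<ge> 0"
    using eventually_ge_at_top[of 0] by eventually_elim (simp add: tame_nonneg[OF t])
  fix c :: real assume c: "c > 0"
  \<comment> \<open>The integral of \<open>1 / y\<close> over \<open>[x / T, x]\<close> is \<open>ln T = 2 / c\<close>, and one factor \<open>2\<close> is lost to uniformity.\<close>
  define T where "T = exp (2 / c)"
  have T: "T > 1" "ln T = 2 / c" using c by (auto simp: T_def)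
  have sc: "\<forall>\<^sub>F x in at_top. \<forall>y\<in>{x/T..x}. u y \<le> 2 * ((y / x) powr (-1) * u x) \<and> (y / x) powr (-1) * u x \<le> 2 * u y"
    by (rule stable_uniform_scaling[OF u(1,1,2)]) (use T in auto)
  show "\<forall>\<^sub>F x in at_top. x * u x \<le> c * integ u x"
    using sc eventually_gt_at_top[of 0]
  proof eventually_elim
    case (elim x)
    have xT: "0 < x / T" "x / T \<le> x" using elim T by (auto simp: field_simps)
    have "(LINT y:{x/T..x}|lborel. 1 / y) = ln x - ln (x / T)"
      unfolding set_lebesgue_integral_def
      using xT by (intro integral_FTC_atLeastAtMost)
        (auto intro!: derivative_eq_intros continuous_intros simp flip: has_real_derivative_iff_has_vector_derivative)
    also have "\<dots> = 2 / c" using T elim by (simp add: ln_div)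
    finally have ln: "(LINT y:{x/T..x}|lborel. 1 / y) = 2 / c" .
    have "(x * u x) * (2 / c) = (LINT y:{x/T..x}|lborel. (x * u x) * (1 / y))"
      unfolding ln[symmetric] by (rule set_integral_mult_right[symmetric])
    also have "\<dots> \<le> (LINT y:{x/T..x}|lborel. 2 * u y)"
    proof (rule set_integral_mono)
      show "set_integrable lborel {x/T..x} (\<lambda>y. (x * u x) * (1 / y))"
        using xT by (intro borel_integrable_atLeastAtMost') (auto intro!: continuous_intros)
      show "set_integrable lborel {x/T..x} (\<lambda>y. 2 * u y)"
        by (intro set_integrable_mult_right tame_set_integrable t)
      fix y assume y: "y \<in> {x/T..x}"
      hence "(y / x) powr (-1) * u x \<le> 2 * u y" using elim by auto
      moreover have "(y / x) powr (-1) = x / y" using y xT elim by (simp add: powr_minus_divide)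
      ultimately have "x / y * u x \<le> 2 * u y" by (simp only:)
      thus "(x * u x) * (1 / y) \<le> 2 * u y" by simp
    qed
    also have "\<dots> \<le> 2 * integ u x"
      unfolding integ_def set_integral_mult_right
      using xT by (intro mult_left_mono set_integral_nonneg_mono tame_set_integrable t) (auto simp: tame_nonneg t)
    finally show ?case using c by (simp add: field_simps)
  qed
qed

text \<open>
  Between \<open>x * t\<close> and \<open>x\<close> the antiderivative grows by \<open>O(x * u x)\<close>, which is negligible.
\<close>

lemma integ_scales:
  assumes u: "shift_stable u" "scales (-1) u"
  shows "scales 0 (integ u)"
proof -
  note t = shift_stable_tame[OF u(1)]
  have two: "(2::real) > 1" by simp
  have le1: "(\<lambda>x. integ u (x * t)) \<sim>[at_top] integ u" if r: "0 < t" "t \<le> 1" for t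
  proof -
    have "(\<lambda>x. integ u x - integ u (x * t)) \<in> O(\<lambda>x. x * u x)"
    proof (rule bigoI)
      show "\<forall>\<^sub>F x in at_top. norm (integ u x - integ u (x * t)) \<le> (2 / t) * norm (x * u x)"
        using uniform_scaling_down[OF u two r] eventually_gt_at_top[of 0]
      proof eventually_elim
        case (elim x)
        have xt: "0 < x * t" "x * t \<le> x" using elim r by (auto simp: mult_le_cancel_left1)
        have "integ u x - integ u (x * t) = (LINT z:{x*t..x}|lborel. u z)"
          unfolding integ_def using xt by (subst set_integral_split[of 0 x _ "x * t"]) (auto intro!: tame_set_integrable t)
        also have "\<dots> \<le> (LINT z:{0..x}|lborel. (2 / t) * u x)"
        proof (rule set_integral_nonneg_mono)
          fix z assume z: "z \<in> {x*t..x}"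
          hence "u z \<le> 2 * ((z / x) powr (-1) * u x)" using elim by (auto simp: mult.commute)
          also have "(z / x) powr (-1) = x / z" using z xt elim by (simp add: powr_minus_divide)
          also have "x / z \<le> 1 / t" using z xt r by (simp add: field_simps)
          finally show "u z \<le> (2 / t) * u x" by (simp add: mult_right_mono tame_nonneg[OF t])
        qed (use xt r in \<open>auto simp: tame_nonneg t const_set_integrable\<close>)
        also have "\<dots> = (2 / t) * (x * u x)" using elim by (subst const_set_integral) auto
        finally have "integ u x - integ u (x * t) \<le> (2 / t) * (x * u x)" .
        moreover have "integ u (x * t) \<le> integ u x" by (rule integ_mono[OF t xt(2)])
        ultimately show ?case using elim tame_nonneg[OF t, of x] by simp
      qed
    qed
    also note times_smallo_integ[OF u]
    finally have "(\<lambda>x. integ u x - integ u (x * t)) \<in> o(integ u)" .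
    hence "(\<lambda>x. - (integ u x - integ u (x * t))) \<in> o(integ u)" by (simp only: landau_o.small.uminus_in_iff)
    thus ?thesis by (intro smallo_imp_asymp_equiv) (simp only: minus_diff_eq)
  qed
  show ?thesis unfolding scales_def
  proof (intro allI impI)
    fix t :: real assume t0: "t > 0"
    have "(\<lambda>x. integ u (x * t)) \<sim>[at_top] integ u"
    proof (cases "t \<le> 1")
      case True thus ?thesis using le1 t0 by simp
    next
      case False
      have "(\<lambda>x. integ u ((x * t) * (1 / t))) \<sim>[at_top] (\<lambda>x. integ u (x * t))"
        by (rule asymp_equiv_compose'[OF le1 filterlim_times_at_top[OF t0]]) (use False in auto)
      thus ?thesis using t0 by (simp add: asymp_equiv_sym)
    qed
    thus "(\<lambda>x. integ u (x * t)) \<sim>[at_top] (\<lambda>x. t powr 0 * integ u x)" using t0 by simp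
  qed
qed

text \<open>
  For \<open>z \<le> \<epsilon> * x\<close> the factor \<open>v (x - z)\<close> is \<open>v x\<close> up to a factor near \<open>1\<close>, and the integral of \<open>u\<close> over
  \<open>[0, \<epsilon> * x]\<close> is asymptotically its integral over \<open>[0, x]\<close>. The bound holds for all small \<open>\<epsilon>\<close>, so that
  the two ends of a convolution can be treated with the same \<open>\<epsilon>\<close>.
\<close>

lemma conv_corner:
  assumes u: "shift_stable u" "scales (-1) u" and v: "shift_stable v" "scales \<gamma> v" and K: "K > 1"
  obtains \<epsilon>0 where "\<epsilon>0 > 0" "\<And>\<epsilon>. 0 < \<epsilon> \<Longrightarrow> \<epsilon> < \<epsilon>0 \<Longrightarrow>
    \<forall>\<^sub>F x in at_top. conv_on {0..\<epsilon>*x} v u x \<le> K * (v x * integ u x) \<and>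
       v x * integ u x \<le> K * conv_on {0..\<epsilon>*x} v u x"
proof -
  note t = shift_stable_tame[OF v(1)] shift_stable_tame[OF u(1)]
  obtain L where L: "L > 1" "L ^ 3 = K" using factor_root[OF K, of 3] by auto
  have "((\<lambda>r. (1 - r) powr \<gamma>) \<longlongrightarrow> (1 - 0) powr \<gamma>) (at_right (0::real))" by (intro tendsto_intros) auto
  hence "((\<lambda>r. (1 - r) powr \<gamma>) \<longlongrightarrow> 1) (at_right (0::real))" by simp
  hence "\<forall>\<^sub>F r in at_right 0. (1 - r) powr \<gamma> < L" "\<forall>\<^sub>F r in at_right 0. (1 - r) powr \<gamma> > 1 / L"
    using L by (auto intro: order_tendstoD)
  hence "\<forall>\<^sub>F r in at_right 0. (1 - r) powr \<gamma> < L \<and> 1 / L < (1 - r) powr \<gamma>" by (rule eventually_conj)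
  then obtain b where b: "b > 0" "\<And>r. 0 < r \<Longrightarrow> r < b \<Longrightarrow> (1 - r) powr \<gamma> < L \<and> 1 / L < (1 - r) powr \<gamma>"
    unfolding eventually_at_right_field by auto
  have b': "(1 - r) powr \<gamma> \<le> L \<and> 1 \<le> L * (1 - r) powr \<gamma>" if "0 \<le> r" "r < b" for r
  proof (cases "r = 0")
    case False
    hence "(1 - r) powr \<gamma> < L \<and> 1 / L < (1 - r) powr \<gamma>" using b that by simp
    thus ?thesis using L by (simp add: field_simps)
  qed (use L in simp)
  show ?thesis
  proof (rule that[of "min b (1/2)"])
    show "min b (1/2) > 0" using b by simp
    fix \<epsilon> :: real assume \<epsilon>: "0 < \<epsilon>" "\<epsilon> < min b (1/2)"
    have "(\<lambda>x. integ u (x * \<epsilon>)) \<sim>[at_top] (\<lambda>x. \<epsilon> powr 0 * integ u x)"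
      by (rule scalesD[OF integ_scales[OF u] \<epsilon>(1)])
    hence "(\<lambda>x. integ u (x * \<epsilon>)) \<sim>[at_top] integ u" using \<epsilon> by simp
    from asymp_equiv_factorD(2)[OF this integ_pos[OF u(1)] L(1)]
    have ev: "\<forall>\<^sub>F x in at_top. integ u x \<le> L * integ u (x * \<epsilon>)" .
    show "\<forall>\<^sub>F x in at_top. conv_on {0..\<epsilon>*x} v u x \<le> K * (v x * integ u x) \<and>
       v x * integ u x \<le> K * conv_on {0..\<epsilon>*x} v u x"
      using ev uniform_scaling_down[OF v L(1), of "1/2", simplified] eventually_gt_at_top[of 0]
    proof eventually_elim
      case (elim x)
      have vz: "v (x - z) \<le> L^2 * v x \<and> v x \<le> L^2 * v (x - z)" if z: "0 \<le> z" "z \<le> \<epsilon> * x" for z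
      proof -
        have "\<epsilon> * x \<le> (1/2) * x" using elim \<epsilon> by (intro mult_right_mono) auto
        hence "x - z \<in> {x/2..x}" using z by auto
        hence 1: "v (x - z) \<le> L * (((x - z) / x) powr \<gamma> * v x)" "((x - z) / x) powr \<gamma> * v x \<le> L * v (x - z)"
          using elim by auto
        have q: "(x - z) / x = 1 - z / x" using elim by (simp add: diff_divide_distrib)
        have "z / x \<le> \<epsilon>" using z elim by (simp add: pos_divide_le_eq)
        hence 2: "((x - z) / x) powr \<gamma> \<le> L" "1 \<le> L * ((x - z) / x) powr \<gamma>"
          unfolding q using b'[of "z / x"] z elim \<epsilon> by auto
        have "((x - z) / x) powr \<gamma> * v x \<le> L * v x" by (rule mult_right_mono[OF 2(1) tame_nonneg[OF t(1)]])
        hence "v (x - z) \<le> L * (L * v x)" using 1(1) L by (meson order_trans mult_left_mono less_imp_le zero_less_one)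
        moreover have "1 * v x \<le> (L * ((x - z) / x) powr \<gamma>) * v x" by (rule mult_right_mono[OF 2(2) tame_nonneg[OF t(1)]])
        hence "v x \<le> L * (((x - z) / x) powr \<gamma> * v x)" by (simp only: mult.assoc mult_1)
        hence "v x \<le> L * (L * v (x - z))" using 1(2) L by (meson order_trans mult_left_mono less_imp_le zero_less_one)
        ultimately show ?thesis by (simp add: power2_eq_square mult.assoc)
      qed
      let ?C = "conv_on {0..\<epsilon>*x} v u x"
      have ex: "\<epsilon> * x \<le> x" using \<epsilon> elim by (simp add: mult_le_cancel_right1)
      have "?C \<le> (LINT z:{0..\<epsilon>*x}|lborel. (L^2 * v x) * u z)"
        by (intro set_integral_mono set_integrable_mult_right tame_conv_set_integrable tame_set_integrable t
            mult_right_mono tame_nonneg) (use vz in auto)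
      also have "\<dots> = (L^2 * v x) * integ u (\<epsilon> * x)" by (simp add: integ_def)
      also have "\<dots> \<le> (L^3 * v x) * integ u x"
        using L ex by (intro mult_mono mult_right_mono power_increasing integ_mono integ_nonneg t)
          (auto simp: tame_nonneg t)
      finally have A: "?C \<le> K * (v x * integ u x)" using L by (simp add: mult_ac)
      have "v x * integ u (\<epsilon> * x) = (LINT z:{0..\<epsilon>*x}|lborel. v x * u z)" by (simp add: integ_def)
      also have "\<dots> \<le> (LINT z:{0..\<epsilon>*x}|lborel. L^2 * (v (x - z) * u z))"
      proof (rule set_integral_mono)
        show "v x * u z \<le> L^2 * (v (x - z) * u z)" if "z \<in> {0..\<epsilon>*x}" for z
        proof -
          have "v x \<le> L^2 * v (x - z)" using vz that by simp
          from mult_right_mono[OF this tame_nonneg[OF t(2)]] show ?thesis by (simp only: mult.assoc)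
        qed
      qed (intro set_integrable_mult_right tame_conv_set_integrable tame_set_integrable t)+
      also have "\<dots> = L^2 * ?C" by simp
      finally have "L * (v x * integ u (\<epsilon> * x)) \<le> L * (L^2 * ?C)" using L by (intro mult_left_mono) auto
      moreover have "v x * integ u x \<le> v x * (L * integ u (x * \<epsilon>))"
        using elim by (intro mult_left_mono tame_nonneg t) auto
      ultimately have "v x * integ u x \<le> L * (L^2 * ?C)" by (simp add: mult_ac)
      also have "\<dots> = K * ?C" unfolding L(2)[symmetric] by (simp add: eval_nat_numeral)
      finally show ?case using A by blast
    qed
  qed
qed

text \<open>
  Both arguments are of order \<open>x\<close>, so the integrand is \<open>O(v x * u x)\<close> and the integral is
  \<open>O(v x * (x * u x))\<close>.
\<close>

lemma conv_middle_smallo: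
  assumes u: "shift_stable u" "scales (-1) u" and v: "shift_stable v" "scales \<gamma> v"
    and \<epsilon>: "0 < \<epsilon>" "\<epsilon> < 1/2"
  shows "(\<lambda>x. conv_on {\<epsilon>*x..(1-\<epsilon>)*x} v u x) \<in> o(\<lambda>x. v x * integ u x)"
proof -
  note t = shift_stable_tame[OF v(1)] shift_stable_tame[OF u(1)]
  define M where "M = max 1 (\<epsilon> powr \<gamma>)"
  have M: "w powr \<gamma> \<le> M" if "\<epsilon> \<le> w" "w \<le> 1" for w
  proof (cases "\<gamma> \<ge> 0")
    case True
    thus ?thesis using that \<epsilon> powr_le_one_le[of w] powr_mono2[of \<gamma> w 1] by (simp add: M_def)
  next
    case False
    thus ?thesis using that \<epsilon> powr_mono2'[of \<gamma> \<epsilon> w] by (simp add: M_def)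
  qed
  have M0: "M > 0" by (simp add: M_def)
  have e1: "\<epsilon> \<le> 1" using \<epsilon> by simp
  have two: "(2::real) > 1" by simp
  have "(\<lambda>x. conv_on {\<epsilon>*x..(1-\<epsilon>)*x} v u x) \<in> O(\<lambda>x. v x * (x * u x))"
  proof (rule bigoI)
    show "\<forall>\<^sub>F x in at_top. norm (conv_on {\<epsilon>*x..(1-\<epsilon>)*x} v u x) \<le> (2 * M * (2 / \<epsilon>)) * norm (v x * (x * u x))"
      using uniform_scaling_down[OF v two \<epsilon>(1) e1] uniform_scaling_down[OF u two \<epsilon>(1) e1]
        eventually_gt_at_top[of 0]
    proof eventually_elim
      case (elim x)
      have ex: "0 < \<epsilon> * x" "(1 - \<epsilon>) * x \<le> x" using \<epsilon> elim by (auto simp: mult_le_cancel_right1)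
      have bound: "v (x - z) * u z \<le> (2 * M * v x) * ((2 / \<epsilon>) * u x)" if z: "z \<in> {\<epsilon>*x..(1-\<epsilon>)*x}" for z
      proof -
        have xz: "x - z \<in> {\<epsilon>*x..x}" "z \<in> {\<epsilon>*x..x}" using z ex by (auto simp: algebra_simps)
        have "v (x - z) \<le> 2 * (((x - z) / x) powr \<gamma> * v x)" using bspec[OF elim(1) xz(1)] by blast
        also have "((x - z) / x) powr \<gamma> \<le> M"
          using xz elim by (intro M) (auto simp: field_simps)
        finally have 1: "v (x - z) \<le> 2 * M * v x" by (simp add: mult.assoc mult_right_mono tame_nonneg[OF t(1)])
        have "u z \<le> 2 * ((z / x) powr (-1) * u x)" using bspec[OF elim(2) xz(2)] by blast
        also have "(z / x) powr (-1) = x / z" using z ex elim by (simp add: powr_minus_divide)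
        also have "x / z \<le> x / (\<epsilon> * x)"
        proof (intro divide_left_mono mult_pos_pos)
          show "\<epsilon> * x \<le> z" using xz(2) by simp
          thus "0 < z" using ex(1) by linarith
        qed (use elim(3) \<epsilon>(1) in auto)
        also have "x / (\<epsilon> * x) = 1 / \<epsilon>" using elim by simp
        finally have 2: "u z \<le> (2 / \<epsilon>) * u x" by (simp add: mult_right_mono tame_nonneg[OF t(2)])
        show ?thesis using M0 by (intro mult_mono 1 2) (auto simp: tame_nonneg t)
      qed
      have "conv_on {\<epsilon>*x..(1-\<epsilon>)*x} v u x \<le> (LINT z:{0..x}|lborel. (2 * M * v x) * ((2 / \<epsilon>) * u x))"
      proof (rule set_integral_nonneg_mono)
        show "{\<epsilon>*x..(1-\<epsilon>)*x} \<subseteq> {0..x}" using ex by auto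
        show "v (x - z) * u z \<le> (2 * M * v x) * ((2 / \<epsilon>) * u x)" if "z \<in> {\<epsilon>*x..(1-\<epsilon>)*x}" for z
          using bound that .
      qed (use M0 \<epsilon> in \<open>auto simp: tame_nonneg t const_set_integrable\<close>)
      also have "\<dots> = (2 * M * (2 / \<epsilon>)) * (v x * (x * u x))"
        using elim by (subst const_set_integral) auto
      finally show ?case using conv_part_nonneg[OF t, of "{\<epsilon>*x..(1-\<epsilon>)*x}" x] elim tame_nonneg[OF t(1), of x]
          tame_nonneg[OF t(2), of x] by simp
    qed
  qed
  also have "(\<lambda>x. v x * (x * u x)) \<in> o(\<lambda>x. v x * integ u x)"
    by (intro landau_o.big_small_mult landau_o.big_refl times_smallo_integ u)
  finally show ?thesis .
qed

text \<open>
  The third part is written with the factors exchanged, so that \<open>conv_corner\<close> applies to either end.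
\<close>

lemma conv_three_parts:
  assumes "tame v" "tame u" "0 < \<epsilon>" "\<epsilon> < 1/2" "x > 0"
  shows "conv v u x = conv_on {0..\<epsilon>*x} v u x + conv_on {\<epsilon>*x..(1-\<epsilon>)*x} v u x
    + conv_on {0..\<epsilon>*x} u v x"
proof -
  have e: "0 \<le> \<epsilon> * x" "\<epsilon> * x \<le> (1 - \<epsilon>) * x" "(1 - \<epsilon>) * x \<le> x" "\<epsilon> * x \<le> x"
    using assms by (auto simp: mult_le_cancel_right1 mult_le_cancel_right)
  have i: "set_integrable lborel {a..b} (\<lambda>z. v (x - z) * u z)" for a b
    by (rule tame_conv_set_integrable[OF assms(1,2)])
  have "conv_on {0..\<epsilon>*x} u v x = conv_on {(1-\<epsilon>)*x..x} v u x"
    by (subst conv_part_reflect) (simp add: algebra_simps)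
  thus ?thesis unfolding conv_def
    using set_integral_split[OF i e(1,4)] set_integral_split[OF i e(2,3)] by simp
qed

text \<open>
  Each end contributes one term, as in the derivative of the product of the two antiderivatives.
\<close>

theorem conv_asymp_product_rule:
  assumes u: "shift_stable u" "scales (-1) u" and v: "shift_stable v" "scales (-1) v"
  shows "conv v u \<sim>[at_top] (\<lambda>x. v x * integ u x + u x * integ v x)"
proof (rule asymp_equiv_factorI)
  note t = shift_stable_tame[OF v(1)] shift_stable_tame[OF u(1)]
  show "\<forall>\<^sub>F x in at_top. v x * integ u x + u x * integ v x > 0"
    using shift_stable_pos[OF u(1)] shift_stable_pos[OF v(1)] integ_pos[OF u(1)] integ_pos[OF v(1)]
    by eventually_elim (simp add: add_pos_pos)
  fix K :: real assume K: "K > 1"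
  then obtain L where L: "L > 1" "L ^ 2 = K" using factor_root[of K 2] by auto
  obtain \<epsilon>1 where e1: "\<epsilon>1 > 0" "\<And>\<epsilon>. 0 < \<epsilon> \<Longrightarrow> \<epsilon> < \<epsilon>1 \<Longrightarrow>
    \<forall>\<^sub>F x in at_top. conv_on {0..\<epsilon>*x} v u x \<le> L * (v x * integ u x) \<and>
       v x * integ u x \<le> L * conv_on {0..\<epsilon>*x} v u x"
    using conv_corner[OF u v L(1)] by blast
  obtain \<epsilon>2 where e2: "\<epsilon>2 > 0" "\<And>\<epsilon>. 0 < \<epsilon> \<Longrightarrow> \<epsilon> < \<epsilon>2 \<Longrightarrow>
    \<forall>\<^sub>F x in at_top. conv_on {0..\<epsilon>*x} u v x \<le> L * (u x * integ v x) \<and>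
       u x * integ v x \<le> L * conv_on {0..\<epsilon>*x} u v x"
    using conv_corner[OF v u L(1)] by blast
  define \<epsilon> where "\<epsilon> = min (min \<epsilon>1 \<epsilon>2) (1/2) / 2"
  have \<epsilon>: "0 < \<epsilon>" "\<epsilon> < \<epsilon>1" "\<epsilon> < \<epsilon>2" "\<epsilon> < 1/2" using e1(1) e2(1) by (auto simp: \<epsilon>_def min_def)
  have KL: "K - L > 0" using L by (simp add: power2_eq_square flip: L(2))
  have mid: "\<forall>\<^sub>F x in at_top. conv_on {\<epsilon>*x..(1-\<epsilon>)*x} v u x \<le> (K - L) * (v x * integ u x)"
    by (rule smallo_leD[OF conv_middle_smallo[OF u v \<epsilon>(1,4)] KL])
      (intro always_eventually allI conv_part_nonneg t,
        intro always_eventually allI mult_nonneg_nonneg tame_nonneg integ_nonneg t)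
  show "\<forall>\<^sub>F x in at_top. conv v u x \<le> K * (v x * integ u x + u x * integ v x) \<and>
      v x * integ u x + u x * integ v x \<le> K * conv v u x"
    using e1(2)[OF \<epsilon>(1,2)] e2(2)[OF \<epsilon>(1,3)] mid eventually_gt_at_top[of 0]
  proof eventually_elim
    case (elim x)
    note d = conv_three_parts[OF t \<epsilon>(1,4) elim(4)]
    have uV: "u x * integ v x \<ge> 0" by (intro mult_nonneg_nonneg tame_nonneg integ_nonneg t)
    have p: "conv_on {\<epsilon>*x..(1-\<epsilon>)*x} v u x \<ge> 0" by (rule conv_part_nonneg[OF t])
    have c: "conv v u x \<ge> 0" by (rule conv_nonneg[OF t])
    have "conv v u x \<le> K * (v x * integ u x) + L * (u x * integ v x)"
      using d elim by (simp add: algebra_simps)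
    also have "L * (u x * integ v x) \<le> K * (u x * integ v x)" using KL uV by (intro mult_right_mono) auto
    finally have 1: "conv v u x \<le> K * (v x * integ u x + u x * integ v x)" by (simp add: algebra_simps)
    have "v x * integ u x + u x * integ v x \<le> L * (conv v u x - conv_on {\<epsilon>*x..(1-\<epsilon>)*x} v u x)"
      using d elim by (simp add: algebra_simps)
    also have "\<dots> \<le> L * conv v u x" using p L by (intro mult_left_mono) auto
    also have "\<dots> \<le> K * conv v u x" using KL c by (intro mult_right_mono) auto
    finally show ?case using 1 by blast
  qed
qed

text \<open>
  The end where the argument of \<open>v\<close> is small contributes at most a multiple of \<open>u x * integ v x\<close>, which is
  \<open>O(v x * (x * u x))\<close> for \<open>\<gamma> > -1\<close> and therefore negligible.
\<close>

theorem conv_asymp_integ: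
  assumes u: "shift_stable u" "scales (-1) u" and v: "shift_stable v" "scales \<gamma> v"
    and \<gamma>: "\<gamma> > -1"
  shows "conv v u \<sim>[at_top] (\<lambda>x. v x * integ u x)"
proof (rule asymp_equiv_factorI)
  note t = shift_stable_tame[OF v(1)] shift_stable_tame[OF u(1)]
  show "\<forall>\<^sub>F x in at_top. v x * integ u x > 0"
    using shift_stable_pos[OF v(1)] integ_pos[OF u(1)] by eventually_elim simp
  fix K :: real assume K: "K > 1"
  then obtain L where L: "L > 1" "L ^ 2 = K" using factor_root[of K 2] by auto
  obtain \<epsilon>1 where e1: "\<epsilon>1 > 0" "\<And>\<epsilon>. 0 < \<epsilon> \<Longrightarrow> \<epsilon> < \<epsilon>1 \<Longrightarrow>
    \<forall>\<^sub>F x in at_top. conv_on {0..\<epsilon>*x} v u x \<le> L * (v x * integ u x) \<and>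
       v x * integ u x \<le> L * conv_on {0..\<epsilon>*x} v u x"
    using conv_corner[OF u v L(1)] by blast
  define \<epsilon> where "\<epsilon> = min \<epsilon>1 (1/2) / 2"
  have \<epsilon>: "0 < \<epsilon>" "\<epsilon> < \<epsilon>1" "\<epsilon> < 1/2" using e1(1) by (auto simp: \<epsilon>_def min_def)
  have KL: "K - L > 0" using L by (simp add: power2_eq_square flip: L(2))
  have mid: "\<forall>\<^sub>F x in at_top. conv_on {\<epsilon>*x..(1-\<epsilon>)*x} v u x \<le> ((K - L)/2) * (v x * integ u x)"
    by (rule smallo_leD[OF conv_middle_smallo[OF u v \<epsilon>(1,3)]])
      (use KL in simp, intro always_eventually allI conv_part_nonneg t,
        intro always_eventually allI mult_nonneg_nonneg tame_nonneg integ_nonneg t)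
  have far0: "(\<lambda>x. conv_on {0..\<epsilon>*x} u v x) \<in> O(\<lambda>x. u x * integ v x)"
  proof (rule bigoI)
    show "\<forall>\<^sub>F x in at_top. norm (conv_on {0..\<epsilon>*x} u v x) \<le> 4 * norm (u x * integ v x)"
      using uniform_scaling_down[OF u, of 2 "1/2", simplified] eventually_gt_at_top[of 0]
    proof eventually_elim
      case (elim x)
      have ex: "\<epsilon> * x \<le> x" "\<epsilon> * x \<le> (1/2) * x" using elim \<epsilon> by (auto intro!: mult_right_mono simp: mult_le_cancel_right1)
      have uz: "u (x - z) \<le> 4 * u x" if z: "z \<in> {0..\<epsilon>*x}" for z
      proof -
        have xz: "x - z \<in> {x/2..x}" using z ex by auto
        hence "u (x - z) \<le> 2 * (((x - z) / x) powr (-1) * u x)" using elim by auto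
        also have "((x - z) / x) powr (-1) = x / (x - z)" using xz elim by (simp add: powr_minus_divide)
        also have "x / (x - z) \<le> 2" using xz elim by (simp add: field_simps)
        finally show ?thesis by (simp add: mult_right_mono tame_nonneg[OF t(2)])
      qed
      have "conv_on {0..\<epsilon>*x} u v x \<le> (LINT z:{0..x}|lborel. (4 * u x) * v z)"
      proof (rule set_integral_nonneg_mono)
        show "u (x - z) * v z \<le> (4 * u x) * v z" if "z \<in> {0..\<epsilon>*x}" for z
          using uz[OF that] by (intro mult_right_mono tame_nonneg t)
        show "set_integrable lborel {0..x} (\<lambda>z. (4 * u x) * v z)"
          by (intro set_integrable_mult_right tame_set_integrable t)
      qed (use ex in \<open>auto simp: tame_nonneg t\<close>)
      also have "\<dots> = 4 * (u x * integ v x)" by (simp add: integ_def)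
      finally show ?case using conv_part_nonneg[OF t(2,1), of "{0..\<epsilon>*x}" x] tame_nonneg[OF t(2), of x]
        integ_nonneg[OF t(1), of x] by simp
    qed
  qed
  also have "(\<lambda>x. u x * integ v x) \<in> O(\<lambda>x. u x * (x * v x))"
    by (intro landau_o.big.mult landau_o.big_refl integ_bigo[OF v \<gamma>])
  also have "(\<lambda>x. u x * (x * v x)) = (\<lambda>x. v x * (x * u x))" by (simp add: mult_ac)
  also have "(\<lambda>x. v x * (x * u x)) \<in> o(\<lambda>x. v x * integ u x)"
    by (intro landau_o.big_small_mult landau_o.big_refl times_smallo_integ u)
  finally have far1: "(\<lambda>x. conv_on {0..\<epsilon>*x} u v x) \<in> o(\<lambda>x. v x * integ u x)" .
  have far: "\<forall>\<^sub>F x in at_top. conv_on {0..\<epsilon>*x} u v x \<le> ((K - L)/2) * (v x * integ u x)"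
    by (rule smallo_leD[OF far1])
      (use KL in simp, intro always_eventually allI conv_part_nonneg t,
        intro always_eventually allI mult_nonneg_nonneg tame_nonneg integ_nonneg t)
  show "\<forall>\<^sub>F x in at_top. conv v u x \<le> K * (v x * integ u x) \<and> v x * integ u x \<le> K * conv v u x"
    using e1(2)[OF \<epsilon>(1,2)] far mid eventually_gt_at_top[of 0]
  proof eventually_elim
    case (elim x)
    note d = conv_three_parts[OF t \<epsilon>(1,3) elim(4)]
    have p: "conv_on {\<epsilon>*x..(1-\<epsilon>)*x} v u x \<ge> 0" "conv_on {0..\<epsilon>*x} u v x \<ge> 0"
      by (rule conv_part_nonneg[OF t]) (rule conv_part_nonneg[OF t(2,1)])
    have c: "conv v u x \<ge> 0" by (rule conv_nonneg[OF t])
    have "conv v u x \<le> L * (v x * integ u x) + ((K - L)/2) * (v x * integ u x) + ((K - L)/2) * (v x * integ u x)"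
      using d elim by linarith
    hence 1: "conv v u x \<le> K * (v x * integ u x)" by (simp add: field_simps)
    have "v x * integ u x \<le> L * conv_on {0..\<epsilon>*x} v u x" using elim by blast
    also have "\<dots> \<le> L * conv v u x" using d p L by (intro mult_left_mono) auto
    also have "\<dots> \<le> K * conv v u x" using KL c by (intro mult_right_mono) auto
    finally show ?case using 1 by blast
  qed
qed

text \<open>
  Associativity moves the integration onto one factor, which raises its index from \<open>-1\<close> to \<open>0\<close>.
\<close>

lemma integ_conv_asymp:
  assumes u: "shift_stable u" "scales (-1) u" and v: "shift_stable v" "scales (-1) v"
  shows "integ (conv u v) \<sim>[at_top] (\<lambda>x. integ u x * integ v x)"
proof -
  note t = shift_stable_tame[OF u(1)] shift_stable_tame[OF v(1)]
  have "integ (conv u v) = conv (integ u) v"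
    using conv_assoc[OF tame_unit_step t] by (simp add: conv_unit_step)
  thus ?thesis using conv_asymp_integ[OF v shift_stable_integ[OF u(1)] integ_scales[OF u]] by simp
qed

section \<open>Tails of products and sums of independent variables\<close>

lemma smallo_tilted_shift:
  assumes g: "shift_stable g" and b: "b \<in> o(\<lambda>s. exp (-\<alpha> * s) * g s)"
  shows "(\<lambda>s. b (s + h)) \<in> o(\<lambda>s. exp (-\<alpha> * s) * g s)"
proof -
  have fl: "filterlim (\<lambda>s::real. s + h) at_top at_top"
    using filterlim_tendsto_add_at_top[OF tendsto_const[of h] filterlim_ident] by (simp add: add.commute)
  have "(\<lambda>s. b (s + h)) \<in> o(\<lambda>s. exp (-\<alpha> * (s + h)) * g (s + h))"
    by (rule landau_o.small.compose[OF b fl])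
  also have "(\<lambda>s. exp (-\<alpha> * (s + h)) * g (s + h)) \<sim>[at_top] (\<lambda>s. exp (-\<alpha> * (s + h)) * g s)"
    by (intro asymp_equiv_mult asymp_equiv_refl shift_stable_shift g)
  hence "(\<lambda>s. exp (-\<alpha> * (s + h)) * g (s + h)) \<in> O(\<lambda>s. exp (-\<alpha> * (s + h)) * g s)"
    by (rule asymp_equiv_imp_bigo)
  also have "(\<lambda>s. exp (-\<alpha> * (s + h)) * g s) = (\<lambda>s. exp (-\<alpha> * h) * (exp (-\<alpha> * s) * g s))"
    by (rule ext) (simp add: algebra_simps flip: exp_add)
  also have "(\<lambda>s. exp (-\<alpha> * h) * (exp (-\<alpha> * s) * g s)) \<in> O(\<lambda>s. exp (-\<alpha> * s) * g s)" by simp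
  finally show ?thesis .
qed

context prob_space begin

text \<open>
  With \<open>a u\<close> the tail of \<open>V\<close> at \<open>exp u\<close>, conditioning on \<open>Y\<close> expresses the tail of the product as the
  integral of \<open>a (s - y)\<close> against the law of \<open>ln Y\<close>.
\<close>

lemma tail_product:
  fixes Y V :: "'a \<Rightarrow> real"
  assumes ind: "indep_var borel Y borel V" and Y0: "AE \<omega> in M. Y \<omega> > 0"
    and pos: "\<alpha> > 0" "c > 0" and g: "shift_stable g" and f: "shift_stable f"
    and V: "(\<lambda>s. \<P>(\<omega> in M. V \<omega> > exp s)) \<sim>[at_top] (\<lambda>s. c * exp (-\<alpha> * s) * g s)"
    and Y: "(\<lambda>s. \<P>(\<omega> in M. Y \<omega> > exp s)) \<sim>[at_top] (\<lambda>s. exp (-\<alpha> * s) * f s)"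
  shows "(\<lambda>s. \<P>(\<omega> in M. Y \<omega> * V \<omega> > exp s)) \<sim>[at_top] (\<lambda>s. \<alpha> * c * exp (-\<alpha> * s) * conv g f s)"
proof -
  have [measurable]: "Y \<in> borel_measurable M" "V \<in> borel_measurable M"
    using indep_var_rv1[OF ind] indep_var_rv2[OF ind] by auto
  define \<mu> where "\<mu> = distr M borel (\<lambda>\<omega>. ln (Y \<omega>))"
  interpret \<mu>: real_distribution \<mu> unfolding \<mu>_def by (rule real_distribution_distr) measurable
  interpret DV: prob_space "distr M borel V" by (rule prob_space_distr) measurable
  define a where "a u = \<P>(\<omega> in M. V \<omega> > exp u)" for u
  have a: "antimono a"
    unfolding a_def antimono_def by (auto intro!: finite_measure_mono intro: order.strict_trans1)
  have [measurable]: "a \<in> borel_measurable borel" by (rule borel_measurable_antimono[OF a])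
  have \<mu>_tail: "measure \<mu> {s<..} = \<P>(\<omega> in M. Y \<omega> > exp s)" for s
  proof -
    have "measure \<mu> {s<..} = \<P>(\<omega> in M. ln (Y \<omega>) > s)"
      unfolding \<mu>_def by (subst measure_distr) (auto intro!: arg_cong[where f = prob])
    also have "\<dots> = \<P>(\<omega> in M. Y \<omega> > exp s)"
    proof (rule finite_measure_eq_AE)
      show "AE \<omega> in M. (\<omega> \<in> {\<omega> \<in> space M. ln (Y \<omega>) > s}) = (\<omega> \<in> {\<omega> \<in> space M. Y \<omega> > exp s})"
        using Y0
      proof eventually_elim
        case (elim \<omega>)
        thus ?case using exp_less_cancel_iff[of s "ln (Y \<omega>)"] by simp
      qed
    qed measurable
    finally show ?thesis .
  qed
  have eq: "\<P>(\<omega> in M. Y \<omega> * V \<omega> > exp s) = (LINT y|\<mu>. a (s - y))" for s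
  proof -
    let ?A = "{p \<in> space (borel \<Otimes>\<^sub>M borel). fst p * snd p > exp s}"
    have A: "?A \<in> sets (borel \<Otimes>\<^sub>M borel)" by measurable
    hence "?A \<in> sets (borel \<Otimes>\<^sub>M distr M borel V)" by simp
    from DV.measurable_emeasure_Pair[OF this]
    have meas: "(\<lambda>y. emeasure (distr M borel V) (Pair y -` ?A)) \<in> borel_measurable (distr M borel Y)" by simp
    have "emeasure M {\<omega> \<in> space M. Y \<omega> * V \<omega> > exp s}
      = emeasure (distr M (borel \<Otimes>\<^sub>M borel) (\<lambda>\<omega>. (Y \<omega>, V \<omega>))) ?A"
      by (subst emeasure_distr[OF _ A]) (auto intro!: arg_cong[where f = "emeasure M"] simp: space_pair_measure)
    also have "distr M (borel \<Otimes>\<^sub>M borel) (\<lambda>\<omega>. (Y \<omega>, V \<omega>)) = distr M borel Y \<Otimes>\<^sub>M distr M borel V"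
      using ind by (simp add: indep_var_distribution_eq)
    also have "emeasure (distr M borel Y \<Otimes>\<^sub>M distr M borel V) ?A
       = (\<integral>\<^sup>+y. emeasure (distr M borel V) (Pair y -` ?A) \<partial>distr M borel Y)"
      by (rule DV.emeasure_pair_measure_alt) (use A in simp)
    also have "\<dots> = (\<integral>\<^sup>+\<omega>. emeasure (distr M borel V) (Pair (Y \<omega>) -` ?A) \<partial>M)"
      by (rule nn_integral_distr[OF _ meas]) simp
    also have "\<dots> = (\<integral>\<^sup>+\<omega>. ennreal (a (s - ln (Y \<omega>))) \<partial>M)"
    proof (rule nn_integral_cong_AE)
      show "AE \<omega> in M. emeasure (distr M borel V) (Pair (Y \<omega>) -` ?A) = ennreal (a (s - ln (Y \<omega>)))"
        using Y0
      proof eventually_elim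
        case (elim \<omega>)
        have "Pair (Y \<omega>) -` ?A = {exp (s - ln (Y \<omega>))<..}"
          using elim by (auto simp: space_pair_measure exp_diff field_simps)
        thus ?case unfolding a_def
          by (simp add: emeasure_distr emeasure_eq_measure vimage_def Int_def conj_commute)
      qed
    qed
    also have "\<dots> = (\<integral>\<^sup>+y. ennreal (a (s - y)) \<partial>\<mu>)"
      unfolding \<mu>_def by (subst nn_integral_distr) auto
    also have "\<dots> = ennreal (LINT y|\<mu>. a (s - y))"
      by (intro nn_integral_eq_integral \<mu>.integrable_const_bound[where B = 1]) (auto simp: a_def)
    finally show ?thesis
      by (simp add: emeasure_eq_measure Bochner_Integration.integral_nonneg a_def)
  qed
  have "(\<lambda>s. LINT y|\<mu>. a (s - y)) \<sim>[at_top] (\<lambda>s. \<alpha> * c * exp (-\<alpha> * s) * conv g f s)"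
  proof (rule \<mu>.tilted_convolution[OF a _ _ pos g f])
    show "a \<sim>[at_top] (\<lambda>s. c * exp (-\<alpha> * s) * g s)" using V by (simp only: a_def[abs_def])
    show "(\<lambda>s. measure \<mu> {s<..}) \<sim>[at_top] (\<lambda>s. exp (-\<alpha> * s) * f s)" using Y by (simp add: \<mu>_tail)
  qed (auto simp: a_def)
  thus ?thesis by (simp add: eq)
qed

text \<open>
  A summand with a negligible right tail does not affect the right tail, whatever its left tail.
  From above, the sum exceeds \<open>exp s\<close> only if \<open>T\<close> exceeds \<open>exp (s - h)\<close> or \<open>X\<close> exceeds the remainder
  \<open>exp (s + d)\<close>. From below, it does so if \<open>T\<close> exceeds \<open>exp (s + h)\<close> and \<open>X\<close> is not too negative, which has
  probability close to \<open>1\<close>. The parameter \<open>h\<close> costs the factor \<open>exp (\<alpha> * h)\<close>.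
\<close>

lemma tail_sum:
  fixes X T :: "'a \<Rightarrow> real"
  assumes ind: "indep_var borel X borel T" and pos: "\<alpha> > 0" "c > 0" and g: "shift_stable g"
    and T: "(\<lambda>s. \<P>(\<omega> in M. T \<omega> > exp s)) \<sim>[at_top] (\<lambda>s. c * exp (-\<alpha> * s) * g s)"
    and X: "(\<lambda>s. \<P>(\<omega> in M. X \<omega> > exp s)) \<in> o(\<lambda>s. exp (-\<alpha> * s) * g s)"
  shows "(\<lambda>s. \<P>(\<omega> in M. X \<omega> + T \<omega> > exp s)) \<sim>[at_top] (\<lambda>s. c * exp (-\<alpha> * s) * g s)"
proof (rule asymp_equiv_factorI)
  have [measurable]: "X \<in> borel_measurable M" "T \<in> borel_measurable M"
    using indep_var_rv1[OF ind] indep_var_rv2[OF ind] by auto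
  let ?g = "\<lambda>s. c * exp (-\<alpha> * s) * g s"
  show gpos: "\<forall>\<^sub>F s in at_top. ?g s > 0"
    using shift_stable_pos[OF g] by eventually_elim (use pos in simp)
  fix K :: real assume K: "K > 1"
  obtain L where L: "L > 1" "L ^ 3 = K" using factor_root[OF K, of 3] by auto
  define h where "h = ln L / \<alpha>"
  have h: "h > 0" "exp (\<alpha> * h) = L" using L pos by (auto simp: h_def)
  \<comment> \<open>The remainder \<open>exp s - exp (s - h)\<close> equals \<open>exp (s + d)\<close>.\<close>
  define d where "d = ln (1 - exp (-h))"
  have d: "exp d = 1 - exp (-h)" using h by (simp add: d_def)
  have shiftpos: "\<forall>\<^sub>F s in at_top. exp (-\<alpha> * u) * ?g s > 0" for u
    using gpos by eventually_elim simp
  have up1: "\<forall>\<^sub>F s in at_top. \<P>(\<omega> in M. T \<omega> > exp (s + - h)) \<le> L * (exp (-\<alpha> * (-h)) * ?g s)"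
    by (rule asymp_equiv_factorD(1)[OF tilted_shift[OF g _ T] shiftpos L(1)]) (use pos in simp)
  have "(\<lambda>s. \<P>(\<omega> in M. X \<omega> > exp (s + d))) \<in> o(\<lambda>s. exp (-\<alpha> * s) * g s)"
    by (rule smallo_tilted_shift[OF g X])
  hence "\<forall>\<^sub>F s in at_top. \<P>(\<omega> in M. X \<omega> > exp (s + d)) \<le> (c * (L^3 - L^2)) * (exp (-\<alpha> * s) * g s)"
    by (rule smallo_leD) (use pos L tame_nonneg[OF shift_stable_tame[OF g]] in \<open>auto simp: power_strict_increasing\<close>)
  with up1 have up: "\<forall>\<^sub>F s in at_top. \<P>(\<omega> in M. X \<omega> + T \<omega> > exp s) \<le> K * ?g s"
  proof eventually_elim
    case (elim s)
    have "exp (s + - h) + exp (s + d) = exp s"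
      unfolding exp_add d by (simp add: algebra_simps)
    hence "\<P>(\<omega> in M. X \<omega> + T \<omega> > exp s) \<le>
       prob ({\<omega> \<in> space M. T \<omega> > exp (s + - h)} \<union> {\<omega> \<in> space M. X \<omega> > exp (s + d)})"
      by (intro finite_measure_mono) auto
    also have "\<dots> \<le> \<P>(\<omega> in M. T \<omega> > exp (s + - h)) + \<P>(\<omega> in M. X \<omega> > exp (s + d))"
      by (intro measure_Un_le) auto
    also have "\<dots> \<le> L * (L * ?g s) + (c * (L^3 - L^2)) * (exp (-\<alpha> * s) * g s)"
      using elim h by simp
    also have "\<dots> = K * ?g s" unfolding L(2)[symmetric] by (simp add: algebra_simps power2_eq_square)
    finally show ?case .
  qed
  have lo1: "\<forall>\<^sub>F s in at_top. exp (-\<alpha> * h) * ?g s \<le> L * \<P>(\<omega> in M. T \<omega> > exp (s + h))"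
    by (rule asymp_equiv_factorD(2)[OF tilted_shift[OF g _ T] shiftpos L(1)]) (use pos in simp)
  interpret DX: real_distribution "distr M borel X" by (rule real_distribution_distr) measurable
  have "filterlim (\<lambda>s::real. - ((exp h - 1) * exp s)) at_bot at_top"
    using h by (intro filterlim_uminus_at_top[THEN iffD1] filterlim_tendsto_pos_mult_at_top[OF tendsto_const _ exp_at_top]) simp
  from filterlim_compose[OF DX.cdf_lim_at_bot this]
  have "((\<lambda>s. cdf (distr M borel X) (- ((exp h - 1) * exp s))) \<longlongrightarrow> 0) at_top" .
  hence "\<forall>\<^sub>F s in at_top. cdf (distr M borel X) (- ((exp h - 1) * exp s)) < 1 - 1 / L"
    using L by (intro order_tendstoD(2)) auto
  with lo1 have lo: "\<forall>\<^sub>F s in at_top. ?g s \<le> K * \<P>(\<omega> in M. X \<omega> + T \<omega> > exp s)"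
  proof eventually_elim
    case (elim s)
    define r where "r = - ((exp h - 1) * exp s)"
    have "cdf (distr M borel X) r = \<P>(\<omega> in M. X \<omega> \<le> r)"
      by (simp add: cdf_def measure_distr vimage_def Int_def conj_commute)
    also have "\<dots> = 1 - \<P>(\<omega> in M. X \<omega> > r)"
      by (subst prob_compl[symmetric]) (auto intro!: arg_cong[where f = prob])
    finally have X1: "1 / L \<le> \<P>(\<omega> in M. X \<omega> > r)" using elim by (simp add: r_def)
    have e: "r + exp (s + h) = exp s" by (simp add: r_def exp_add algebra_simps)
    have "\<P>(\<omega> in M. X \<omega> > r) * \<P>(\<omega> in M. T \<omega> > exp (s + h)) =
       prob ((\<lambda>\<omega>. (X \<omega>, T \<omega>)) -` ({r<..} \<times> {exp (s + h)<..}) \<inter> space M)"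
      by (subst indep_varD[OF ind]) (auto simp: vimage_def Int_def conj_commute)
    also have "\<dots> \<le> \<P>(\<omega> in M. X \<omega> + T \<omega> > exp s)"
      using e by (intro finite_measure_mono) auto
    finally have P: "\<P>(\<omega> in M. X \<omega> > r) * \<P>(\<omega> in M. T \<omega> > exp (s + h)) \<le> \<P>(\<omega> in M. X \<omega> + T \<omega> > exp s)" .
    have "1 / L * \<P>(\<omega> in M. T \<omega> > exp (s + h)) \<le> \<P>(\<omega> in M. X \<omega> + T \<omega> > exp s)"
      using mult_right_mono[OF X1, of "\<P>(\<omega> in M. T \<omega> > exp (s + h))"] P by simp
    hence 1: "\<P>(\<omega> in M. T \<omega> > exp (s + h)) \<le> L * \<P>(\<omega> in M. X \<omega> + T \<omega> > exp s)"
      using L by (simp add: field_simps)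
    have "?g s = L * (exp (-\<alpha> * h) * ?g s)"
    proof -
      have "L * exp (-\<alpha> * h) = 1" unfolding h(2)[symmetric] by (simp flip: exp_add)
      hence "L * exp (-\<alpha> * h) * ?g s = ?g s" by (simp only: mult_1)
      thus ?thesis by (simp only: mult.assoc)
    qed
    also have "\<dots> \<le> L * (L * (L * \<P>(\<omega> in M. X \<omega> + T \<omega> > exp s)))"
      using elim(1) 1 L by (meson mult_left_mono order_trans less_imp_le zero_less_one)
    also have "\<dots> = K * \<P>(\<omega> in M. X \<omega> + T \<omega> > exp s)"
      unfolding L(2)[symmetric] by (simp add: eval_nat_numeral)
    finally show ?case .
  qed
  show "\<forall>\<^sub>F s in at_top. \<P>(\<omega> in M. X \<omega> + T \<omega> > exp s) \<le> K * ?g s \<and>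
     ?g s \<le> K * \<P>(\<omega> in M. X \<omega> + T \<omega> > exp s)"
    by (rule eventually_conj[OF up lo])
qed

end

section \<open>The discounted sum and its tail\<close>

text \<open>
  With \<open>\<xi> k = X (n - k)\<close> and \<open>\<eta> k = Y (n - k)\<close> this is the inner sum
  \<open>X (n - m) + Y (n - m + 1) * (X (n - m + 1) + \<dots> + Y n * X n)\<close>.
\<close>

primrec backward_sum :: "(nat \<Rightarrow> real) \<Rightarrow> (nat \<Rightarrow> real) \<Rightarrow> nat \<Rightarrow> real" where
  "backward_sum \<xi> \<eta> 0 = \<xi> 0"
| "backward_sum \<xi> \<eta> (Suc m) = \<xi> (Suc m) + \<eta> m * backward_sum \<xi> \<eta> m"

primrec iter_conv :: "(real \<Rightarrow> real) \<Rightarrow> (nat \<Rightarrow> real \<Rightarrow> real) \<Rightarrow> nat \<Rightarrow> real \<Rightarrow> real" where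
  "iter_conv g \<phi> 0 = g"
| "iter_conv g \<phi> (Suc m) = conv (iter_conv g \<phi> m) (\<phi> m)"

lemma shift_stable_iter_conv:
  assumes "shift_stable g" "\<And>i. i < m \<Longrightarrow> shift_stable (\<phi> i)"
  shows "shift_stable (iter_conv g \<phi> m)"
  using assms by (induction m) (auto intro: shift_stable_conv)

lemma backward_sum_cong:
  assumes "\<And>k. k \<le> m \<Longrightarrow> \<xi> k = \<xi>' k" "\<And>k. k < m \<Longrightarrow> \<eta> k = \<eta>' k"
  shows "backward_sum \<xi> \<eta> m = backward_sum \<xi>' \<eta>' m"
  using assms by (induction m) auto

lemma backward_sum_measurable:
  assumes "\<And>k. k \<le> m \<Longrightarrow> \<xi> k \<in> borel_measurable N" "\<And>k. k < m \<Longrightarrow> \<eta> k \<in> borel_measurable N"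
  shows "(\<lambda>\<omega>. backward_sum (\<lambda>k. \<xi> k \<omega>) (\<lambda>k. \<eta> k \<omega>) m) \<in> borel_measurable N"
  using assms by (induction m) auto

lemma backward_sum_eq:
  fixes X Y :: "nat \<Rightarrow> real"
  assumes "m < n"
  shows "(\<Prod>j=1..n-m. Y j) * backward_sum (\<lambda>k. X (n - k)) (\<lambda>k. Y (n - k)) m = (\<Sum>i=n-m..n. X i * (\<Prod>j=1..i. Y j))"
  using assms
proof (induction m)
  case (Suc m)
  let ?B = "backward_sum (\<lambda>k. X (n - k)) (\<lambda>k. Y (n - k))"
  define q where "q = n - Suc m"
  have q: "n - m = Suc q" "q \<le> n" using Suc.prems by (auto simp: q_def)
  have "(\<Prod>j=1..q. Y j) * ?B (Suc m) = (\<Prod>j=1..q. Y j) * X q + (\<Prod>j=1..Suc q. Y j) * ?B m"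
    by (simp add: q q_def[symmetric] algebra_simps)
  also have "(\<Prod>j=1..Suc q. Y j) * ?B m = (\<Sum>i=Suc q..n. X i * (\<Prod>j=1..i. Y j))"
    using Suc by (simp add: q)
  also have "(\<Prod>j=1..q. Y j) * X q + (\<Sum>i=Suc q..n. X i * (\<Prod>j=1..i. Y j)) = (\<Sum>i=q..n. X i * (\<Prod>j=1..i. Y j))"
    by (subst sum.atLeast_Suc_atMost[OF q(2)]) simp
  finally show ?case by (simp only: q_def)
qed simp

lemma S_eq_backward_sum:
  assumes "n \<ge> 1"
  shows "S X Y n \<omega> = Y 1 \<omega> * backward_sum (\<lambda>k. X (n - k) \<omega>) (\<lambda>k. Y (n - k) \<omega>) (n - 1)"
  using backward_sum_eq[of "n - 1" n "\<lambda>j. Y j \<omega>" "\<lambda>i. X i \<omega>"] assms by (simp add: S_def)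

context prob_space begin

lemma indep_var_of_family:
  assumes ind: "indep_vars (\<lambda>_. borel) Z I" and a: "a \<in> I" "B \<subseteq> I" "a \<notin> B"
    and m: "\<phi> \<in> borel_measurable (PiM B (\<lambda>_. borel))"
  shows "indep_var borel (Z a) borel (\<lambda>\<omega>. \<phi> (restrict (\<lambda>i. Z i \<omega>) B) :: real)"
proof -
  have "indep_var (PiM {a} (\<lambda>_. borel)) (\<lambda>\<omega>. restrict (\<lambda>i. Z i \<omega>) {a}) (PiM B (\<lambda>_. borel)) (\<lambda>\<omega>. restrict (\<lambda>i. Z i \<omega>) B)"
    by (rule indep_var_restrict[OF ind]) (use a in auto)
  from indep_var_compose[OF this _ m, of "\<lambda>p. p a" borel]
  show ?thesis by (simp add: o_def)
qed

text \<open>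
  Induction over the inner sums \<open>B m\<close> of \<open>S\<close>. The bound \<open>f (n - m) \<in> O(H m)\<close> is carried along because the
  hypothesis compares \<open>f (n - m - 1)\<close> with \<open>conv (f (n - m)) (fs (n - m))\<close> only, whereas the inner sum has
  the tail of \<open>conv (H m) (fs (n - m))\<close>.
\<close>

theorem tail_S:
  fixes X Y :: "nat \<Rightarrow> 'a \<Rightarrow> real"
  assumes n: "n \<ge> 1" and \<alpha>: "\<alpha> > 0"
    and ind: "indep_vars (\<lambda>_. borel) (case_sum X Y) ({1..n} <+> {1..n})"
    and Y0: "\<And>i. i \<in> {1..n} \<Longrightarrow> AE \<omega> in M. Y i \<omega> > 0"
    and f: "\<And>i. i \<in> {1..n} \<Longrightarrow> shift_stable (f i)"
    and fs: "\<And>i. i \<in> {1..n} \<Longrightarrow> shift_stable (fs i)"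
    and X: "\<And>i. i \<in> {1..n} \<Longrightarrow> (\<lambda>s. \<P>(\<omega> in M. X i \<omega> > exp s)) \<sim>[at_top] (\<lambda>s. exp (-\<alpha> * s) * f i s)"
    and Y: "\<And>i. i \<in> {1..n} \<Longrightarrow> (\<lambda>s. \<P>(\<omega> in M. Y i \<omega> > exp s)) \<sim>[at_top] (\<lambda>s. exp (-\<alpha> * s) * fs i s)"
    and small: "\<And>k. k \<in> {2..n} \<Longrightarrow> f (k - 1) \<in> o(conv (f k) (fs k))"
  shows "(\<lambda>s. \<P>(\<omega> in M. S X Y n \<omega> > exp s)) \<sim>[at_top]
     (\<lambda>s. \<alpha> ^ n * exp (-\<alpha> * s) * iter_conv (f n) (\<lambda>m. fs (n - m)) n s)"
proof -
  define B where "B m \<omega> = backward_sum (\<lambda>k. X (n - k) \<omega>) (\<lambda>k. Y (n - k) \<omega>) m" for m \<omega>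
  define H where "H = iter_conv (f n) (\<lambda>m. fs (n - m))"
  have H: "shift_stable (H m)" if "m \<le> n" for m
    unfolding H_def using that n by (intro shift_stable_iter_conv f fs) auto
  let ?B = "\<lambda>p m. backward_sum (\<lambda>k. p (Inl (n - k))) (\<lambda>k. p (Inr (n - k))) m"
  have indY: "indep_var borel (Y (n - m)) borel (B m)" if m: "m < n" for m
  proof -
    define J where "J = Inl ` {n-m..n} \<union> Inr ` {n-m<..n}"
    have "indep_var borel (case_sum X Y (Inr (n - m))) borel (\<lambda>\<omega>. ?B (restrict (\<lambda>i. case_sum X Y i \<omega>) J) m)"
      by (rule indep_var_of_family[OF ind])
        (use m in \<open>auto simp: J_def intro!: backward_sum_measurable measurable_component_singleton\<close>)
    moreover have "?B (restrict (\<lambda>i. case_sum X Y i \<omega>) J) m = B m \<omega>" for \<omega>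
      unfolding B_def by (rule backward_sum_cong) (use m in \<open>auto simp: J_def\<close>)
    ultimately show ?thesis by simp
  qed
  have indX: "indep_var borel (X (n - Suc m)) borel (\<lambda>\<omega>. Y (n - m) \<omega> * B m \<omega>)" if m: "Suc m < n" for m
  proof -
    define J where "J = Inl ` {n-m..n} \<union> Inr ` {n-m..n}"
    have "indep_var borel (case_sum X Y (Inl (n - Suc m))) borel
        (\<lambda>\<omega>. (\<lambda>p. p (Inr (n - m)) * ?B p m) (restrict (\<lambda>i. case_sum X Y i \<omega>) J))"
      by (rule indep_var_of_family[OF ind])
        (use m in \<open>auto simp: J_def intro!: borel_measurable_times backward_sum_measurable measurable_component_singleton\<close>)
    moreover have "?B (restrict (\<lambda>i. case_sum X Y i \<omega>) J) m = B m \<omega>" for \<omega>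
      unfolding B_def by (rule backward_sum_cong) (use m in \<open>auto simp: J_def\<close>)
    moreover have "restrict (\<lambda>i. case_sum X Y i \<omega>) J (Inr (n - m)) = Y (n - m) \<omega>" for \<omega>
      using m by (simp add: J_def)
    ultimately show ?thesis by simp
  qed
  have prod_tail: "(\<lambda>s. \<P>(\<omega> in M. Y (n - m) \<omega> * B m \<omega> > exp s)) \<sim>[at_top]
       (\<lambda>s. \<alpha> ^ Suc m * exp (-\<alpha> * s) * H (Suc m) s)"
    if m: "m < n" and B: "(\<lambda>s. \<P>(\<omega> in M. B m \<omega> > exp s)) \<sim>[at_top] (\<lambda>s. \<alpha> ^ m * exp (-\<alpha> * s) * H m s)" for m
    using tail_product[OF indY[OF m] Y0 \<alpha> _ H fs B Y] m \<alpha> by (simp add: H_def)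
  have main: "(\<lambda>s. \<P>(\<omega> in M. B m \<omega> > exp s)) \<sim>[at_top] (\<lambda>s. \<alpha> ^ m * exp (-\<alpha> * s) * H m s)
      \<and> f (n - m) \<in> O(H m)" if "m < n" for m
    using that
  proof (induction m)
    case 0
    thus ?case using X[of n] by (simp add: B_def H_def)
  next
    case (Suc m)
    hence IH: "(\<lambda>s. \<P>(\<omega> in M. B m \<omega> > exp s)) \<sim>[at_top] (\<lambda>s. \<alpha> ^ m * exp (-\<alpha> * s) * H m s)"
      "f (n - m) \<in> O(H m)" by auto
    have "f (n - Suc m) \<in> o(conv (f (n - m)) (fs (n - m)))"
      using small[of "n - m"] Suc.prems by simp
    also have "conv (f (n - m)) (fs (n - m)) \<in> O(conv (H m) (fs (n - m)))"
      using Suc.prems by (intro conv_bigo_mono f fs H IH) auto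
    finally have fo: "f (n - Suc m) \<in> o(H (Suc m))" by (simp add: H_def)
    have "(\<lambda>s. \<P>(\<omega> in M. X (n - Suc m) \<omega> > exp s)) \<in> O(\<lambda>s. exp (-\<alpha> * s) * f (n - Suc m) s)"
      using Suc.prems by (intro asymp_equiv_imp_bigo X) auto
    also have "(\<lambda>s. exp (-\<alpha> * s) * f (n - Suc m) s) \<in> o(\<lambda>s. exp (-\<alpha> * s) * H (Suc m) s)"
      by (intro landau_o.big_small_mult landau_o.big_refl fo)
    finally have Xo: "(\<lambda>s. \<P>(\<omega> in M. X (n - Suc m) \<omega> > exp s)) \<in> o(\<lambda>s. exp (-\<alpha> * s) * H (Suc m) s)" .
    have "(\<lambda>s. \<P>(\<omega> in M. X (n - Suc m) \<omega> + Y (n - m) \<omega> * B m \<omega> > exp s)) \<sim>[at_top]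
       (\<lambda>s. \<alpha> ^ Suc m * exp (-\<alpha> * s) * H (Suc m) s)"
      using Suc.prems \<alpha> by (intro tail_sum[OF indX _ _ H prod_tail Xo] IH) auto
    moreover have "B (Suc m) \<omega> = X (n - Suc m) \<omega> + Y (n - m) \<omega> * B m \<omega>" for \<omega>
      by (simp add: B_def)
    ultimately show ?case using landau_o.small_imp_big[OF fo] by simp
  qed
  have "S X Y n \<omega> = Y (n - (n - 1)) \<omega> * B (n - 1) \<omega>" for \<omega>
    using S_eq_backward_sum[OF n] n by (simp add: B_def)
  thus ?thesis using prod_tail[of "n - 1"] main[of "n - 1"] n by (simp add: H_def)
qed

end

section \<open>Iterated convolutions of regularly varying functions\<close>

lemma asymp_equiv_add_pos:
  fixes u1 u2 v1 v2 :: "real \<Rightarrow> real"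
  assumes "u1 \<sim>[F] v1" "u2 \<sim>[F] v2" "\<forall>\<^sub>F x in F. v1 x > 0" "\<forall>\<^sub>F x in F. v2 x > 0"
  shows "(\<lambda>x. u1 x + u2 x) \<sim>[F] (\<lambda>x. v1 x + v2 x)"
proof (rule asymp_equiv_factorI)
  show "\<forall>\<^sub>F x in F. v1 x + v2 x > 0" using assms(3,4) by eventually_elim simp
  fix K :: real assume K: "K > 1"
  show "\<forall>\<^sub>F x in F. u1 x + u2 x \<le> K * (v1 x + v2 x) \<and> v1 x + v2 x \<le> K * (u1 x + u2 x)"
    using asymp_equiv_factorD[OF assms(1,3) K] asymp_equiv_factorD[OF assms(2,4) K]
    by eventually_elim (simp add: distrib_left)
qed

lemma scales_add:
  assumes "scales \<gamma> u" "scales \<gamma> v" "\<forall>\<^sub>F x in at_top. u x > 0" "\<forall>\<^sub>F x in at_top. v x > 0"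
  shows "scales \<gamma> (\<lambda>x. u x + v x)"
  unfolding scales_def
proof (intro allI impI)
  fix t :: real assume t: "t > 0"
  have "(\<lambda>x. u (x * t) + v (x * t)) \<sim>[at_top] (\<lambda>x. t powr \<gamma> * u x + t powr \<gamma> * v x)"
    using assms(3,4) t by (intro asymp_equiv_add_pos scalesD assms) (auto elim: eventually_mono)
  thus "(\<lambda>x. u (x * t) + v (x * t)) \<sim>[at_top] (\<lambda>x. t powr \<gamma> * (u x + v x))"
    by (simp add: distrib_left)
qed

lemma iter_conv_Suc_left:
  "iter_conv g \<phi> (Suc m) = iter_conv (conv g (\<phi> 0)) (\<lambda>i. \<phi> (Suc i)) m"
  by (induction m) simp_all

lemma Beta_Gamma_step:
  fixes a b :: real assumes "a > 0"
  shows "P / Gamma a * Beta a b = P * Gamma b / Gamma (a + b)"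
  using Gamma_real_pos[OF assms] by (simp add: Beta_def)

text \<open>
  The index of the iterated convolution grows by \<open>\<delta> i + 1\<close> at each step, so all convolutions are
  governed by \<open>conv_asymp_Beta\<close>; the Gamma factors of successive Beta functions cancel.
\<close>

lemma iter_conv_asymp_Beta:
  assumes g: "shift_stable g" "scales \<gamma> g" "\<gamma> > -1"
    and \<phi>: "\<And>i. i < m \<Longrightarrow> shift_stable (\<phi> i)" "\<And>i. i < m \<Longrightarrow> scales (\<delta> i) (\<phi> i)" "\<And>i. i < m \<Longrightarrow> \<delta> i > -1"
  shows "iter_conv g \<phi> m \<sim>[at_top] (\<lambda>x. x ^ m * g x * (\<Prod>i<m. \<phi> i x) *
      (Gamma (\<gamma> + 1) * (\<Prod>i<m. Gamma (\<delta> i + 1)) / Gamma (\<gamma> + (\<Sum>i<m. \<delta> i) + m + 1)))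
    \<and> scales (\<gamma> + (\<Sum>i<m. \<delta> i) + m) (iter_conv g \<phi> m)"
  using \<phi>
proof (induction m)
  case 0
  have "Gamma (\<gamma> + 1) \<noteq> 0" using Gamma_real_pos[of "\<gamma> + 1"] g(3) by linarith
  thus ?case using g by simp
next
  case (Suc m)
  define H where "H = iter_conv g \<phi> m"
  define \<gamma>' where "\<gamma>' = \<gamma> + (\<Sum>i<m. \<delta> i) + m"
  define P where "P = Gamma (\<gamma> + 1) * (\<Prod>i<m. Gamma (\<delta> i + 1))"
  have IH: "H \<sim>[at_top] (\<lambda>x. x ^ m * g x * (\<Prod>i<m. \<phi> i x) * (P / Gamma (\<gamma>' + 1)))" "scales \<gamma>' H"
    using Suc by (auto simp: H_def \<gamma>'_def P_def)
  have Hs: "shift_stable H" unfolding H_def using Suc.prems g by (intro shift_stable_iter_conv) auto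
  have "(\<Sum>i<m. \<delta> i + 1) \<ge> 0"
  proof (rule sum_nonneg)
    fix i assume "i \<in> {..<m}"
    thus "\<delta> i + 1 \<ge> 0" using Suc.prems(3)[of i] by simp
  qed
  hence \<gamma>': "\<gamma>' > -1" using g(3) by (simp add: \<gamma>'_def sum.distrib)
  have c: "conv H (\<phi> m) \<sim>[at_top] (\<lambda>x. x * H x * \<phi> m x * Beta (\<gamma>' + 1) (\<delta> m + 1))"
    using Suc.prems by (intro conv_asymp_Beta Hs IH \<gamma>') auto
  have "\<dots> \<sim>[at_top] (\<lambda>x. x * (x ^ m * g x * (\<Prod>i<m. \<phi> i x) * (P / Gamma (\<gamma>' + 1))) * \<phi> m x * Beta (\<gamma>' + 1) (\<delta> m + 1))"
    by (intro asymp_equiv_mult asymp_equiv_refl IH)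
  also have "\<dots> = (\<lambda>x. x ^ Suc m * g x * (\<Prod>i<Suc m. \<phi> i x) * (P / Gamma (\<gamma>' + 1) * Beta (\<gamma>' + 1) (\<delta> m + 1)))"
    by (simp add: mult_ac)
  also have "P / Gamma (\<gamma>' + 1) * Beta (\<gamma>' + 1) (\<delta> m + 1) = P * Gamma (\<delta> m + 1) / Gamma ((\<gamma>' + 1) + (\<delta> m + 1))"
    using \<gamma>' by (intro Beta_Gamma_step) simp
  also have "P * Gamma (\<delta> m + 1) = Gamma (\<gamma> + 1) * (\<Prod>i<Suc m. Gamma (\<delta> i + 1))" by (simp add: P_def)
  also have "(\<gamma>' + 1) + (\<delta> m + 1) = \<gamma> + (\<Sum>i<Suc m. \<delta> i) + Suc m + 1" by (simp add: \<gamma>'_def)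
  finally have 1: "conv H (\<phi> m) \<sim>[at_top] (\<lambda>x. x ^ Suc m * g x * (\<Prod>i<Suc m. \<phi> i x) *
      (Gamma (\<gamma> + 1) * (\<Prod>i<Suc m. Gamma (\<delta> i + 1)) / Gamma (\<gamma> + (\<Sum>i<Suc m. \<delta> i) + Suc m + 1)))"
    using asymp_equiv_trans[OF c] by blast
  have "scales (1 + \<gamma>' + \<delta> m + 0) (\<lambda>x. x * H x * \<phi> m x * Beta (\<gamma>' + 1) (\<delta> m + 1))"
    by (intro scales_mult scales_ident IH Suc.prems) (auto simp: scales_def)
  hence "scales (1 + \<gamma>' + \<delta> m + 0) (conv H (\<phi> m))" by (rule scales_cong[OF c])
  hence "scales (\<gamma> + (\<Sum>i<Suc m. \<delta> i) + Suc m) (conv H (\<phi> m))" by (simp add: \<gamma>'_def add_ac)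
  with 1 show ?case by (simp only: iter_conv.simps H_def)
qed

text \<open>
  A factor of index \<open>-1\<close> contributes its slowly varying antiderivative and leaves the index \<open>\<gamma>\<close>
  unchanged.
\<close>

lemma iter_conv_asymp_integ:
  assumes g: "shift_stable g" "scales \<gamma> g" "\<gamma> > -1"
    and \<phi>: "\<And>i. i < m \<Longrightarrow> shift_stable (\<phi> i)" "\<And>i. i < m \<Longrightarrow> scales (-1) (\<phi> i)"
  shows "iter_conv g \<phi> m \<sim>[at_top] (\<lambda>x. g x * (\<Prod>i<m. integ (\<phi> i) x)) \<and> scales \<gamma> (iter_conv g \<phi> m)"
  using \<phi>
proof (induction m)
  case 0
  thus ?case using g by simp
next
  case (Suc m)
  define H where "H = iter_conv g \<phi> m"
  have IH: "H \<sim>[at_top] (\<lambda>x. g x * (\<Prod>i<m. integ (\<phi> i) x))" "scales \<gamma> H"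
    using Suc by (auto simp: H_def)
  have Hs: "shift_stable H" unfolding H_def using Suc.prems g by (intro shift_stable_iter_conv) auto
  have \<phi>m: "shift_stable (\<phi> m)" "scales (-1) (\<phi> m)" using Suc.prems by auto
  have c: "conv H (\<phi> m) \<sim>[at_top] (\<lambda>x. H x * integ (\<phi> m) x)"
    by (rule conv_asymp_integ[OF \<phi>m Hs IH(2) g(3)])
  also have "\<dots> \<sim>[at_top] (\<lambda>x. (g x * (\<Prod>i<m. integ (\<phi> i) x)) * integ (\<phi> m) x)"
    by (intro asymp_equiv_mult asymp_equiv_refl IH)
  finally have 1: "conv H (\<phi> m) \<sim>[at_top] (\<lambda>x. g x * (\<Prod>i<Suc m. integ (\<phi> i) x))" by (simp add: mult_ac)
  have "scales (\<gamma> + 0) (conv H (\<phi> m))"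
    by (rule scales_cong[OF c scales_mult[OF IH(2) integ_scales[OF \<phi>m]]])
  with 1 show ?case by (simp add: H_def)
qed

text \<open>
  Formally the derivative of the product of all antiderivatives. The asymptotics of the antiderivative
  of the iterated convolution has to be carried through the induction, since the product rule for
  the next step refers to it.
\<close>

lemma iter_conv_asymp_product_rule:
  assumes g: "shift_stable g" "scales (-1) g"
    and \<phi>: "\<And>i. i < m \<Longrightarrow> shift_stable (\<phi> i)" "\<And>i. i < m \<Longrightarrow> scales (-1) (\<phi> i)"
  shows "iter_conv g \<phi> m \<sim>[at_top] (\<lambda>x. g x * (\<Prod>i<m. integ (\<phi> i) x) +
      integ g x * (\<Sum>i<m. \<phi> i x * (\<Prod>j\<in>{..<m} - {i}. integ (\<phi> j) x)))
    \<and> integ (iter_conv g \<phi> m) \<sim>[at_top] (\<lambda>x. integ g x * (\<Prod>i<m. integ (\<phi> i) x))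
    \<and> scales (-1) (iter_conv g \<phi> m)"
  using \<phi>
proof (induction m)
  case 0
  thus ?case using g by simp
next
  case (Suc m)
  define H where "H = iter_conv g \<phi> m"
  define E where "E x = g x * (\<Prod>i<m. integ (\<phi> i) x) +
      integ g x * (\<Sum>i<m. \<phi> i x * (\<Prod>j\<in>{..<m} - {i}. integ (\<phi> j) x))" for x
  define J where "J x = integ g x * (\<Prod>i<m. integ (\<phi> i) x)" for x
  have IH: "H \<sim>[at_top] E" "integ H \<sim>[at_top] J" "scales (-1) H"
    using Suc unfolding H_def E_def J_def by auto
  have Hs: "shift_stable H" unfolding H_def using Suc.prems g by (intro shift_stable_iter_conv) auto
  have \<phi>m: "shift_stable (\<phi> m)" "scales (-1) (\<phi> m)" using Suc.prems by auto
  have E0: "\<forall>\<^sub>F x in at_top. E x > 0"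
    by (rule asymp_equiv_eventually_pos[OF asymp_equiv_symI[OF IH(1)] shift_stable_pos[OF Hs]])
  have J0: "\<forall>\<^sub>F x in at_top. J x > 0"
    by (rule asymp_equiv_eventually_pos[OF asymp_equiv_symI[OF IH(2)] integ_pos[OF Hs]])
  note p = integ_pos[OF Hs] shift_stable_pos[OF Hs] integ_pos[OF \<phi>m(1)] shift_stable_pos[OF \<phi>m(1)]
  have p1: "\<forall>\<^sub>F x in at_top. H x * integ (\<phi> m) x > 0" using p(2,3) by eventually_elim simp
  have p2: "\<forall>\<^sub>F x in at_top. \<phi> m x * integ H x > 0" using p(4,1) by eventually_elim simp
  have p3: "\<forall>\<^sub>F x in at_top. E x * integ (\<phi> m) x > 0" using E0 p(3) by eventually_elim simp
  have p4: "\<forall>\<^sub>F x in at_top. \<phi> m x * J x > 0" using p(4) J0 by eventually_elim simp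
  have c: "conv H (\<phi> m) \<sim>[at_top] (\<lambda>x. H x * integ (\<phi> m) x + \<phi> m x * integ H x)"
    by (rule conv_asymp_product_rule[OF \<phi>m Hs IH(3)])
  also have "\<dots> \<sim>[at_top] (\<lambda>x. E x * integ (\<phi> m) x + \<phi> m x * J x)"
    by (intro asymp_equiv_add_pos asymp_equiv_mult asymp_equiv_refl IH p3 p4)
  also have "\<dots> = (\<lambda>x. g x * (\<Prod>i<Suc m. integ (\<phi> i) x) +
      integ g x * (\<Sum>i<Suc m. \<phi> i x * (\<Prod>j\<in>{..<Suc m} - {i}. integ (\<phi> j) x)))"
  proof
    fix x
    have "(\<Prod>j\<in>{..<Suc m} - {i}. integ (\<phi> j) x) = (\<Prod>j\<in>{..<m} - {i}. integ (\<phi> j) x) * integ (\<phi> m) x" if "i < m" for i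
    proof -
      have "{..<Suc m} - {i} = insert m ({..<m} - {i})" using that by auto
      thus ?thesis by (simp add: mult.commute)
    qed
    hence "(\<Sum>i<m. \<phi> i x * (\<Prod>j\<in>{..<Suc m} - {i}. integ (\<phi> j) x)) =
        (\<Sum>i<m. \<phi> i x * (\<Prod>j\<in>{..<m} - {i}. integ (\<phi> j) x)) * integ (\<phi> m) x"
      by (simp add: sum_distrib_right mult.assoc)
    moreover have "{..<Suc m} - {m} = {..<m}" by auto
    ultimately show "E x * integ (\<phi> m) x + \<phi> m x * J x = g x * (\<Prod>i<Suc m. integ (\<phi> i) x) +
      integ g x * (\<Sum>i<Suc m. \<phi> i x * (\<Prod>j\<in>{..<Suc m} - {i}. integ (\<phi> j) x))"
      by (simp add: E_def J_def algebra_simps)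
  qed
  finally have 1: "conv H (\<phi> m) \<sim>[at_top] \<dots>" .
  have "integ (conv H (\<phi> m)) \<sim>[at_top] (\<lambda>x. integ H x * integ (\<phi> m) x)"
    by (rule integ_conv_asymp[OF Hs IH(3) \<phi>m])
  also have "\<dots> \<sim>[at_top] (\<lambda>x. J x * integ (\<phi> m) x)"
    by (intro asymp_equiv_mult asymp_equiv_refl IH)
  finally have 2: "integ (conv H (\<phi> m)) \<sim>[at_top] (\<lambda>x. integ g x * (\<Prod>i<Suc m. integ (\<phi> i) x))"
    by (simp add: J_def mult.assoc)
  have s1: "scales (-1) (\<lambda>x. H x * integ (\<phi> m) x)"
    using scales_mult[OF IH(3) integ_scales[OF \<phi>m]] by simp
  have s2: "scales (-1) (\<lambda>x. \<phi> m x * integ H x)"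
    using scales_mult[OF \<phi>m(2) integ_scales[OF Hs IH(3)]] by simp
  have 3: "scales (-1) (conv H (\<phi> m))"
    by (rule scales_cong[OF c scales_add[OF s1 s2 p1 p2]])
  show ?case using 1 2 3 by (simp only: iter_conv.simps H_def)
qed

text \<open>
  The first convolution replaces \<open>g\<close> by its antiderivative and produces the index \<open>\<delta> 0 > -1\<close>; from then on
  \<open>iter_conv_asymp_Beta\<close> applies. This is why one power of \<open>x\<close> is missing.
\<close>

lemma iter_conv_asymp_mixed:
  assumes g: "shift_stable g" "scales (-1) g"
    and \<phi>: "\<And>i. i \<le> m \<Longrightarrow> shift_stable (\<phi> i)" "\<And>i. i \<le> m \<Longrightarrow> scales (\<delta> i) (\<phi> i)" "\<And>i. i \<le> m \<Longrightarrow> \<delta> i > -1"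
  shows "iter_conv g \<phi> (Suc m) \<sim>[at_top] (\<lambda>x. x ^ m * integ g x * (\<Prod>i<Suc m. \<phi> i x) *
      ((\<Prod>i<Suc m. Gamma (\<delta> i + 1)) / Gamma ((\<Sum>i<Suc m. \<delta> i) + m + 1)))"
proof -
  define g' where "g' = conv g (\<phi> 0)"
  have c: "g' \<sim>[at_top] (\<lambda>x. \<phi> 0 x * integ g x)"
    unfolding g'_def conv_commute[of g]
    by (rule conv_asymp_integ[OF g]) (use \<phi> in auto)
  have g's: "shift_stable g'" unfolding g'_def using g \<phi> by (intro shift_stable_conv) auto
  have "scales (\<delta> 0 + 0) g'"
    by (rule scales_cong[OF c scales_mult[OF _ integ_scales[OF g]]]) (use \<phi> in auto)
  hence g'sc: "scales (\<delta> 0) g'" by simp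
  define C where "C = Gamma (\<delta> 0 + 1) * (\<Prod>i<m. Gamma (\<delta> (Suc i) + 1)) / Gamma (\<delta> 0 + (\<Sum>i<m. \<delta> (Suc i)) + m + 1)"
  have "iter_conv g' (\<lambda>i. \<phi> (Suc i)) m \<sim>[at_top] (\<lambda>x. x ^ m * g' x * (\<Prod>i<m. \<phi> (Suc i) x) * C)"
    unfolding C_def
    by (rule iter_conv_asymp_Beta[OF g's g'sc, THEN conjunct1]) (use \<phi> in auto)
  also have "\<dots> \<sim>[at_top] (\<lambda>x. x ^ m * (\<phi> 0 x * integ g x) * (\<Prod>i<m. \<phi> (Suc i) x) * C)"
    by (intro asymp_equiv_mult asymp_equiv_refl c)
  also have "\<dots> = (\<lambda>x. x ^ m * integ g x * (\<Prod>i<Suc m. \<phi> i x) * C)"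
    by (simp only: prod.lessThan_Suc_shift mult_ac)
  finally show ?thesis
    unfolding C_def g'_def iter_conv_Suc_left prod.lessThan_Suc_shift sum.lessThan_Suc_shift .
qed

text \<open>
  Each \<open>Beta a b\<close> is \<open>Gamma a * Gamma b / Gamma (a + b)\<close>, and the denominator of one factor cancels
  \<open>Gamma a\<close> of the next.
\<close>

lemma Beta_telescope:
  fixes c :: real and \<delta> :: "nat \<Rightarrow> real"
  assumes c: "c > -1" and \<delta>: "\<And>j. j \<in> {1..m} \<Longrightarrow> \<delta> j > -1"
  shows "(\<Prod>j=1..m. Beta (c + (\<Sum>k=1..j-1. \<delta> k) + real j) (\<delta> j + 1)) =
     Gamma (c + 1) * (\<Prod>j=1..m. Gamma (\<delta> j + 1)) / Gamma (c + (\<Sum>k=1..m. \<delta> k) + m + 1)"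
  using \<delta>
proof (induction m)
  case 0
  have "Gamma (c + 1) \<noteq> 0" using Gamma_real_pos[of "c + 1"] c by linarith
  thus ?case by simp
next
  case (Suc m)
  have "(\<Sum>k=1..m. \<delta> k + 1) \<ge> 0"
  proof (rule sum_nonneg)
    fix k assume "k \<in> {1..m}"
    thus "\<delta> k + 1 \<ge> 0" using Suc.prems[of k] by simp
  qed
  hence p: "c + (\<Sum>k=1..m. \<delta> k) + real m + 1 > 0" using c by (simp add: sum.distrib)
  have "(\<Prod>j=1..Suc m. Beta (c + (\<Sum>k=1..j-1. \<delta> k) + real j) (\<delta> j + 1)) =
    Gamma (c + 1) * (\<Prod>j=1..m. Gamma (\<delta> j + 1)) / Gamma (c + (\<Sum>k=1..m. \<delta> k) + real m + 1) *
      Beta (c + (\<Sum>k=1..m. \<delta> k) + real m + 1) (\<delta> (Suc m) + 1)"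
    using Suc by (simp add: add_ac)
  also have "\<dots> = Gamma (c + 1) * (\<Prod>j=1..m. Gamma (\<delta> j + 1)) * Gamma (\<delta> (Suc m) + 1) /
      Gamma ((c + (\<Sum>k=1..m. \<delta> k) + real m + 1) + (\<delta> (Suc m) + 1))"
    by (rule Beta_Gamma_step[OF p])
  finally show ?case by (simp add: mult_ac add_ac)
qed

section \<open>From the hypotheses on distributions to shift-stable functions\<close>

text \<open>
  The hypotheses constrain \<open>f\<close> on \<open>[0,\<infinity>)\<close> only; its values elsewhere are replaced by \<open>0\<close>, which
  affects neither \<open>conv\<close> nor \<open>integ\<close>.
\<close>

definition zero_extend :: "(real \<Rightarrow> real) \<Rightarrow> real \<Rightarrow> real" where
  "zero_extend f y = (if y < 0 then 0 else f y)"

lemma zero_extend_eq: "0 \<le> y \<Longrightarrow> zero_extend f y = f y"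
  by (simp add: zero_extend_def)

lemma eventually_zero_extend: "\<forall>\<^sub>F y in at_top. zero_extend f y = f y"
  using eventually_ge_at_top[of 0] by eventually_elim (simp add: zero_extend_eq)

lemma conv_zero_extend: "conv (zero_extend f) (zero_extend g) = conv f g"
  unfolding conv_def by (intro ext set_lebesgue_integral_cong) (auto simp: zero_extend_def)

lemma integ_zero_extend: "integ (zero_extend f) = integ f"
  unfolding integ_def by (intro ext set_lebesgue_integral_cong) (auto simp: zero_extend_def)

lemma regularly_varying_scales:
  assumes "regularly_varying \<gamma> f"
  shows "scales \<gamma> (zero_extend f)"
proof (rule scales_cong)
  show "zero_extend f \<sim>[at_top] f" by (rule asymp_equiv_refl_ev[OF eventually_zero_extend])
  show "scales \<gamma> f" using assms unfolding regularly_varying_def scales_def by blast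
qed

lemma tame_zero_extend:
  assumes "admissible f"
  shows "tame (zero_extend f)"
  unfolding tame_def
proof (intro conjI allI impI)
  have "f \<in> borel_measurable (restrict_space borel {0..})" using assms by (simp add: admissible_def)
  hence "(\<lambda>x. indicator {0..} x *\<^sub>R f x) \<in> borel_measurable borel"
    by (subst (asm) borel_measurable_restrict_space_iff) auto
  also have "(\<lambda>x. indicator {0..} x *\<^sub>R f x) = zero_extend f"
    by (auto simp: zero_extend_def indicator_def)
  finally show "zero_extend f \<in> borel_measurable borel" .
  show "0 \<le> zero_extend f y" for y using assms by (simp add: zero_extend_def admissible_def)
  show "zero_extend f y = 0" if "y < 0" for y using that by (simp add: zero_extend_def)
  fix b :: real
  have "bounded (f ` {0..b})" using assms by (simp add: admissible_def)
  then obtain C where C: "\<And>y. y \<in> {0..b} \<Longrightarrow> norm (f y) \<le> C" unfolding bounded_iff by blast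
  show "\<exists>C. \<forall>y\<le>b. zero_extend f y \<le> C"
  proof (intro exI[of _ "max 0 C"] allI impI)
    fix y assume "y \<le> b"
    thus "zero_extend f y \<le> max 0 C" using C[of y] by (auto simp: zero_extend_def)
  qed
qed

text \<open>
  Shift stability is slow variation of \<open>l\<close> read at \<open>exp s\<close>. The divergence of \<open>integ\<close> follows from the
  infinite Lebesgue integral by monotone convergence.
\<close>

lemma shift_stable_zero_extend:
  assumes R: "R11_representation \<alpha> F l f"
  shows "shift_stable (zero_extend f)"
proof -
  define g where "g = zero_extend f"
  have adm: "admissible f" using R by (simp add: R11_representation_def)
  have t: "tame g" unfolding g_def by (rule tame_zero_extend[OF adm])
  have l: "slowly_varying l" using R unfolding R11_representation_def by blast
  have fl: "f y = l (exp y)" if "y \<ge> 0" for y using R that unfolding R11_representation_def by blast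
  have gl: "\<forall>\<^sub>F s in at_top. g (s + h) = l (exp s * exp h)" for h
    using eventually_ge_at_top[of "- h"]
    by eventually_elim (simp add: g_def zero_extend_eq fl exp_add)
  have pos: "\<forall>\<^sub>F s in at_top. g s > 0"
  proof -
    have "\<forall>\<^sub>F x in at_top. l x > 0" using l unfolding regularly_varying_def by blast
    from eventually_compose_filterlim[OF this exp_at_top] gl[of 0]
    show ?thesis by eventually_elim simp
  qed
  have shift: "(\<lambda>s. g (s + h)) \<sim>[at_top] g" for h
  proof -
    have "(\<lambda>x. l (x * exp h)) \<sim>[at_top] (\<lambda>x. exp h powr 0 * l x)"
      using l unfolding regularly_varying_def by (meson exp_gt_zero)
    from asymp_equiv_compose'[OF this exp_at_top]
    have "(\<lambda>s. l (exp s * exp h)) \<sim>[at_top] (\<lambda>s. l (exp s))" by simp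
    thus ?thesis
    proof (rule asymp_equiv_transfer)
      show "\<forall>\<^sub>F s in at_top. l (exp s * exp h) = g (s + h)" using gl[of h] by eventually_elim simp
      show "\<forall>\<^sub>F s in at_top. l (exp s) = g s" using gl[of 0] by eventually_elim simp
    qed
  qed
  have inf: "(\<integral>\<^sup>+y. ennreal (g y) \<partial>lborel) = \<infinity>"
  proof -
    have "(\<integral>\<^sup>+y. ennreal (g y) \<partial>lborel) = (\<integral>\<^sup>+y\<in>{0..}. ennreal (f y) \<partial>lborel)"
      by (intro nn_integral_cong) (auto simp: g_def zero_extend_def indicator_def)
    thus ?thesis using R by (simp add: R11_representation_def)
  qed
  have "filterlim (integ g) at_top at_top"
    unfolding filterlim_at_top
  proof (rule allI, rule ccontr)
    fix Z assume Z: "\<not> (\<forall>\<^sub>F s in at_top. Z \<le> integ g s)"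
    have le: "integ g s \<le> Z" for s
    proof (rule ccontr)
      assume gt: "\<not> integ g s \<le> Z"
      have "\<forall>\<^sub>F s' in at_top. Z \<le> integ g s'"
        using eventually_ge_at_top[of s]
      proof eventually_elim
        case (elim s')
        thus ?case using integ_mono[OF t elim] gt by linarith
      qed
      thus False using Z by blast
    qed
    have Z0: "Z \<ge> 0" using le[of 0] integ_nonneg[OF t, of 0] by linarith
    have [measurable]: "g \<in> borel_measurable borel" by (rule tame_measurable[OF t])
    have "(\<integral>\<^sup>+y. ennreal (g y) \<partial>lborel) = (\<integral>\<^sup>+y. (SUP n. ennreal (indicator {0..real n} y *\<^sub>R g y)) \<partial>lborel)"
    proof (rule nn_integral_cong)
      fix y
      obtain N where N: "y \<le> real N" using real_arch_simple by blast
      have "(SUP n. ennreal (indicator {0..real n} y *\<^sub>R g y)) = ennreal (g y)"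
      proof (rule antisym)
        show "(SUP n. ennreal (indicator {0..real n} y *\<^sub>R g y)) \<le> ennreal (g y)"
          by (rule SUP_least) (auto simp: indicator_def tame_nonneg[OF t])
        have "ennreal (g y) = ennreal (indicator {0..real N} y *\<^sub>R g y)"
          using N tame_zero[OF t, of y] by (auto simp: indicator_def)
        also have "\<dots> \<le> (SUP n. ennreal (indicator {0..real n} y *\<^sub>R g y))" by (rule SUP_upper) simp
        finally show "ennreal (g y) \<le> (SUP n. ennreal (indicator {0..real n} y *\<^sub>R g y))" .
      qed
      thus "ennreal (g y) = (SUP n. ennreal (indicator {0..real n} y *\<^sub>R g y))" by simp
    qed
    also have "\<dots> = (SUP n. \<integral>\<^sup>+y. ennreal (indicator {0..real n} y *\<^sub>R g y) \<partial>lborel)"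
      by (rule nn_integral_monotone_convergence_SUP)
         (auto simp: incseq_def le_fun_def indicator_def tame_nonneg[OF t])
    also have "\<dots> \<le> ennreal Z"
    proof (rule SUP_least)
      fix n :: nat
      have "(\<integral>\<^sup>+y. ennreal (indicator {0..real n} y *\<^sub>R g y) \<partial>lborel) = ennreal (integ g (real n))"
        unfolding integ_def set_lebesgue_integral_def
        using tame_set_integrable[OF t, of 0 "real n"]
        by (intro nn_integral_eq_integral) (auto simp: set_integrable_def tame_nonneg[OF t])
      thus "(\<integral>\<^sup>+y. ennreal (indicator {0..real n} y *\<^sub>R g y) \<partial>lborel) \<le> ennreal Z"
        using le[of "real n"] by (simp add: ennreal_leI)
    qed
    finally show False using inf by (simp add: top_unique)
  qed
  with t pos shift show ?thesis unfolding shift_stable_def g_def by blast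
qed

lemma dist_tail_exp:
  assumes R: "R11_representation \<alpha> F l f"
  shows "(\<lambda>s. dist_tail F (exp s)) \<sim>[at_top] (\<lambda>s. exp (-\<alpha> * s) * zero_extend f s)"
proof -
  have "dist_tail F \<sim>[at_top] (\<lambda>x. x powr (-\<alpha>) * l x)"
    using R unfolding R11_representation_def by blast
  from asymp_equiv_compose'[OF this exp_at_top]
  have "(\<lambda>s. dist_tail F (exp s)) \<sim>[at_top] (\<lambda>s. exp s powr (-\<alpha>) * l (exp s))" .
  also have "\<dots> \<sim>[at_top] (\<lambda>s. exp (-\<alpha> * s) * zero_extend f s)"
  proof (rule asymp_equiv_refl_ev)
    have fl: "f y = l (exp y)" if "y \<ge> 0" for y using R that unfolding R11_representation_def by blast
    show "\<forall>\<^sub>F s in at_top. exp s powr (-\<alpha>) * l (exp s) = exp (-\<alpha> * s) * zero_extend f s"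
      using eventually_ge_at_top[of 0] by eventually_elim (simp add: zero_extend_eq fl powr_def)
  qed
  finally show ?thesis .
qed

lemma (in prob_space) dist_tail_distr:
  assumes [measurable]: "X \<in> borel_measurable M"
  shows "dist_tail (distr M borel X) x = \<P>(\<omega> in M. X \<omega> > x)"
proof -
  have "cdf (distr M borel X) x = \<P>(\<omega> in M. X \<omega> \<le> x)"
    by (simp add: cdf_def measure_distr vimage_def Int_def conj_commute)
  also have "\<dots> = 1 - \<P>(\<omega> in M. X \<omega> > x)"
    by (subst prob_compl[symmetric]) (auto intro!: arg_cong[where f = prob])
  finally show ?thesis by (simp add: dist_tail_def)
qed

lemma asymp_equiv_exp_to_ln:
  fixes P H E :: "real \<Rightarrow> real"
  assumes "(\<lambda>s. P (exp s)) \<sim>[at_top] (\<lambda>s. c * exp (-\<alpha> * s) * H s)" "H \<sim>[at_top] E"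
  shows "P \<sim>[at_top] (\<lambda>x. c * x powr (-\<alpha>) * E (ln x))"
proof -
  have "(\<lambda>s. P (exp s)) \<sim>[at_top] (\<lambda>s. c * exp (-\<alpha> * s) * E s)"
    by (rule asymp_equiv_trans[OF assms(1)]) (intro asymp_equiv_mult asymp_equiv_refl assms(2))
  from asymp_equiv_compose'[OF this ln_at_top] show ?thesis
  proof (rule asymp_equiv_transfer)
    show "\<forall>\<^sub>F x in at_top. P (exp (ln x)) = P x"
      using eventually_gt_at_top[of 0] by eventually_elim simp
    show "\<forall>\<^sub>F x in at_top. c * exp (-\<alpha> * ln x) * E (ln x) = c * x powr (-\<alpha>) * E (ln x)"
      using eventually_gt_at_top[of 0] by eventually_elim (simp add: powr_def)
  qed
qed

section \<open>The running maximum\<close>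

lemma S_le_S_positive_part:
  assumes "k \<le> n" "\<And>j. j \<in> {1..n} \<Longrightarrow> Y j \<omega> > 0"
  shows "S X Y k \<omega> \<le> S (\<lambda>i \<omega>. max 0 (X i \<omega>)) Y n \<omega>"
proof -
  have p: "(\<Prod>j=1..i. Y j \<omega>) \<ge> 0" if "i \<le> n" for i
    using assms(2) that by (intro prod_nonneg) (force simp: less_eq_real_def)
  have "S X Y k \<omega> \<le> (\<Sum>i=1..k. max 0 (X i \<omega>) * (\<Prod>j=1..i. Y j \<omega>))"
    unfolding S_def using p assms(1) by (intro sum_mono mult_right_mono) auto
  also have "\<dots> \<le> (\<Sum>i=1..n. max 0 (X i \<omega>) * (\<Prod>j=1..i. Y j \<omega>))"
    using p assms(1) by (intro sum_mono2) auto
  finally show ?thesis by (simp add: S_def)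
qed

context prob_space begin

text \<open>
  Taking positive parts makes all summands nonnegative, so the full sum dominates every partial sum of
  the original variables.
\<close>

lemma ruin_prob_between:
  assumes X: "\<And>i. i \<in> {1..n} \<Longrightarrow> X i \<in> borel_measurable M" and Y: "\<And>i. i \<in> {1..n} \<Longrightarrow> Y i \<in> borel_measurable M"
    and Y0: "\<And>i. i \<in> {1..n} \<Longrightarrow> AE \<omega> in M. Y i \<omega> > 0"
  shows "S_tail M X Y x n \<le> ruin_prob M X Y x n"
    and "x \<ge> 0 \<Longrightarrow> ruin_prob M X Y x n \<le> S_tail M (\<lambda>i \<omega>. max 0 (X i \<omega>)) Y x n"
proof -
  have meas: "S Z Y k \<in> borel_measurable M" if "\<And>i. i \<in> {1..n} \<Longrightarrow> Z i \<in> borel_measurable M" "k \<le> n" for Z k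
    unfolding S_def[abs_def] using that Y by (intro borel_measurable_sum borel_measurable_times borel_measurable_prod) auto
  have max_gr: "S_max X Y n \<omega> > x \<longleftrightarrow> (\<exists>k\<in>{0..n}. S X Y k \<omega> > x)" for \<omega>
    unfolding S_max_def by (subst Max_gr_iff) auto
  have "{\<omega> \<in> space M. S_max X Y n \<omega> > x} = (\<Union>k\<in>{0..n}. {\<omega> \<in> space M. S X Y k \<omega> > x})"
    using max_gr by auto
  also have "\<dots> \<in> sets M"
    using meas[OF X] by (intro sets.finite_UN) auto
  finally have sets: "{\<omega> \<in> space M. S_max X Y n \<omega> > x} \<in> sets M" .
  show "S_tail M X Y x n \<le> ruin_prob M X Y x n"
    unfolding S_tail_def ruin_prob_def using max_gr sets by (intro finite_measure_mono) auto
  have "AE \<omega> in M. \<forall>i\<in>{1..n}. Y i \<omega> > 0"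
    using Y0 by (intro AE_finite_allI) auto
  hence "AE \<omega> in M. \<omega> \<in> {\<omega> \<in> space M. S_max X Y n \<omega> > x} \<longrightarrow>
      \<omega> \<in> {\<omega> \<in> space M. S (\<lambda>i \<omega>. max 0 (X i \<omega>)) Y n \<omega> > x}"
  proof eventually_elim
    case (elim \<omega>)
    show ?case
    proof
      assume "\<omega> \<in> {\<omega> \<in> space M. S_max X Y n \<omega> > x}"
      then obtain k where "\<omega> \<in> space M" "k \<le> n" "S X Y k \<omega> > x" using max_gr by auto
      thus "\<omega> \<in> {\<omega> \<in> space M. S (\<lambda>i \<omega>. max 0 (X i \<omega>)) Y n \<omega> > x}"
        using S_le_S_positive_part[of k n Y \<omega> X] elim by force
    qed
  qed
  moreover have "{\<omega> \<in> space M. S (\<lambda>i \<omega>. max 0 (X i \<omega>)) Y n \<omega> > x} \<in> sets M"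
    using meas[of "\<lambda>i \<omega>. max 0 (X i \<omega>)" n] X by auto
  ultimately show "ruin_prob M X Y x n \<le> S_tail M (\<lambda>i \<omega>. max 0 (X i \<omega>)) Y x n"
    unfolding S_tail_def ruin_prob_def by (intro finite_measure_mono_AE)
qed

lemma indep_vars_positive_part:
  fixes X Y :: "nat \<Rightarrow> 'a \<Rightarrow> real"
  assumes "indep_vars (\<lambda>_. borel) (case_sum X Y) I"
  shows "indep_vars (\<lambda>_. borel) (case_sum (\<lambda>i \<omega>. max 0 (X i \<omega>)) Y) I"
proof -
  let ?h = "\<lambda>i :: nat + nat. case i of Inl _ \<Rightarrow> max (0::real) | Inr _ \<Rightarrow> (\<lambda>y. y)"
  have "indep_vars (\<lambda>_. borel) (\<lambda>i. ?h i \<circ> case_sum X Y i) I"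
    by (rule indep_vars_compose[OF assms]) (auto split: sum.split)
  also have "(\<lambda>i. ?h i \<circ> case_sum X Y i) = case_sum (\<lambda>i \<omega>. max 0 (X i \<omega>)) Y"
    by (auto simp: fun_eq_iff split: sum.split)
  finally show ?thesis .
qed

lemma indep_vars_case_sum_measurable:
  fixes X :: "'i \<Rightarrow> 'a \<Rightarrow> real" and Y :: "'j \<Rightarrow> 'a \<Rightarrow> real"
  assumes "indep_vars (\<lambda>_. borel) (case_sum X Y) (I <+> J)"
  shows "i \<in> I \<Longrightarrow> X i \<in> borel_measurable M" and "j \<in> J \<Longrightarrow> Y j \<in> borel_measurable M"
proof -
  have "\<forall>k\<in>I <+> J. random_variable borel (case_sum X Y k)"
    using assms unfolding indep_vars_def by blast
  from bspec[OF this InlI[of i I J]] bspec[OF this InrI[of j J I]]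
  show "i \<in> I \<Longrightarrow> X i \<in> borel_measurable M" and "j \<in> J \<Longrightarrow> Y j \<in> borel_measurable M" by simp_all
qed

text \<open>
  The positive parts of the \<open>X i\<close> have the same right tails as the \<open>X i\<close>, so \<open>tail_S\<close> gives the two
  bounds for the running maximum the same asymptotics.
\<close>

theorem ruin_asymp:
  fixes X Y :: "nat \<Rightarrow> 'a \<Rightarrow> real"
  assumes n: "n \<ge> 1" and \<alpha>: "\<alpha> > 0"
    and ind: "indep_vars (\<lambda>_. borel) (case_sum X Y) ({1..n} <+> {1..n})"
    and Y0: "\<And>i. i \<in> {1..n} \<Longrightarrow> AE \<omega> in M. Y i \<omega> > 0"
    and f: "\<And>i. i \<in> {1..n} \<Longrightarrow> shift_stable (f i)"
    and fs: "\<And>i. i \<in> {1..n} \<Longrightarrow> shift_stable (fs i)"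
    and X: "\<And>i. i \<in> {1..n} \<Longrightarrow> (\<lambda>s. \<P>(\<omega> in M. X i \<omega> > exp s)) \<sim>[at_top] (\<lambda>s. exp (-\<alpha> * s) * f i s)"
    and Y: "\<And>i. i \<in> {1..n} \<Longrightarrow> (\<lambda>s. \<P>(\<omega> in M. Y i \<omega> > exp s)) \<sim>[at_top] (\<lambda>s. exp (-\<alpha> * s) * fs i s)"
    and small: "\<And>k. k \<in> {2..n} \<Longrightarrow> f (k - 1) \<in> o(conv (f k) (fs k))"
    and E: "iter_conv (f n) (\<lambda>m. fs (n - m)) n \<sim>[at_top] E"
  shows "(\<lambda>x. ruin_prob M X Y x n) \<sim>[at_top] (\<lambda>x. S_tail M X Y x n)"
    and "(\<lambda>x. S_tail M X Y x n) \<sim>[at_top] (\<lambda>x. \<alpha> ^ n * x powr (-\<alpha>) * E (ln x))"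
proof -
  let ?X = "\<lambda>i \<omega>. max 0 (X i \<omega>)"
  let ?E = "\<lambda>x. \<alpha> ^ n * x powr (-\<alpha>) * E (ln x)"
  note rv = indep_vars_case_sum_measurable[OF ind]
  show 1: "(\<lambda>x. S_tail M X Y x n) \<sim>[at_top] ?E"
    unfolding S_tail_def
    by (rule asymp_equiv_exp_to_ln[OF tail_S[OF n \<alpha> ind Y0 f fs X Y small] E])
  have "\<And>i s. {\<omega> \<in> space M. max 0 (X i \<omega>) > exp s} = {\<omega> \<in> space M. X i \<omega> > exp s}"
    by (auto simp: less_max_iff_disj not_less[symmetric])
  hence X': "(\<lambda>s. \<P>(\<omega> in M. ?X i \<omega> > exp s)) \<sim>[at_top] (\<lambda>s. exp (-\<alpha> * s) * f i s)" if "i \<in> {1..n}" for i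
    using X[OF that] by simp
  have 2: "(\<lambda>x. S_tail M ?X Y x n) \<sim>[at_top] ?E"
    unfolding S_tail_def
    by (rule asymp_equiv_exp_to_ln[OF tail_S[OF n \<alpha> indep_vars_positive_part[OF ind] Y0 f fs X' Y small] E])
  have "(\<lambda>x. ruin_prob M X Y x n) \<sim>[at_top] ?E"
  proof (rule asymp_equiv_sandwich_real[OF 1 2])
    show "\<forall>\<^sub>F x in at_top. ruin_prob M X Y x n \<in> {S_tail M X Y x n..S_tail M ?X Y x n}"
      using eventually_ge_at_top[of 0]
    proof eventually_elim
      case (elim x)
      thus ?case using ruin_prob_between[of n X Y x] rv Y0 by simp
    qed
  qed
  thus "(\<lambda>x. ruin_prob M X Y x n) \<sim>[at_top] (\<lambda>x. S_tail M X Y x n)"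
    using asymp_equiv_trans asymp_equiv_symI[OF 1] by blast
qed

end

section \<open>The four regimes\<close>

lemma prod_reverse: "(\<Prod>i<n. h (n - i)) = (\<Prod>i=1..n. h i)" for h :: "nat \<Rightarrow> 'b :: comm_monoid_mult"
  by (rule prod.reindex_bij_witness[of _ "\<lambda>i. n - i" "\<lambda>i. n - i"]) auto

lemma sum_reverse: "(\<Sum>i<n. h (n - i)) = (\<Sum>i=1..n. h i)" for h :: "nat \<Rightarrow> 'b :: comm_monoid_add"
  by (rule sum.reindex_bij_witness[of _ "\<lambda>i. n - i" "\<lambda>i. n - i"]) auto

lemma sum_prod_reverse:
  fixes a b :: "nat \<Rightarrow> 'b :: comm_semiring_1"
  shows "(\<Sum>i<n. a (n - i) * (\<Prod>j\<in>{..<n} - {i}. b (n - j))) = (\<Sum>i=1..n. a i * (\<Prod>j\<in>{1..n} - {i}. b j))"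
proof -
  have "(\<Prod>j\<in>{..<n} - {i}. b (n - j)) = (\<Prod>j\<in>{1..n} - {n - i}. b j)" if "i < n" for i
    using that by (intro prod.reindex_bij_witness[of _ "\<lambda>j. n - j" "\<lambda>j. n - j"]) auto
  hence "(\<Sum>i<n. a (n - i) * (\<Prod>j\<in>{..<n} - {i}. b (n - j))) = (\<Sum>i<n. a (n - i) * (\<Prod>j\<in>{1..n} - {n - i}. b j))"
    by (intro sum.cong) auto
  also have "\<dots> = (\<Sum>i=1..n. a i * (\<Prod>j\<in>{1..n} - {i}. b j))"
    by (rule sum_reverse[of "\<lambda>i. a i * (\<Prod>j\<in>{1..n} - {i}. b j)"])
  finally show ?thesis .
qed

theorem theorem3p2:
  fixes M :: "'a measure" and n :: nat and \<alpha> :: real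
    and X Y :: "nat \<Rightarrow> 'a \<Rightarrow> real"
    and F G :: "nat \<Rightarrow> real measure"
    and l ls f fs :: "nat \<Rightarrow> real \<Rightarrow> real"
  assumes "prob_space M" and "n \<ge> 1" and "\<alpha> > 0"
    and "prob_space.indep_vars M (\<lambda>_. borel) (case_sum X Y) ({1..n} <+> {1..n})"
    and "\<And>i. i \<in> {1..n} \<Longrightarrow> distr M borel (X i) = F i"
    and "\<And>i. i \<in> {1..n} \<Longrightarrow> distr M borel (Y i) = G i"
    and "\<And>i. i \<in> {1..n} \<Longrightarrow> AE y in G i. y > 0"
    and "\<And>i. i \<in> {1..n} \<Longrightarrow> nonlattice_log (F i)"
    and "\<And>i. i \<in> {1..n} \<Longrightarrow> nonlattice_log (G i)"
    and "\<And>i. i \<in> {1..n} \<Longrightarrow> F i \<in> R11 \<alpha>"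
    and "\<And>i. i \<in> {1..n} \<Longrightarrow> G i \<in> R11 \<alpha>"
    and "\<And>i. i \<in> {1..n} \<Longrightarrow> R11_representation \<alpha> (F i) (l i) (f i)"
    and "\<And>i. i \<in> {1..n} \<Longrightarrow> R11_representation \<alpha> (G i) (ls i) (fs i)"
    and "\<And>k. k \<in> {2..n} \<Longrightarrow> f (k - 1) \<in> o(conv (f k) (fs k))"
  shows
    "(\<forall>\<gamma> \<gamma>s :: nat \<Rightarrow> real.
        (\<forall>i\<in>{1..n}. \<gamma> i > -1 \<and> regularly_varying (\<gamma> i) (f i) \<and>
                    \<gamma>s i > -1 \<and> regularly_varying (\<gamma>s i) (fs i)) \<longrightarrow>
        (\<lambda>x. ruin_prob M X Y x n) \<sim>[at_top] (\<lambda>x. S_tail M X Y x n) \<and>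
        (\<lambda>x. S_tail M X Y x n) \<sim>[at_top]
          (\<lambda>x. \<alpha> ^ n * x powr (-\<alpha>) * (ln x) ^ n * f n (ln x) * (\<Prod>i=1..n. fs i (ln x)) *
             (\<Prod>j=1..n. Beta (\<gamma> n + (\<Sum>k=1..j-1. \<gamma>s k) + real j) (\<gamma>s j + 1)))) \<and>
     ((\<forall>i\<in>{1..n}. regularly_varying (-1) (f i) \<and> regularly_varying (-1) (fs i)) \<longrightarrow>
        (\<lambda>x. ruin_prob M X Y x n) \<sim>[at_top] (\<lambda>x. S_tail M X Y x n) \<and>
        (\<lambda>x. S_tail M X Y x n) \<sim>[at_top]
          (\<lambda>x. \<alpha> ^ n * x powr (-\<alpha>) *
             (f n (ln x) * (\<Prod>i=1..n. integ (fs i) (ln x)) +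
              integ (f n) (ln x) *
                (\<Sum>i=1..n. fs i (ln x) * (\<Prod>j\<in>{1..n} - {i}. integ (fs j) (ln x)))))) \<and>
     (\<forall>\<gamma>s :: nat \<Rightarrow> real.
        (\<forall>i\<in>{1..n}. regularly_varying (-1) (f i) \<and>
                    \<gamma>s i > -1 \<and> regularly_varying (\<gamma>s i) (fs i)) \<longrightarrow>
        (\<lambda>x. ruin_prob M X Y x n) \<sim>[at_top] (\<lambda>x. S_tail M X Y x n) \<and>
        (\<lambda>x. S_tail M X Y x n) \<sim>[at_top]
          (\<lambda>x. \<alpha> ^ n * x powr (-\<alpha>) * (ln x) ^ (n - 1) * integ (f n) (ln x) *
             (\<Prod>i=1..n. fs i (ln x)) *
             (\<Prod>j=1..n-1. Beta ((\<Sum>k=1..j. \<gamma>s k) + real j) (\<gamma>s (j + 1) + 1)))) \<and>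
     (\<forall>\<gamma> :: nat \<Rightarrow> real.
        (\<forall>i\<in>{1..n}. \<gamma> i > -1 \<and> regularly_varying (\<gamma> i) (f i) \<and>
                    regularly_varying (-1) (fs i)) \<longrightarrow>
        (\<lambda>x. ruin_prob M X Y x n) \<sim>[at_top] (\<lambda>x. S_tail M X Y x n) \<and>
        (\<lambda>x. S_tail M X Y x n) \<sim>[at_top]
          (\<lambda>x. \<alpha> ^ n * x powr (-\<alpha>) * f n (ln x) * (\<Prod>i=1..n. integ (fs i) (ln x))))"
proof -
  interpret prob_space M by (rule assms(1))
  note n = assms(2) and \<alpha> = assms(3) and ind = assms(4)
  define g where "g i = zero_extend (f i)" for i
  define gs where "gs i = zero_extend (fs i)" for i
  define \<phi> where "\<phi> m = gs (n - m)" for m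
  define H where "H = iter_conv (g n) \<phi> n"
  have gn: "g n s = f n s" if "s \<ge> 0" for s using that by (simp add: g_def zero_extend_eq)
  have \<phi>n: "\<phi> m s = fs (n - m) s" if "s \<ge> 0" for m s using that by (simp add: \<phi>_def gs_def zero_extend_eq)
  have ig: "integ (g i) = integ (f i)" and i\<phi>: "integ (\<phi> m) = integ (fs (n - m))" for i m
    by (simp_all add: g_def \<phi>_def gs_def integ_zero_extend)
  note rv = indep_vars_case_sum_measurable[OF ind]
  have Y0: "AE \<omega> in M. Y i \<omega> > 0" if "i \<in> {1..n}" for i
  proof -
    have "AE y in distr M borel (Y i). y > 0"
      using assms(7)[OF that] unfolding assms(6)[OF that, symmetric] .
    thus ?thesis using rv(2)[OF that] by (subst (asm) AE_distr_iff) auto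
  qed
  have gst: "shift_stable (g i)" and gsst: "shift_stable (gs i)" if "i \<in> {1..n}" for i
    unfolding g_def gs_def
    by (rule shift_stable_zero_extend[OF assms(12)[OF that]], rule shift_stable_zero_extend[OF assms(13)[OF that]])
  have \<phi>st: "shift_stable (\<phi> m)" if "m < n" for m unfolding \<phi>_def using that by (intro gsst) auto
  have Xt: "(\<lambda>s. \<P>(\<omega> in M. X i \<omega> > exp s)) \<sim>[at_top] (\<lambda>s. exp (-\<alpha> * s) * g i s)" if "i \<in> {1..n}" for i
    using dist_tail_exp[OF assms(12)[OF that]] assms(5)[OF that, symmetric] dist_tail_distr[OF rv(1)[OF that]]
    by (simp add: g_def)
  have Yt: "(\<lambda>s. \<P>(\<omega> in M. Y i \<omega> > exp s)) \<sim>[at_top] (\<lambda>s. exp (-\<alpha> * s) * gs i s)" if "i \<in> {1..n}" for i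
    using dist_tail_exp[OF assms(13)[OF that]] assms(6)[OF that, symmetric] dist_tail_distr[OF rv(2)[OF that]]
    by (simp add: gs_def)
  have small: "g (k - 1) \<in> o(conv (g k) (gs k))" if "k \<in> {2..n}" for k
  proof -
    have "g (k - 1) \<in> O(f (k - 1))" unfolding g_def
      by (rule asymp_equiv_imp_bigo[OF asymp_equiv_refl_ev[OF eventually_zero_extend]])
    also have "f (k - 1) \<in> o(conv (f k) (fs k))" by (rule assms(14)[OF that])
    finally show ?thesis by (simp add: g_def gs_def conv_zero_extend)
  qed
  have concl: "(\<lambda>x. ruin_prob M X Y x n) \<sim>[at_top] (\<lambda>x. S_tail M X Y x n) \<and>
      (\<lambda>x. S_tail M X Y x n) \<sim>[at_top] (\<lambda>x. \<alpha> ^ n * x powr (-\<alpha>) * E (ln x))"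
    if "H \<sim>[at_top] E" for E
  proof -
    have E: "iter_conv (g n) (\<lambda>m. gs (n - m)) n \<sim>[at_top] E"
      using that by (simp add: H_def \<phi>_def[abs_def])
    show ?thesis
      using ruin_asymp[OF n \<alpha> ind Y0 gst gsst Xt Yt small E] by blast
  qed
  have eventually_eq: "H \<sim>[at_top] E'" if "H \<sim>[at_top] E" "\<And>s. s \<ge> 0 \<Longrightarrow> E s = E' s" for E E'
  proof (rule asymp_equiv_trans[OF that(1) asymp_equiv_refl_ev])
    show "\<forall>\<^sub>F s in at_top. E s = E' s" using eventually_ge_at_top[of 0] by eventually_elim (rule that(2))
  qed
  have prod_fs: "(\<Prod>i<n. \<phi> i s) = (\<Prod>i=1..n. fs i s)" if "s \<ge> 0" for s
    using prod_reverse[of "\<lambda>i. fs i s" n] \<phi>n[OF that] by simp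
  have prod_integ: "(\<Prod>i<n. integ (\<phi> i) s) = (\<Prod>i=1..n. integ (fs i) s)" for s
    using prod_reverse[of "\<lambda>i. integ (fs i) s" n] by (simp add: i\<phi>)
  have nn: "n \<in> {1..n}" using n by simp
  show ?thesis
  proof (intro conjI allI impI)
    fix \<gamma> \<gamma>s :: "nat \<Rightarrow> real"
    assume A: "\<forall>i\<in>{1..n}. \<gamma> i > -1 \<and> regularly_varying (\<gamma> i) (f i) \<and> \<gamma>s i > -1 \<and> regularly_varying (\<gamma>s i) (fs i)"
    let ?E = "\<lambda>s. s ^ n * f n s * (\<Prod>i=1..n. fs i s) * (\<Prod>j=1..n. Beta (\<gamma> n + (\<Sum>k=1..j-1. \<gamma>s k) + real j) (\<gamma>s j + 1))"
    have g: "scales (\<gamma> n) (g n)" unfolding g_def using A nn by (intro regularly_varying_scales) auto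
    have \<phi>: "scales (\<gamma>s (n - i)) (\<phi> i)" "\<gamma>s (n - i) > -1" if "i < n" for i
      unfolding \<phi>_def gs_def using A that by (auto intro!: regularly_varying_scales)
    have B: "(\<Prod>j=1..n. Beta (\<gamma> n + (\<Sum>k=1..j-1. \<gamma>s k) + real j) (\<gamma>s j + 1)) =
       Gamma (\<gamma> n + 1) * (\<Prod>i<n. Gamma (\<gamma>s (n - i) + 1)) / Gamma (\<gamma> n + (\<Sum>i<n. \<gamma>s (n - i)) + n + 1)"
      unfolding prod_reverse[of "\<lambda>i. Gamma (\<gamma>s i + 1)" n] sum_reverse[of \<gamma>s n]
      using A nn by (intro Beta_telescope) auto
    have "H \<sim>[at_top] ?E"
      unfolding H_def B
      by (rule eventually_eq[unfolded H_def, OF iter_conv_asymp_Beta[OF gst[OF nn] g _ \<phi>st \<phi>, THEN conjunct1]])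
         (use A nn in \<open>auto simp: prod_fs gn\<close>)
    from concl[OF this]
    show "(\<lambda>x. ruin_prob M X Y x n) \<sim>[at_top] (\<lambda>x. S_tail M X Y x n)"
      and "(\<lambda>x. S_tail M X Y x n) \<sim>[at_top]
          (\<lambda>x. \<alpha> ^ n * x powr (-\<alpha>) * (ln x) ^ n * f n (ln x) * (\<Prod>i=1..n. fs i (ln x)) *
             (\<Prod>j=1..n. Beta (\<gamma> n + (\<Sum>k=1..j-1. \<gamma>s k) + real j) (\<gamma>s j + 1)))"
      by (simp_all only: mult.assoc)
  next
    assume A: "\<forall>i\<in>{1..n}. regularly_varying (-1) (f i) \<and> regularly_varying (-1) (fs i)"
    let ?E = "\<lambda>s. f n s * (\<Prod>i=1..n. integ (fs i) s) + integ (f n) s * (\<Sum>i=1..n. fs i s * (\<Prod>j\<in>{1..n} - {i}. integ (fs j) s))"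
    have g: "scales (-1) (g n)" unfolding g_def using A nn by (intro regularly_varying_scales) auto
    have \<phi>: "scales (-1) (\<phi> i)" if "i < n" for i
      unfolding \<phi>_def gs_def using A that by (auto intro!: regularly_varying_scales)
    have "(\<Sum>i<n. \<phi> i s * (\<Prod>j\<in>{..<n} - {i}. integ (\<phi> j) s)) = (\<Sum>i=1..n. fs i s * (\<Prod>j\<in>{1..n} - {i}. integ (fs j) s))" if "s \<ge> 0" for s
      using sum_prod_reverse[of "\<lambda>i. fs i s" n "\<lambda>i. integ (fs i) s"] by (simp add: \<phi>n[OF that] i\<phi>)
    hence "H \<sim>[at_top] ?E"
      unfolding H_def
      by (intro eventually_eq[unfolded H_def, OF iter_conv_asymp_product_rule[OF gst[OF nn] g \<phi>st \<phi>, THEN conjunct1]])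
         (auto simp: prod_integ gn ig)
    from concl[OF this]
    show "(\<lambda>x. ruin_prob M X Y x n) \<sim>[at_top] (\<lambda>x. S_tail M X Y x n)"
      and "(\<lambda>x. S_tail M X Y x n) \<sim>[at_top]
          (\<lambda>x. \<alpha> ^ n * x powr (-\<alpha>) *
             (f n (ln x) * (\<Prod>i=1..n. integ (fs i) (ln x)) +
              integ (f n) (ln x) *
                (\<Sum>i=1..n. fs i (ln x) * (\<Prod>j\<in>{1..n} - {i}. integ (fs j) (ln x)))))"
      by blast+
  next
    fix \<gamma>s :: "nat \<Rightarrow> real"
    assume A: "\<forall>i\<in>{1..n}. regularly_varying (-1) (f i) \<and> \<gamma>s i > -1 \<and> regularly_varying (\<gamma>s i) (fs i)"
    obtain m where m: "n = Suc m" using n by (cases n) auto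
    let ?B = "\<Prod>j=1..n-1. Beta ((\<Sum>k=1..j. \<gamma>s k) + real j) (\<gamma>s (j + 1) + 1)"
    let ?E = "\<lambda>s. s ^ (n - 1) * integ (f n) s * (\<Prod>i=1..n. fs i s) * ?B"
    have g: "scales (-1) (g n)" unfolding g_def using A nn by (intro regularly_varying_scales) auto
    have \<phi>: "scales (\<gamma>s (n - i)) (\<phi> i)" "\<gamma>s (n - i) > -1" "shift_stable (\<phi> i)" if "i \<le> m" for i
      using A that \<phi>st[of i] m unfolding \<phi>_def gs_def by (auto intro!: regularly_varying_scales)
    have split1: "(\<Sum>k=1..Suc j. \<gamma>s k) = \<gamma>s 1 + (\<Sum>k=1..j. \<gamma>s (k + 1))" for j
      by (induction j) simp_all
    have split2: "(\<Prod>k=1..Suc j. Gamma (\<gamma>s k + 1)) = Gamma (\<gamma>s 1 + 1) * (\<Prod>k=1..j. Gamma (\<gamma>s (k + 1) + 1))" for j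
      by (induction j) simp_all
    \<comment> \<open>The product telescopes from \<open>\<gamma>s 1\<close>, the iterated convolution from \<open>\<gamma>s n\<close>; the quotient is the same.\<close>
    have "?B = (\<Prod>j=1..m. Beta (\<gamma>s 1 + (\<Sum>k=1..j-1. \<gamma>s (k + 1)) + real j) (\<gamma>s (j + 1) + 1))"
      unfolding m
    proof (rule prod.cong)
      fix j assume "j \<in> {1..m}"
      then obtain i where j: "j = Suc i" by (cases j) auto
      show "Beta ((\<Sum>k=1..j. \<gamma>s k) + real j) (\<gamma>s (j + 1) + 1) =
         Beta (\<gamma>s 1 + (\<Sum>k=1..j-1. \<gamma>s (k + 1)) + real j) (\<gamma>s (j + 1) + 1)"
        unfolding j split1 by simp
    qed simp
    also have "\<dots> = Gamma (\<gamma>s 1 + 1) * (\<Prod>j=1..m. Gamma (\<gamma>s (j + 1) + 1)) / Gamma (\<gamma>s 1 + (\<Sum>k=1..m. \<gamma>s (k + 1)) + m + 1)"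
      using A m by (intro Beta_telescope) auto
    also have "\<dots> = (\<Prod>i=1..n. Gamma (\<gamma>s i + 1)) / Gamma ((\<Sum>i=1..n. \<gamma>s i) + m + 1)"
      unfolding m split1 split2 ..
    also have "\<dots> = (\<Prod>i<Suc m. Gamma (\<gamma>s (n - i) + 1)) / Gamma ((\<Sum>i<Suc m. \<gamma>s (n - i)) + m + 1)"
      unfolding m prod_reverse[of "\<lambda>i. Gamma (\<gamma>s i + 1)" "Suc m"] sum_reverse[of \<gamma>s "Suc m"] ..
    finally have B: "?B = (\<Prod>i<Suc m. Gamma (\<gamma>s (n - i) + 1)) / Gamma ((\<Sum>i<Suc m. \<gamma>s (n - i)) + m + 1)" .
    have "iter_conv (g n) \<phi> (Suc m) \<sim>[at_top] (\<lambda>s. s ^ m * integ (g n) s * (\<Prod>i<Suc m. \<phi> i s) * ?B)"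
      unfolding B
      by (rule iter_conv_asymp_mixed[OF gst[OF nn] g]) (use \<phi> in auto)
    hence H: "H \<sim>[at_top] (\<lambda>s. s ^ (n - 1) * integ (g n) s * (\<Prod>i<n. \<phi> i s) * ?B)"
      unfolding H_def by (simp only: m diff_Suc_1)
    have "H \<sim>[at_top] ?E"
      by (rule eventually_eq[OF H]) (simp only: prod_fs ig)
    from concl[OF this]
    show "(\<lambda>x. ruin_prob M X Y x n) \<sim>[at_top] (\<lambda>x. S_tail M X Y x n)"
      and "(\<lambda>x. S_tail M X Y x n) \<sim>[at_top]
          (\<lambda>x. \<alpha> ^ n * x powr (-\<alpha>) * (ln x) ^ (n - 1) * integ (f n) (ln x) *
             (\<Prod>i=1..n. fs i (ln x)) *
             (\<Prod>j=1..n-1. Beta ((\<Sum>k=1..j. \<gamma>s k) + real j) (\<gamma>s (j + 1) + 1)))"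
      by (simp_all only: mult.assoc)
  next
    fix \<gamma> :: "nat \<Rightarrow> real"
    assume A: "\<forall>i\<in>{1..n}. \<gamma> i > -1 \<and> regularly_varying (\<gamma> i) (f i) \<and> regularly_varying (-1) (fs i)"
    let ?E = "\<lambda>s. f n s * (\<Prod>i=1..n. integ (fs i) s)"
    have g: "scales (\<gamma> n) (g n)" "\<gamma> n > -1"
      unfolding g_def using A nn by (auto intro!: regularly_varying_scales)
    have \<phi>: "scales (-1) (\<phi> i)" if "i < n" for i
      unfolding \<phi>_def gs_def using A that by (auto intro!: regularly_varying_scales)
    have "H \<sim>[at_top] ?E"
      unfolding H_def
      by (rule eventually_eq[unfolded H_def, OF iter_conv_asymp_integ[OF gst[OF nn] g \<phi>st \<phi>, THEN conjunct1]])
         (auto simp: prod_integ gn)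
    from concl[OF this]
    show "(\<lambda>x. ruin_prob M X Y x n) \<sim>[at_top] (\<lambda>x. S_tail M X Y x n)"
      and "(\<lambda>x. S_tail M X Y x n) \<sim>[at_top]
          (\<lambda>x. \<alpha> ^ n * x powr (-\<alpha>) * f n (ln x) * (\<Prod>i=1..n. integ (fs i) (ln x)))"
      by (simp_all only: mult.assoc)
  qed
qed

end
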